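(* Let $q,\widetilde q\in L_1(0,\pi)$ be real-valued, let $f,F,\widetilde F\in\mathscr R$ with $\operatorname{ind} f\ge\operatorname{ind} F$, and let $\{\lambda_n\}_{n\ge0}$ and $\{\widetilde\lambda_n\}_{n\ge0}$ denote the eigenvalues (in increasing order) of the problems $\mathscr P(q,f,F)$ and $\mathscr P(\widetilde q,f,\widetilde F)$ respectively. If $q(x)=\widetilde q(x)$ a.e. on $[0,\pi/2]$ and $\lambda_n=\widetilde\lambda_n$ for all $n\ge0$, then $(q,f,F)=(\widetilde q,f,\widetilde F)$, i.e. $q=\widetilde q$ a.e. on $[0,\pi]$ and $F=\widetilde F$.
   Context: $\mathscr R$ is the set consisting of the symbol $\infty$ together with all rational functions $f(\lambda)=h_0\lambda+h+\sum_{k=1}^d\frac{\delta_k}{h_k-\lambda}$ ($d\ge 0$) with real coefficients, $h_0\ge 0$, $\delta_k>0$, $h_1<\dots<h_d$. The index is $\operatorname{ind} f=2d+1$ if $h_0>0$, $\operatorname{ind} f=2d$ if $h_0=0$, and $\operatorname{ind}\infty=-1$. For $f\neq\infty$ put $f_\downarrow(\lambda)=h_0'\prod_{k=1}^d(h_k-\lambda)$ with $h_0'=1/h_0$ if $h_0>0$ and $h_0'=1$ if $h_0=0$, and $f_\uparrow=f\cdot f_\downarrow$ (a polynomial); for $f=\infty$ put $f_\uparrow=-1$, $f_\downarrow=0$. $\mathscr P(q,f,F)$ is the boundary value problem $-y''+q(x)y=\lambda y$ on $(0,\pi)$, $\frac{y'(0)}{y(0)}=-f(\lambda)$, $\frac{y'(\pi)}{y(\pi)}=F(\lambda)$,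 i.e. $f_\downarrow(\lambda)y'(0)+f_\uparrow(\lambda)y(0)=0$ and $F_\downarrow(\lambda)y'(\pi)-F_\uparrow(\lambda)y(\pi)=0$ (so $\infty$ means a Dirichlet condition). Its eigenvalues are real and simple and form an increasing sequence tending to $+\infty$. *)

theory Defs
  imports "HOL-Analysis.Analysis" "HOL-Computational_Algebra.Polynomial"
begin

section \<open>The class of boundary coefficients\<close>

text \<open>
  \<open>Ratl h0 h [(h\<^sub>1, \<delta>\<^sub>1), \<dots>, (h\<^sub>d, \<delta>\<^sub>d)]\<close> stands for the rational function
  \<open>h0 \<lambda> + h + \<Sum>k. \<delta>\<^sub>k / (h\<^sub>k - \<lambda>)\<close>.  On \<open>class_R\<close> below this representation is unique
  (lemma \<open>class_R_eqI\<close>), so equality of data is equality of rational functions.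
\<close>

datatype bcoeff = Infty | Ratl real real "(real \<times> real) list"

definition class_R :: "bcoeff set" where
  "class_R = insert Infty
     {Ratl h0 h ps | h0 h ps. h0 \<ge> 0 \<and> (\<forall>k<length ps. snd (ps ! k) > 0) \<and>
        sorted_wrt (<) (map fst ps)}"

fun ratval :: "bcoeff \<Rightarrow> real \<Rightarrow> real" where
  "ratval Infty x = undefined"
| "ratval (Ratl h0 h ps) x =
     h0 * x + h + (\<Sum>k<length ps. snd (ps ! k) / (fst (ps ! k) - x))"

fun poles :: "bcoeff \<Rightarrow> real set" where
  "poles Infty = {}"
| "poles (Ratl h0 h ps) = fst ` set ps"

fun ind :: "bcoeff \<Rightarrow> int" where
  "ind Infty = - 1"
| "ind (Ratl h0 h ps) =
     (if h0 > 0 then 2 * int (length ps) + 1 else 2 * int (length ps))"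

definition lead_norm :: "real \<Rightarrow> real" where
  "lead_norm h0 = (if h0 > 0 then 1 / h0 else 1)"

fun down :: "bcoeff \<Rightarrow> real poly" where
  "down Infty = 0"
| "down (Ratl h0 h ps) =
     smult (lead_norm h0) (\<Prod>k<length ps. [:fst (ps ! k), - 1:])"

text \<open>
  The product of the function with \<open>down\<close>, with the poles cancelled; see \<open>poly_up\<close>.
\<close>

fun up :: "bcoeff \<Rightarrow> real poly" where
  "up Infty = - 1"
| "up (Ratl h0 h ps) =
     [:h, h0:] * down (Ratl h0 h ps) +
     smult (lead_norm h0)
       (\<Sum>k<length ps. smult (snd (ps ! k))
          (\<Prod>j\<in>{..<length ps} - {k}. [:fst (ps ! j), - 1:]))"

lemma poly_up:
  assumes "f \<noteq> Infty" "x \<notin> poles f"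
  shows "poly (up f) x = ratval f x * poly (down f) x"
proof -
  obtain h0 h ps where f: "f = Ratl h0 h ps"
    using assms(1) by (cases f) auto
  define n where "n = length ps"
  define P where "P = (\<lambda>A. \<Prod>j\<in>A. (fst (ps ! j) - x))"
  have nz: "fst (ps ! k) - x \<noteq> 0" if "k < n" for k
    using assms(2) that unfolding f n_def by (force simp: image_iff in_set_conv_nth)
  have P: "P ({..<n} - {k}) = P {..<n} / (fst (ps ! k) - x)" if "k < n" for k
    using nz[OF that] prod.remove[of "{..<n}" k "\<lambda>j. fst (ps ! j) - x"] that
    by (simp add: P_def)
  have pd: "poly (down f) x = lead_norm h0 * P {..<n}"
    by (simp add: f n_def P_def poly_prod)
  have "poly (up f) x = (h + x * h0) * poly (down f) x +
      lead_norm h0 * (\<Sum>k<n. snd (ps ! k) * P ({..<n} - {k}))"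
    unfolding f up.simps poly_add poly_mult poly_smult poly_sum
    by (simp add: n_def P_def poly_prod)
  also have "(\<Sum>k<n. snd (ps ! k) * P ({..<n} - {k})) =
      (\<Sum>k<n. snd (ps ! k) / (fst (ps ! k) - x)) * P {..<n}"
    unfolding sum_distrib_right by (rule sum.cong) (auto simp: P)
  finally show ?thesis
    unfolding pd by (simp add: f n_def algebra_simps)
qed

lemma class_R_eqI:
  assumes "f \<in> class_R" "g \<in> class_R" "f \<noteq> Infty" "g \<noteq> Infty"
    and eq: "\<And>x. x \<notin> poles f \<union> poles g \<Longrightarrow> ratval f x = ratval g x"
  shows "f = g"
proof -
  obtain h0 h ps where f: "f = Ratl h0 h ps" using assms(3) by (cases f) auto
  obtain h0' h' qs where g: "g = Ratl h0' h' qs" using assms(4) by (cases g) auto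
  define res :: "(real \<times> real) list \<Rightarrow> real \<Rightarrow> real" where "res = (\<lambda>ps a. \<Sum>p\<leftarrow>ps. if fst p = a then snd p else (0::real))"
  have lim: "((\<lambda>x. (a - x) * ratval (Ratl h0 h ps) x) \<longlongrightarrow> res ps a) (at a)"
    for h0 h ps a
  proof -
    have 1: "((\<lambda>x. (a - x) * (d / (k - x))) \<longlongrightarrow> (if k = a then d else 0)) (at a)"
      for k d :: real
    proof (cases "k = a")
      case True
      have "eventually (\<lambda>x. (a - x) * (d / (k - x)) = d) (at a)"
        using True by (auto simp: eventually_at_filter)
      then show ?thesis using True by (simp add: tendsto_eventually)
    next
      case False
      have "((\<lambda>x. (a - x) * (d / (k - x))) \<longlongrightarrow> (a - a) * (d / (k - a))) (at a)"
        by (intro tendsto_intros) (use False in auto)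
      then show ?thesis using False by simp
    qed
    have "((\<lambda>x. (a - x) * (h0 * x + h) +
        (\<Sum>k<length ps. (a - x) * (snd (ps ! k) / (fst (ps ! k) - x)))) \<longlongrightarrow>
        (a - a) * (h0 * a + h) +
        (\<Sum>k<length ps. if fst (ps ! k) = a then snd (ps ! k) else 0)) (at a)"
      by (intro tendsto_add tendsto_sum 1 tendsto_intros)
    then show ?thesis
      by (simp add: res_def sum_list_sum_nth atLeast0LessThan sum_distrib_left distrib_left)
  qed
  have fin: "finite (poles f \<union> poles g)" by (simp add: f g)
  have res: "res ps a = res qs a" for a
  proof -
    have "open (- (poles f \<union> poles g - {a}))"
      by (intro open_Compl finite_imp_closed finite_Diff fin)
    then have ev: "eventually (\<lambda>x. x \<notin> poles f \<union> poles g - {a}) (at a)"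
      unfolding eventually_at_topological by blast
    have ev': "eventually (\<lambda>x. (a - x) * ratval f x = (a - x) * ratval g x) (at a)"
      using ev eventually_neq_at_within[of a a UNIV]
      by eventually_elim (use eq in auto)
    have "((\<lambda>x. (a - x) * ratval g x) \<longlongrightarrow> res ps a) (at a)"
      using lim[of a h0 h ps] tendsto_cong[OF ev'] by (simp only: f)
    moreover have "((\<lambda>x. (a - x) * ratval g x) \<longlongrightarrow> res qs a) (at a)"
      using lim[of a h0' h' qs] by (simp only: g)
    ultimately show ?thesis
      by (rule LIM_unique)
  qed
  have mem: "set ps = {(a, d). d = res ps a \<and> d \<noteq> 0}"
    if "sorted_wrt (<) (map fst ps)" "\<forall>k<length ps. snd (ps ! k) > 0" for ps
  proof -
    have pos: "\<forall>p\<in>set ps. snd p > 0" using that(2) by (metis in_set_conv_nth)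
    have dist: "distinct (map fst ps)" using that(1) strict_sorted_iff by blast
    have 1: "res ps a = d" if "(a, d) \<in> set ps" "distinct (map fst ps)" for a d ps
      using that
    proof (induction ps)
      case (Cons p ps)
      have 0: "res ps b = 0" if "b \<notin> fst ` set ps" for b
        unfolding res_def using that
        by (induction ps) auto
      show ?case
      proof (cases "p = (a, d)")
        case True
        then show ?thesis using Cons.prems 0[of a] by (simp add: res_def)
      next
        case False
        then have in_ps: "(a, d) \<in> set ps" using Cons.prems by auto
        then have "a \<in> fst ` set ps" by force
        then have "fst p \<noteq> a" using Cons.prems by auto
        then have "res (p # ps) a = res ps a" by (simp add: res_def)
        then show ?thesis using Cons.IH[OF in_ps] Cons.prems by simp
      qed
    qed simp
    have 2: "a \<in> fst ` set ps" if "res ps a \<noteq> 0" for a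
    proof (rule ccontr)
      assume "a \<notin> fst ` set ps"
      then have "res ps a = 0" unfolding res_def by (induction ps) auto
      with that show False by simp
    qed
    show ?thesis using 1 2 pos dist by fastforce
  qed
  have "set ps = set qs"
    using mem[of ps] mem[of qs] res assms(1,2) by (auto simp: f g class_R_def)
  moreover have "sorted_wrt (<) (map fst ps)" "sorted_wrt (<) (map fst qs)"
    using assms(1,2) by (auto simp: f g class_R_def)
  ultimately have ps: "ps = qs"
  proof -
    assume *: "set ps = set qs" "sorted_wrt (<) (map fst ps)" "sorted_wrt (<) (map fst qs)"
    have m: "map fst ps = map fst qs"
      using * by (intro strict_sorted_equal) auto
    have "distinct (map fst ps)" using *(2) strict_sorted_iff by blast
    then have inj: "inj_on fst (set ps \<union> set qs)" using *(1) by (simp add: distinct_map)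
    show ?thesis using map_inj_on[OF m inj] .
  qed
  have inf: "infinite (- (poles f \<union> poles g))"
    using fin by (simp add: Compl_eq_Diff_UNIV infinite_UNIV_char_0)
  then obtain x where x: "x \<notin> poles f \<union> poles g"
    by (metis Compl_iff ex_in_conv finite.emptyI)
  have "infinite (- (poles f \<union> poles g) - {x})" using inf by simp
  then obtain y where y: "y \<notin> poles f \<union> poles g" "y \<noteq> x"
    by (metis Compl_iff DiffE ex_in_conv finite.emptyI singletonI)
  have e: "h0 * x + h = h0' * x + h'" "h0 * y + h = h0' * y + h'"
    using eq[OF x] eq[OF y(1)] by (simp_all add: f g ps)
  then have "(h0 - h0') * (x - y) = 0" by (simp add: algebra_simps)
  then have "h0 = h0'" using y(2) by simp
  with e show ?thesis by (simp add: f g ps)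
qed


section \<open>The boundary value problem\<close>

text \<open>\<open>u\<close> is absolutely continuous on \<open>[0, pi]\<close> with \<open>u' = g\<close> almost everywhere.\<close>

definition has_ac_derivative :: "(real \<Rightarrow> complex) \<Rightarrow> (real \<Rightarrow> complex) \<Rightarrow> bool" where
  "has_ac_derivative u g \<longleftrightarrow>
     g absolutely_integrable_on {0..pi} \<and>
     (\<forall>x\<in>{0..pi}. (g has_integral (u x - u 0)) {0..x})"

text \<open>
  Here \<open>y1\<close> is \<open>y'\<close> (everywhere on \<open>[0, pi]\<close>, since it is continuous) and \<open>y2\<close> is \<open>y''\<close>
  (almost everywhere).
\<close>

definition is_solution ::
  "(real \<Rightarrow> real) \<Rightarrow> complex \<Rightarrow> (real \<Rightarrow> complex) \<Rightarrow> (real \<Rightarrow> complex) \<Rightarrow> bool" where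
  "is_solution q z y y1 \<longleftrightarrow>
     has_ac_derivative y y1 \<and>
     (\<exists>y2. has_ac_derivative y1 y2 \<and>
        (AE x in lebesgue_on {0..pi}. - y2 x + of_real (q x) * y x = z * y x))"

abbreviation cpoly :: "real poly \<Rightarrow> complex \<Rightarrow> complex" where
  "cpoly p z \<equiv> poly (map_poly complex_of_real p) z"

definition is_eigenvalue ::
  "(real \<Rightarrow> real) \<Rightarrow> bcoeff \<Rightarrow> bcoeff \<Rightarrow> complex \<Rightarrow> bool" where
  "is_eigenvalue q f F z \<longleftrightarrow>
     (\<exists>y y1. is_solution q z y y1 \<and> (\<exists>x\<in>{0..pi}. y x \<noteq> 0) \<and>
        cpoly (down f) z * y1 0 + cpoly (up f) z * y 0 = 0 \<and>
        cpoly (down F) z * y1 pi - cpoly (up F) z * y pi = 0)"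

text \<open>
  \<open>lam\<close> is the increasing enumeration of all eigenvalues (which are real and simple).
\<close>

definition eigenvalue_sequence ::
  "(real \<Rightarrow> real) \<Rightarrow> bcoeff \<Rightarrow> bcoeff \<Rightarrow> (nat \<Rightarrow> real) \<Rightarrow> bool" where
  "eigenvalue_sequence q f F lam \<longleftrightarrow>
     strict_mono lam \<and> range (\<lambda>n. complex_of_real (lam n)) = {z. is_eigenvalue q f F z}"

end

theory Submission
  imports Defs "HOL-Complex_Analysis.Complex_Analysis" "HOL-Real_Asymp.Real_Asymp"
begin

text \<open>
  Let \<open>\<psi>\<close> and \<open>\<psi>'\<close> be the solutions for \<open>q\<close> and \<open>q'\<close> that satisfy the boundary conditions at the right
  end point.  At a common eigenvalue they are multiples of eigenfunctions which agree up to a factor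
  on the left half, so their Wronskian \<open>H(\<lambda>)\<close> at \<open>pi / 2\<close> vanishes there.  The characteristic function \<open>X\<close>
  of the second problem has only simple zeros, because the boundary coefficients are Herglotz functions;
  hence \<open>H / X\<close> is entire.  With \<open>\<lambda> = - k\<^sup>2\<close> and \<open>s = \<bar>Re k\<bar>\<close>, \<open>H\<close> has size at most
  \<open>\<bar>k\<bar> ^ (ind F + ind F' + 1) * exp (s * pi)\<close>, and \<open>X\<close> has size \<open>\<bar>k\<bar> ^ (ind f + ind F' + 1) * exp (s * pi)\<close>
  on large squares in the \<open>k\<close>-plane.  As \<open>ind F \<le> ind f\<close>, the quotient is bounded; it tends to \<open>0\<close> along real
  \<open>k\<close>, so \<open>H = 0\<close> by Liouville, and both problems have the same Weyl function at \<open>pi / 2\<close>.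

  For the solutions \<open>C, S\<close> and \<open>C', S'\<close> with Cauchy data \<open>(1, 0)\<close>, \<open>(0, 1)\<close> at \<open>pi / 2\<close>, equality of the Weyl
  functions makes \<open>S C' - S' C\<close> an entire function of \<open>\<lambda>\<close> of size \<open>O(1 / \<bar>k\<bar>)\<close> on large squares, so it
  vanishes.  Then \<open>C = C'\<close> for one large negative \<open>\<lambda>\<close>, which gives \<open>q = q'\<close>, and
  the Wronskian of \<open>\<psi>\<close> and \<open>\<psi>'\<close> at \<open>pi\<close> gives \<open>F = F'\<close>.
\<close>

section \<open>Absolutely continuous functions\<close>

text \<open>The midpoint is where growth balances: a Wronskian at \<open>pi / 2\<close> grows at
  most like \<open>exp (2 * s * pi / 2)\<close>, the rate of \<open>X\<close> over the full length.
  This balance only bounds \<open>H / X\<close>. Decay comes from cancellation: the leading terms of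
  \<open>H\<close> combine to a power of \<open>k\<close> times \<open>0\<close> or, up to sign,
  \<open>cosh\<^sup>2 - sinh\<^sup>2 = 1\<close>, so the exponential survives only in an error with
  a factor \<open>1 / norm k\<close>. Near the imaginary axis even this gives no decay, since
  \<open>exp (- s * pi)\<close> is close to \<open>1\<close> there; hence Liouville together with
  one real ray. Lower bounds for \<open>X\<close> fail near its zeros. The half-sides of the squares
  are chosen so that \<open>cosh\<close> and \<open>sinh\<close> are both large on the boundary,
  whatever the parities of the indices. In the second stage \<open>S C' - S' C\<close> at distance
  \<open>x\<close> from the midpoint is multiplied by the midpoint values of both Weyl solutions.
  Equality of the Weyl functions turns the product into terms where \<open>S\<close> or
  \<open>S'\<close> meets a Weyl solution at the same point; the rates \<open>s * x\<close> and
  \<open>s * (pi / 2 - x)\<close> add up to that of the divisor, and a factor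
  \<open>1 / norm k\<close> from \<open>S\<close> or \<open>S'\<close> remains.\<close>

definition ac_on :: "real \<Rightarrow> (real \<Rightarrow> 'a::euclidean_space) \<Rightarrow> (real \<Rightarrow> 'a) \<Rightarrow> bool" where
  "ac_on L u g \<longleftrightarrow> g absolutely_integrable_on {0..L} \<and>
     (\<forall>x\<in>{0..L}. (g has_integral (u x - u 0)) {0..x})"

text \<open>
  With \<open>m\<close> the variation function, this replaces differentiation almost everywhere and Fubini's
  theorem in the proof of the product rule \<open>ac_on_mult\<close>.
\<close>

lemma eq_if_small_increments:
  fixes D :: "real \<Rightarrow> 'a::real_normed_vector" and m :: "real \<Rightarrow> real"
  assumes "0 \<le> L"
    and small: "\<And>e. e > 0 \<Longrightarrow> \<exists>d>0. \<forall>x\<in>{0..L}. \<forall>y\<in>{x..L}. y - x < d \<longrightarrow>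
      norm (D y - D x) \<le> e * (m y - m x)"
  shows "D L = D 0"
proof (rule ccontr)
  assume "D L \<noteq> D 0"
  have le: "norm (D L - D 0) \<le> e * (m L - m 0)" if e: "e > 0" for e
  proof -
    obtain d where d: "d > 0"
      "\<And>x y. x \<in> {0..L} \<Longrightarrow> y \<in> {x..L} \<Longrightarrow> y - x < d \<Longrightarrow> norm (D y - D x) \<le> e * (m y - m x)"
      using small[OF e] by blast
    obtain N :: nat where N: "L / d < real N" using reals_Archimedean2 by blast
    then have "N > 0" using d \<open>0 \<le> L\<close> by (cases N) (auto simp: field_simps)
    define p where "p = (\<lambda>i. real i * L / real N)"
    have step: "norm (D (p (Suc i)) - D (p i)) \<le> e * (m (p (Suc i)) - m (p i))" if "i < N" for i
    proof (rule d(2))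
      have "real i * L \<le> real N * L" "real (Suc i) * L \<le> real N * L"
        using that \<open>0 \<le> L\<close> by (auto intro!: mult_right_mono)
      then show "p i \<in> {0..L}" "p (Suc i) \<in> {p i..L}"
        using \<open>N > 0\<close> \<open>0 \<le> L\<close> by (auto simp: p_def field_simps)
      have "p (Suc i) - p i = L / N"
        unfolding p_def diff_divide_distrib[symmetric] by (simp add: algebra_simps)
      also have "\<dots> < d" using N d(1) \<open>N > 0\<close> by (simp add: field_simps)
      finally show "p (Suc i) - p i < d" .
    qed
    have "norm (D (p N) - D (p 0)) = norm (\<Sum>i<N. D (p (Suc i)) - D (p i))"
      using sum_lessThan_telescope[of "\<lambda>i. D (p i)" N] by simp
    also have "\<dots> \<le> (\<Sum>i<N. e * (m (p (Suc i)) - m (p i)))"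
      by (rule order_trans[OF norm_sum]) (auto intro!: sum_mono step)
    also have "\<dots> = e * (m (p N) - m (p 0))"
      unfolding sum_distrib_left[symmetric] using sum_lessThan_telescope[of "\<lambda>i. m (p i)" N] by simp
    finally show ?thesis using \<open>N > 0\<close> by (simp add: p_def)
  qed
  define c where "c = norm (D L - D 0)"
  have c: "c > 0" using \<open>D L \<noteq> D 0\<close> by (simp add: c_def)
  define M where "M = m L - m 0"
  have "M > 0" using less_le_trans[OF c, of M] le[OF zero_less_one] by (simp add: c_def M_def)
  \<comment> \<open>The choice \<open>e = c / (2 * M)\<close> gives \<open>c \<le> c / 2\<close>;
    positivity of \<open>M\<close> came from \<open>e = 1\<close>.\<close>
  have "c \<le> c / (2 * M) * M" unfolding c_def M_def
    by (rule le) (use c \<open>M > 0\<close> in \<open>simp add: c_def M_def\<close>)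
  with \<open>M > 0\<close> c show False by simp
qed

lemma ac_on_has_integral:
  assumes "ac_on L u g" "0 \<le> x" "x \<le> y" "y \<le> L"
  shows "(g has_integral (u y - u x)) {x..y}"
proof -
  have "(g has_integral (u y - u 0)) {0..y}" "(g has_integral (u x - u 0)) {0..x}"
    using assms by (auto simp: ac_on_def)
  moreover have "g integrable_on {x..y}"
    by (rule integrable_on_subinterval[of g "{0..L}"])
      (use assms in \<open>auto simp: ac_on_def absolutely_integrable_on_def\<close>)
  then obtain i where i: "(g has_integral i) {x..y}" by blast
  ultimately have "(g has_integral (u x - u 0 + i)) {0..y}"
    using assms(2,3) has_integral_combine by blast
  with \<open>(g has_integral (u y - u 0)) {0..y}\<close> have "u x - u 0 + i = u y - u 0"
    using has_integral_unique by blast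
  then have "i = u y - u x" by (simp add: algebra_simps)
  with i show ?thesis by simp
qed

lemma ac_on_absolutely_integrable:
  "ac_on L u g \<Longrightarrow> g absolutely_integrable_on {0..L}"
  by (simp add: ac_on_def)

lemma ac_on_subset: "ac_on L u g \<Longrightarrow> M \<le> L \<Longrightarrow> ac_on M u g"
  unfolding ac_on_def using set_integrable_subset[of lebesgue "{0..L}" g "{0..M}"] by auto

lemma continuous_on_ac:
  assumes "ac_on L u g"
  shows "continuous_on {0..L} u"
proof -
  have "g integrable_on {0..L}"
    using assms by (simp add: ac_on_def absolutely_integrable_on_def)
  then have "continuous_on {0..L} (\<lambda>x. u 0 + integral {0..x} g)"
    by (intro continuous_intros indefinite_integral_continuous_1)
  moreover have "u 0 + integral {0..x} g = u x" if "x \<in> {0..L}" for x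
    using assms that integral_unique[of g "u x - u 0"] by (auto simp: ac_on_def)
  ultimately show ?thesis by (rule continuous_on_eq)
qed

lemma ac_on_integral:
  assumes "g absolutely_integrable_on {0..L}"
  shows "ac_on L (\<lambda>x. c + integral {0..x} g) g"
proof -
  have "g integrable_on {0..x}" if "x \<in> {0..L}" for x
    by (rule integrable_on_subinterval[of g "{0..L}"])
      (use assms that in \<open>auto simp: absolutely_integrable_on_def\<close>)
  then show ?thesis using assms by (auto simp: ac_on_def intro: integrable_integral)
qed

lemma absolutely_integrable_continuous_mult:
  fixes g :: "real \<Rightarrow> 'a::{euclidean_space,real_normed_algebra}"
  assumes "g absolutely_integrable_on {a..b}" "continuous_on {a..b} f"
  shows "(\<lambda>x. f x * g x) absolutely_integrable_on {a..b}"
proof (rule absolutely_integrable_bounded_measurable_product[where h = "(*)" and f = f, OF _ _ _ _ assms(1)])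
  show "bilinear ((*) :: 'a \<Rightarrow> _)"
    by (simp add: bilinear_conv_bounded_bilinear bounded_bilinear_mult)
  show "f \<in> borel_measurable (lebesgue_on {a..b})"
    using assms(2) by (intro continuous_imp_measurable_on_sets_lebesgue) auto
  show "bounded (f ` {a..b})"
    using assms(2) by (intro compact_imp_bounded compact_continuous_image) auto
qed auto

lemma ac_on_continuous:
  fixes g :: "real \<Rightarrow> 'a::euclidean_space"
  assumes "\<And>x. (u has_vector_derivative g x) (at x)" "continuous_on {0..L} g"
  shows "ac_on L u g"
  unfolding ac_on_def
proof safe
  show "g absolutely_integrable_on {0..L}"
    using assms(2) by (rule absolutely_integrable_continuous_real)
  show "(g has_integral u x - u 0) {0..x}" if "x \<in> {0..L}" for x
    by (rule fundamental_theorem_of_calculus)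
       (use that assms(1) in \<open>auto intro: has_vector_derivative_at_within\<close>)
qed

lemma ac_on_cong:
  assumes "ac_on L u g" "\<And>x. x \<in> {0..L} \<Longrightarrow> u x = v x" "\<And>x. x \<in> {0..L} \<Longrightarrow> g x = h x"
  shows "ac_on L v h"
proof -
  have "h absolutely_integrable_on {0..L}"
    using assms absolutely_integrable_spike[where f = g and g = h and S = "{}" and T = "{0..L}"] by (auto simp: ac_on_def)
  moreover have "(h has_integral v x - v 0) {0..x}" if "x \<in> {0..L}" for x
  proof -
    have "(g has_integral v x - v 0) {0..x}"
      using assms(1) that assms(2)[of x] assms(2)[of 0] unfolding ac_on_def by fastforce
    then show ?thesis by (rule has_integral_eq[rotated]) (use that assms(3) in auto)
  qed
  ultimately show ?thesis by (simp add: ac_on_def)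
qed

lemma ac_on_add:
  assumes "ac_on L u g" "ac_on L v h"
  shows "ac_on L (\<lambda>x. u x + v x) (\<lambda>x. g x + h x)"
  unfolding ac_on_def
proof (intro conjI ballI)
  show "(\<lambda>x. g x + h x) absolutely_integrable_on {0..L}"
    by (rule set_integral_add(1)) (use assms in \<open>simp_all add: ac_on_def\<close>)
  fix x assume "x \<in> {0..L}"
  then have "((\<lambda>x. g x + h x) has_integral (u x - u 0) + (v x - v 0)) {0..x}"
    using assms by (intro has_integral_add) (simp_all add: ac_on_def)
  then show "((\<lambda>x. g x + h x) has_integral (u x + v x) - (u 0 + v 0)) {0..x}"
    by (simp add: algebra_simps)
qed

lemma ac_on_bounded_linear:
  fixes T :: "'a::euclidean_space \<Rightarrow> 'b::euclidean_space"
  assumes "bounded_linear T" "ac_on L u g"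
  shows "ac_on L (\<lambda>x. T (u x)) (\<lambda>x. T (g x))"
proof -
  interpret bounded_linear T by fact
  have "(\<lambda>x. T (g x)) absolutely_integrable_on {0..L}"
    using absolutely_integrable_linear[where f = g and s = "{0..L}" and h = T] assms by (auto simp: ac_on_def o_def)
  moreover have "((\<lambda>x. T (g x)) has_integral T (u x) - T (u 0)) {0..x}" if "x \<in> {0..L}" for x
    using has_integral_linear[of g "u x - u 0" "{0..x}" T] assms that
    by (simp add: ac_on_def o_def diff)
  ultimately show ?thesis
    by (simp add: ac_on_def)
qed

lemma ac_on_diff:
  "ac_on L u g \<Longrightarrow> ac_on L v h \<Longrightarrow> ac_on L (\<lambda>x. u x - v x) (\<lambda>x. g x - h x)"
  using ac_on_add[of L u g "\<lambda>x. - v x" "\<lambda>x. - h x"]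
    ac_on_bounded_linear[OF bounded_linear_minus[OF bounded_linear_ident], of L v h] by simp

lemma ac_on_cmult:
  fixes u :: "real \<Rightarrow> 'a::{euclidean_space,real_normed_algebra}"
  shows "ac_on L u g \<Longrightarrow> ac_on L (\<lambda>x. c * u x) (\<lambda>x. c * g x)"
  by (rule ac_on_bounded_linear[OF bounded_linear_mult_right])

text \<open>The defect \<open>D\<close> between the product and the integral of the expected
  derivative has increments at most \<open>e * (m y - m x)\<close> on short intervals, by uniform
  continuity of \<open>u\<close> and \<open>v\<close>; so it is constant.\<close>

lemma ac_on_mult:
  fixes u v :: "real \<Rightarrow> 'a::{euclidean_space,real_normed_field}"
  assumes u: "ac_on L u g" and v: "ac_on L v h"
  shows "ac_on L (\<lambda>x. u x * v x) (\<lambda>x. g x * v x + u x * h x)"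
proof -
  let ?w = "\<lambda>x. g x * v x + u x * h x"
  have cu: "continuous_on {0..L} u" and cv: "continuous_on {0..L} v"
    using assms continuous_on_ac by blast+
  have "(\<lambda>x. v x * g x) absolutely_integrable_on {0..L}"
       "(\<lambda>x. u x * h x) absolutely_integrable_on {0..L}"
    using u v cu cv by (auto intro!: absolutely_integrable_continuous_mult simp: ac_on_def)
  then have w: "?w absolutely_integrable_on {0..L}"
    by (subst mult.commute) (rule set_integral_add(1))
  define m where "m = (\<lambda>x. integral {0..x} (\<lambda>t. norm (g t) + norm (h t)))"
  define D where "D = (\<lambda>x. u x * v x - integral {0..x} ?w)"
  have ng: "(\<lambda>t. norm (g t) + norm (h t)) absolutely_integrable_on {0..L}"
    using u v by (intro set_integral_add(1)) (auto simp: ac_on_def absolutely_integrable_on_def)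
  have m: "ac_on L m (\<lambda>t. norm (g t) + norm (h t))"
    using ac_on_integral[OF ng, of 0] by (simp add: m_def)
  have W: "ac_on L (\<lambda>x. integral {0..x} ?w) ?w"
    using ac_on_integral[OF w, of 0] by simp
  have *: "\<exists>d>0. \<forall>x\<in>{0..L}. \<forall>y\<in>{x..L}. y - x < d \<longrightarrow> norm (D y - D x) \<le> e * (m y - m x)"
    if e: "e > 0" for e
  proof -
    have "uniformly_continuous_on {0..L} u" "uniformly_continuous_on {0..L} v"
      using cu cv by (auto intro: compact_uniformly_continuous)
    then obtain d1 d2 where d: "d1 > 0" "d2 > 0"
        "\<And>x y. x \<in> {0..L} \<Longrightarrow> y \<in> {0..L} \<Longrightarrow> dist y x < d1 \<Longrightarrow> dist (u y) (u x) < e"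
        "\<And>x y. x \<in> {0..L} \<Longrightarrow> y \<in> {0..L} \<Longrightarrow> dist y x < d2 \<Longrightarrow> dist (v y) (v x) < e"
      using e unfolding uniformly_continuous_on_def by metis
    have "norm (D y - D x) \<le> e * (m y - m x)"
      if x: "x \<in> {0..L}" and y: "y \<in> {x..L}" and xy: "y - x < min d1 d2" for x y
    proof -
      have *: "0 \<le> x" "x \<le> y" "y \<le> L" using x y by auto
      note I = ac_on_has_integral[OF _ *]
      \<comment> \<open>The increment of the product is split as
        \<open>(u y - u x) * v y + u x * (v y - v x)\<close>. With the factors \<open>v y\<close>
        and \<open>u x\<close> frozen, both summands are integrals by linearity alone.\<close>
      have "((\<lambda>t. (g t * v y + u x * h t) - ?w t) has_integral
          ((u y - u x) * v y + u x * (v y - v x)) - (integral {0..y} ?w - integral {0..x} ?w)) {x..y}"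
        by (intro has_integral_diff has_integral_add has_integral_mult_left has_integral_mult_right
            I[OF u] I[OF v] I[OF W])
      also have "((u y - u x) * v y + u x * (v y - v x)) - (integral {0..y} ?w - integral {0..x} ?w) =
          D y - D x" by (simp add: D_def algebra_simps)
      finally have 1: "((\<lambda>t. g t * (v y - v t) + (u x - u t) * h t) has_integral D y - D x) {x..y}"
        by (simp add: algebra_simps)
      have 2: "((\<lambda>t. e * (norm (g t) + norm (h t))) has_integral e * (m y - m x)) {x..y}"
        by (intro has_integral_mult_right I[OF m])
      have "norm (g t * (v y - v t) + (u x - u t) * h t) \<le> e * (norm (g t) + norm (h t))"
        if t: "t \<in> {x..y}" for t
      proof -
        have "norm (v y - v t) \<le> e" "norm (u x - u t) \<le> e"
          using d(3)[of t x] d(4)[of t y] t xy * by (auto simp: dist_norm)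
        then have "norm (g t * (v y - v t)) \<le> norm (g t) * e" "norm ((u x - u t) * h t) \<le> e * norm (h t)"
          by (auto simp: norm_mult intro!: mult_left_mono mult_right_mono)
        then show ?thesis using norm_triangle_ineq[of "g t * (v y - v t)" "(u x - u t) * h t"]
          by (simp add: algebra_simps)
      qed
      then show ?thesis
        using integral_norm_bound_integral[OF has_integral_integrable[OF 1] has_integral_integrable[OF 2]]
        unfolding integral_unique[OF 1] integral_unique[OF 2] by blast
    qed
    then show ?thesis using d(1,2) by (intro exI[of _ "min d1 d2"]) auto
  qed
  have D: "D x = D 0" if "x \<in> {0..L}" for x
  proof (intro eq_if_small_increments[of x D m])
    fix e :: real assume "e > 0"
    then obtain d where "d > 0" "\<And>x y. x \<in> {0..L} \<Longrightarrow> y \<in> {x..L} \<Longrightarrow> y - x < d \<Longrightarrow>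
        norm (D y - D x) \<le> e * (m y - m x)"
      using * by blast
    then show "\<exists>d>0. \<forall>xa\<in>{0..x}. \<forall>y\<in>{xa..x}. y - xa < d \<longrightarrow> norm (D y - D xa) \<le> e * (m y - m xa)"
      using that by (intro exI[of _ d]) auto
  qed (use that in auto)
  have "(?w has_integral u x * v x - u 0 * v 0) {0..x}" if x: "x \<in> {0..L}" for x
  proof -
    have "(?w has_integral integral {0..x} ?w) {0..x}"
      using W x by (auto simp: ac_on_def)
    then show ?thesis using D[OF x] by (simp add: D_def algebra_simps)
  qed
  then show ?thesis using w by (simp add: ac_on_def)
qed

lemma ac_on_AE:
  assumes "ac_on L u g" "AE x in lebesgue_on {0..L}. g x = h x"
  shows "ac_on L u h"
proof -
  have "AE x in lebesgue. x \<in> {0..L} \<longrightarrow> g x = h x"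
    using assms(2) by (simp add: AE_restrict_space_iff)
  then have N: "negligible {x. \<not> (x \<in> {0..L} \<longrightarrow> g x = h x)}"
    unfolding eventually_ae_filter_negligible by (auto intro: negligible_subset)
  have "h absolutely_integrable_on {0..L}"
    by (rule absolutely_integrable_spike[OF ac_on_absolutely_integrable[OF assms(1)] N]) auto
  moreover have "(h has_integral u x - u 0) {0..x}" if "x \<in> {0..L}" for x
    by (rule has_integral_spike[OF N, of _ _ g]) (use assms(1) that in \<open>auto simp: ac_on_def\<close>)
  ultimately show ?thesis by (simp add: ac_on_def)
qed

section \<open>Solutions of the differential equation\<close>

text \<open>The second derivative is the explicit function \<open>(p - z) * y\<close> instead of one
  that equals it almost everywhere. By \<open>ac_on_AE\<close> this is equivalent (see
  \<open>is_solution_iff_sol\<close>), and it removes a witness from every argument.\<close>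

definition sol :: "real \<Rightarrow> (real \<Rightarrow> real) \<Rightarrow> complex \<Rightarrow> (real \<Rightarrow> complex) \<Rightarrow> (real \<Rightarrow> complex) \<Rightarrow> bool" where
  "sol L p z y y1 \<longleftrightarrow> ac_on L y y1 \<and> ac_on L y1 (\<lambda>x. (of_real (p x) - z) * y x)"

lemma sol_ac: "sol L p z y y1 \<Longrightarrow> ac_on L y y1"
  and sol_ac1: "sol L p z y y1 \<Longrightarrow> ac_on L y1 (\<lambda>x. (of_real (p x) - z) * y x)"
  by (simp_all add: sol_def)

lemma sol_continuous: "sol L p z y y1 \<Longrightarrow> continuous_on {0..L} y"
  and sol_continuous1: "sol L p z y y1 \<Longrightarrow> continuous_on {0..L} y1"
  by (auto simp: sol_def intro: continuous_on_ac)

lemma sol_subset: "sol L p z y y1 \<Longrightarrow> M \<le> L \<Longrightarrow> sol M p z y y1"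
  by (auto simp: sol_def intro: ac_on_subset)

lemma sol_scale: "sol L p z y y1 \<Longrightarrow> sol L p z (\<lambda>x. c * y x) (\<lambda>x. c * y1 x)"
  unfolding sol_def by (auto dest: ac_on_cmult[where c = c] simp: mult.left_commute)

text \<open>This is where reality of the potential enters: for real \<open>z\<close> the conjugate
  solves the same equation, which produces the integral of \<open>(norm y)\<^sup>2\<close> in
  \<open>characteristic_simple_zero\<close>.\<close>

lemma sol_cnj:
  assumes "sol L p z y y1"
  shows "sol L p (cnj z) (\<lambda>x. cnj (y x)) (\<lambda>x. cnj (y1 x))"
  using assms ac_on_bounded_linear[OF bounded_linear_cnj, of L y y1]
    ac_on_bounded_linear[OF bounded_linear_cnj, of L y1 "\<lambda>x. (of_real (p x) - z) * y x"]
  by (simp add: sol_def)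

lemma sol_AE:
  assumes "sol L p z y y1" "AE x in lebesgue_on {0..L}. p x = q x"
  shows "sol L q z y y1"
proof -
  from assms(2)
  have "AE x in lebesgue_on {0..L}. (of_real (p x) - z) * y x = (of_real (q x) - z) * y x"
    by eventually_elim simp
  then show ?thesis using assms(1) unfolding sol_def by (blast intro: ac_on_AE)
qed

lemma has_integral_reflect_at:
  fixes g :: "real \<Rightarrow> 'a::euclidean_space"
  assumes "(g has_integral i) {L - b..L - a}" "a \<le> b"
  shows "((\<lambda>t. g (L - t)) has_integral i) {a..b}"
proof -
  have "(\<lambda>x. L - x) ` {L - b..L - a} = {a..b}"
    using image_affinity_atLeastAtMost[of "-1" L "L - b" "L - a"] assms(2) by simp
  then show ?thesis
    using has_integral_affinity[of g i "L - b" "L - a" "-1" L] assms(1) by simp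
qed

lemma ac_on_reflect:
  assumes "ac_on L u g" "0 \<le> L"
  shows "ac_on L (\<lambda>x. u (L - x)) (\<lambda>x. - g (L - x))"
proof -
  have "h integrable_on {0..L} \<Longrightarrow> (\<lambda>x. h (L - x)) integrable_on {0..L}"
    for h :: "real \<Rightarrow> 'b::euclidean_space"
    using has_integral_reflect_at[of h _ L L 0] assms(2) unfolding integrable_on_def by auto
  from this[of g] this[of "\<lambda>x. norm (g x)"]
  have "(\<lambda>x. - g (L - x)) absolutely_integrable_on {0..L}"
    using assms(1) by (auto simp: ac_on_def absolutely_integrable_on_def intro: integrable_neg)
  moreover have "((\<lambda>x. - g (L - x)) has_integral u (L - x) - u (L - 0)) {0..x}" if "x \<in> {0..L}" for x
  proof -
    have "(g has_integral (u (L - 0) - u (L - x))) {L - x..L - 0}"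
      by (rule ac_on_has_integral[OF assms(1)]) (use that in auto)
    from has_integral_neg[OF has_integral_reflect_at[OF this]] that show ?thesis by simp
  qed
  ultimately show ?thesis by (simp add: ac_on_def)
qed

lemma sol_reflect:
  assumes "sol L p z y y1" "0 \<le> L"
  shows "sol L (\<lambda>t. p (L - t)) z (\<lambda>t. y (L - t)) (\<lambda>t. - y1 (L - t))"
  unfolding sol_def
proof
  show "ac_on L (\<lambda>t. y (L - t)) (\<lambda>t. - y1 (L - t))"
    by (rule ac_on_reflect[OF sol_ac[OF assms(1)] assms(2)])
  show "ac_on L (\<lambda>t. - y1 (L - t)) (\<lambda>x. (of_real (p (L - x)) - z) * y (L - x))"
    using ac_on_cmult[OF ac_on_reflect[OF sol_ac1[OF assms(1)] assms(2)], of "-1"] by simp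
qed

text \<open>Lagrange's identity: the potential cancels in the derivative of the Wronskian and only
  the difference of the spectral parameters is left.\<close>

lemma sol_wronskian:
  assumes y: "sol L p z y y1" and u: "sol L p w u u1" and x: "x \<in> {0..L}"
  shows "((\<lambda>t. (z - w) * (y t * u t)) has_integral
    (y x * u1 x - y1 x * u x) - (y 0 * u1 0 - y1 0 * u 0)) {0..x}"
proof -
  have "ac_on L (\<lambda>x. y x * u1 x - y1 x * u x)
    (\<lambda>x. (y1 x * u1 x + y x * ((of_real (p x) - w) * u x)) -
         ((of_real (p x) - z) * y x * u x + y1 x * u1 x))"
    by (intro ac_on_diff ac_on_mult sol_ac[OF y] sol_ac1[OF y] sol_ac[OF u] sol_ac1[OF u])
  then have "ac_on L (\<lambda>x. y x * u1 x - y1 x * u x) (\<lambda>t. (z - w) * (y t * u t))"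
    by (simp add: algebra_simps)
  then show ?thesis using x by (simp add: ac_on_def)
qed

lemma sol_wronskian_eq:
  assumes "sol L p z y y1" "sol L p z u u1" "x \<in> {0..L}"
  shows "y x * u1 x - y1 x * u x = y 0 * u1 0 - y1 0 * u 0"
  using sol_wronskian[OF assms] by simp

lemma ac_on_power:
  assumes "ac_on L m (g :: real \<Rightarrow> real)"
  shows "ac_on L (\<lambda>x. m x ^ Suc n) (\<lambda>x. real (Suc n) * (m x ^ n * g x))"
proof (induction n)
  case (Suc n)
  have "ac_on L (\<lambda>x. m x * m x ^ Suc n) (\<lambda>x. g x * m x ^ Suc n + m x * (real (Suc n) * (m x ^ n * g x)))"
    by (rule ac_on_mult[OF assms Suc])
  then show ?case by (simp add: algebra_simps)
qed (use assms in simp)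

section \<open>Existence for the first-order system by Picard iteration\<close>

context
  fixes L :: real and P :: "real \<Rightarrow> complex" and \<alpha> \<beta> :: complex
  assumes P: "P absolutely_integrable_on {0..L}"
begin

text \<open>These are the terms of the Neumann series, not its partial sums: the initial data occur
  in term \<open>0\<close> only, and all later terms vanish at \<open>0\<close>.\<close>

private fun picard :: "nat \<Rightarrow> (real \<Rightarrow> complex) \<times> (real \<Rightarrow> complex)" where
  "picard 0 = ((\<lambda>x. \<alpha>), (\<lambda>x. \<beta>))"
| "picard (Suc n) = ((\<lambda>x. integral {0..x} (snd (picard n))),
     (\<lambda>x. integral {0..x} (\<lambda>t. P t * fst (picard n) t)))"

private abbreviation "a n \<equiv> fst (picard n)"
private abbreviation "b n \<equiv> snd (picard n)"

private lemma picard_ac: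
  "ac_on L (a (Suc n)) (b n) \<and> ac_on L (b (Suc n)) (\<lambda>t. P t * a n t)"
proof -
  have "continuous_on {0..L} (a n) \<and> continuous_on {0..L} (b n)"
  proof (induction n)
    case (Suc n)
    have "(\<lambda>t. P t * a n t) absolutely_integrable_on {0..L}"
      using absolutely_integrable_continuous_mult[OF P, of "a n"] Suc by (simp add: mult.commute)
    moreover have "b n absolutely_integrable_on {0..L}"
      using Suc by (auto intro: absolutely_integrable_continuous_real)
    ultimately show ?case
      by (auto simp: absolutely_integrable_on_def intro!: indefinite_integral_continuous_1)
  qed auto
  then have "(\<lambda>t. P t * a n t) absolutely_integrable_on {0..L}" "b n absolutely_integrable_on {0..L}"
    using absolutely_integrable_continuous_mult[OF P, of "a n"]
    by (auto intro: absolutely_integrable_continuous_real simp: mult.commute)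
  from ac_on_integral[OF this(1), of 0] ac_on_integral[OF this(2), of 0] show ?thesis
    by simp
qed

text \<open>The weight \<open>1 + norm (P t)\<close> dominates both rows of the system, whose
  coefficients are \<open>1\<close> and \<open>P t\<close>.\<close>

private definition "m x = integral {0..x} (\<lambda>t. 1 + norm (P t))"

private lemma m_ac: "ac_on L m (\<lambda>t. 1 + norm (P t))"
proof -
  have "(\<lambda>t. 1 + norm (P t)) absolutely_integrable_on {0..L}"
    by (rule set_integral_add(1))
       (use P in \<open>auto simp: absolutely_integrable_on_def\<close>)
  from ac_on_integral[OF this, of 0] show ?thesis by (simp add: m_def[abs_def])
qed

private lemma m_mono: "0 \<le> x \<Longrightarrow> x \<le> y \<Longrightarrow> y \<le> L \<Longrightarrow> m x \<le> m y"
  using has_integral_nonneg[OF ac_on_has_integral[OF m_ac, of x y]] by simp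

private lemma m_nonneg: "x \<in> {0..L} \<Longrightarrow> 0 \<le> m x"
  using m_mono[of 0 x] by (simp add: m_def)

text \<open>One more integration replaces \<open>m ^ n / fact n\<close> by
  \<open>m ^ Suc n / fact (Suc n)\<close>, because the weight is the derivative of \<open>m\<close>.
  No smallness of the interval is needed for the series to converge.\<close>

private lemma picard_bound:
  "x \<in> {0..L} \<Longrightarrow> norm (a n x) + norm (b n x) \<le> (norm \<alpha> + norm \<beta>) * (m x ^ n / fact n)"
proof (induction n arbitrary: x)
  case (Suc n)
  let ?C = "norm \<alpha> + norm \<beta>"
  have I: "(b n has_integral a (Suc n) x) {0..x}" "((\<lambda>t. P t * a n t) has_integral b (Suc n) x) {0..x}"
    using picard_ac[of n] Suc.prems by (auto simp: ac_on_def)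
  have "((\<lambda>t. real (Suc n) * (m t ^ n * (1 + norm (P t)))) has_integral m x ^ Suc n - m 0 ^ Suc n) {0..x}"
    using ac_on_power[OF m_ac, of n] Suc.prems by (simp add: ac_on_def)
  from has_integral_mult_right[OF this, of "?C / fact (Suc n)"]
  have "((\<lambda>t. ?C / fact (Suc n) * (real (Suc n) * (m t ^ n * (1 + norm (P t))))) has_integral
      ?C * (m x ^ Suc n / fact (Suc n))) {0..x}"
    by (simp add: m_def)
  moreover have "?C / fact (Suc n) * (real (Suc n) * (m t ^ n * (1 + norm (P t)))) =
      ?C * (m t ^ n / fact n) * (1 + norm (P t))" for t
  proof -
    have "fact (Suc n) = real (Suc n) * fact n" by simp
    then show ?thesis by (simp add: divide_simps del: fact_Suc of_nat_Suc)
  qed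
  ultimately have "((\<lambda>t. ?C * (m t ^ n / fact n) * (1 + norm (P t))) has_integral
      ?C * (m x ^ Suc n / fact (Suc n))) {0..x}"
    by (simp only:)
  then have J: "((\<lambda>t. ?C * (m t ^ n / fact n) * (1 + norm (P t))) has_integral ?C * (m x ^ Suc n / fact (Suc n))) {0..x}"
    by simp
  have "ac_on x (a (Suc n)) (b n)" "ac_on x (b (Suc n)) (\<lambda>t. P t * a n t)"
    using picard_ac[of n] Suc.prems by (auto intro: ac_on_subset simp del: picard.simps)
  note ai = this[THEN ac_on_absolutely_integrable]
  have K: "(\<lambda>t. norm (b n t)) integrable_on {0..x}" "(\<lambda>t. norm (P t * a n t)) integrable_on {0..x}"
    using ai by (auto simp: absolutely_integrable_on_def)
  have "norm (a (Suc n) x) + norm (b (Suc n) x) \<le>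
      integral {0..x} (\<lambda>t. norm (b n t)) + integral {0..x} (\<lambda>t. norm (P t * a n t))"
    using integral_norm_bound_integral[OF has_integral_integrable[OF I(1)] K(1)]
       integral_norm_bound_integral[OF has_integral_integrable[OF I(2)] K(2)]
    unfolding integral_unique[OF I(1)] integral_unique[OF I(2)] by auto
  also have "\<dots> = integral {0..x} (\<lambda>t. norm (b n t) + norm (P t * a n t))"
    using K by (simp add: integral_add)
  also have "\<dots> \<le> integral {0..x} (\<lambda>t. ?C * (m t ^ n / fact n) * (1 + norm (P t)))"
  proof (rule integral_le)
    fix t assume "t \<in> {0..x}"
    then have t: "t \<in> {0..L}" using Suc.prems by auto
    have "norm (b n t) + norm (P t * a n t) \<le> (norm (a n t) + norm (b n t)) * (1 + norm (P t))"
      by (simp add: norm_mult algebra_simps)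
    also have "\<dots> \<le> ?C * (m t ^ n / fact n) * (1 + norm (P t))"
      by (intro mult_right_mono Suc.IH t) simp
    finally show "norm (b n t) + norm (P t * a n t) \<le> ?C * (m t ^ n / fact n) * (1 + norm (P t))" .
  qed (use K J in \<open>auto intro: integrable_add\<close>)
  also have "\<dots> = ?C * (m x ^ Suc n / fact (Suc n))" by (rule integral_unique[OF J])
  finally show ?case .
qed simp

private lemma picard_solution:
  assumes "0 \<le> L"
  shows "\<exists>y y1. ac_on L y y1 \<and> ac_on L y1 (\<lambda>x. P x * y x) \<and> y 0 = \<alpha> \<and> y1 0 = \<beta>"
proof -
  let ?C = "norm \<alpha> + norm \<beta>"
  define B where "B = (\<lambda>n. ?C * (m L ^ n / fact n))"
  have sB: "summable B"
    using summable_exp[of "m L"] unfolding B_def by (intro summable_mult) (simp add: field_simps)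
  have bd: "norm (a n x) \<le> B n \<and> norm (b n x) \<le> B n" if "x \<in> {0..L}" for n x
  proof -
    have "m x ^ n \<le> m L ^ n" using that by (intro power_mono m_mono m_nonneg) auto
    then have "?C * (m x ^ n / fact n) \<le> B n"
      unfolding B_def by (intro mult_left_mono divide_right_mono) auto
    with picard_bound[OF that, of n] show ?thesis
      using norm_ge_zero[of "a n x"] norm_ge_zero[of "b n x"] by linarith
  qed
  define y where "y = (\<lambda>x. \<Sum>n. a n x)"
  define y1 where "y1 = (\<lambda>x. \<Sum>n. b n x)"
  have sa: "summable (\<lambda>n. a n x)" and sb: "summable (\<lambda>n. b n x)" if "x \<in> {0..L}" for x
    using bd[OF that] sB by (auto intro: summable_comparison_test')
  have part: "norm (\<Sum>i<n. a i x) \<le> suminf B" "norm (\<Sum>i<n. b i x) \<le> suminf B" if "x \<in> {0..L}" for x n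
  proof -
    have "(\<Sum>i<n. B i) \<le> suminf B"
      using sB m_nonneg[of L] assms by (intro sum_le_suminf) (auto simp: B_def)
    moreover have "norm (\<Sum>i<n. a i x) \<le> (\<Sum>i<n. B i)" "norm (\<Sum>i<n. b i x) \<le> (\<Sum>i<n. B i)"
      using bd[OF that] by (auto intro: sum_norm_le)
    ultimately show "norm (\<Sum>i<n. a i x) \<le> suminf B" "norm (\<Sum>i<n. b i x) \<le> suminf B" by auto
  qed
  have z: "a (Suc n) 0 = 0" "b (Suc n) 0 = 0" for n by auto
  have 0: "y 0 = \<alpha>" "y1 0 = \<beta>"
  proof -
    have "a n 0 = 0" "b n 0 = 0" if "n \<notin> {0}" for n
      using that z[of "n - 1"] by auto
    then show "y 0 = \<alpha>" "y1 0 = \<beta>"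
      using suminf_finite[of "{0}" "\<lambda>n. a n 0"] suminf_finite[of "{0}" "\<lambda>n. b n 0"]
      by (auto simp: y_def y1_def)
  qed
  have I: "(y1 has_integral (y x - \<alpha>)) {0..x}" "((\<lambda>t. P t * y t) has_integral (y1 x - \<beta>)) {0..x}"
    if x: "x \<in> {0..L}" for x
  proof -
    have sub: "t \<in> {0..L}" if "t \<in> {0..x}" for t using that x by auto
    have a: "((\<lambda>t. \<Sum>i<n. b i t) has_integral (\<Sum>i<n. a (Suc i) x)) {0..x}"
      and b: "((\<lambda>t. P t * (\<Sum>i<n. a i t)) has_integral (\<Sum>i<n. b (Suc i) x)) {0..x}" for n
      unfolding sum_distrib_left using picard_ac x
      by (auto simp: ac_on_def intro!: has_integral_sum)
    show "(y1 has_integral (y x - \<alpha>)) {0..x}"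
    proof (rule has_integral_dominated_convergence[OF a])
      show "(\<lambda>t. suminf B) integrable_on {0..x}" by auto
      show "\<forall>t\<in>{0..x}. norm (\<Sum>i<k. b i t) \<le> suminf B" for k using part sub by blast
      show "\<forall>t\<in>{0..x}. (\<lambda>k. \<Sum>i<k. b i t) \<longlonglongrightarrow> y1 t"
        unfolding y1_def by (intro ballI summable_LIMSEQ sb sub)
      \<comment> \<open>Integration raises the index by one, so the sum of the integrals lacks term
        \<open>0\<close>, which is the constant \<open>\<alpha>\<close>.\<close>
      show "(\<lambda>k. \<Sum>i<k. a (Suc i) x) \<longlonglongrightarrow> y x - \<alpha>"
        using summable_sums[OF sa[OF x]] sums_Suc_iff[of "\<lambda>n. a n x" "y x - \<alpha>"]
        by (simp add: y_def sums_def)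
    qed
    show "((\<lambda>t. P t * y t) has_integral (y1 x - \<beta>)) {0..x}"
    proof (rule has_integral_dominated_convergence[OF b])
      have "P absolutely_integrable_on {0..x}"
        by (rule set_integrable_subset[OF P]) (use x in auto)
      then show "(\<lambda>t. norm (P t) * suminf B) integrable_on {0..x}"
        by (auto simp: absolutely_integrable_on_def intro: integrable_on_mult_left)
      show "\<forall>t\<in>{0..x}. norm (P t * (\<Sum>i<k. a i t)) \<le> norm (P t) * suminf B" for k
        using part sub by (auto simp: norm_mult intro!: mult_left_mono)
      show "\<forall>t\<in>{0..x}. (\<lambda>k. P t * (\<Sum>i<k. a i t)) \<longlonglongrightarrow> P t * y t"
        unfolding y_def by (intro ballI tendsto_mult_left summable_LIMSEQ sa sub)
      show "(\<lambda>k. \<Sum>i<k. b (Suc i) x) \<longlonglongrightarrow> y1 x - \<beta>"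
        using summable_sums[OF sb[OF x]] sums_Suc_iff[of "\<lambda>n. b n x" "y1 x - \<beta>"]
        by (simp add: y1_def sums_def)
    qed
  qed
  have cont: "continuous_on {0..L} u"
    if *: "\<And>x. x \<in> {0..L} \<Longrightarrow> (g has_integral (u x - c)) {0..x}" for u g :: "real \<Rightarrow> complex" and c
  proof -
    have "g integrable_on {0..L}" using that[of L] assms by auto
    then have "continuous_on {0..L} (\<lambda>x. c + integral {0..x} g)"
      by (intro continuous_intros indefinite_integral_continuous_1)
    moreover have "c + integral {0..x} g = u x" if "x \<in> {0..L}" for x
      using integral_unique[of g "u x - c"] *[OF that] by auto
    ultimately show ?thesis by (rule continuous_on_eq)
  qed
  have c1: "continuous_on {0..L} y1" by (rule cont[OF I(2)])
  have c: "continuous_on {0..L} y" by (rule cont[OF I(1)])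
  have "y1 absolutely_integrable_on {0..L}"
    using c1 by (rule absolutely_integrable_continuous_real)
  moreover have "(\<lambda>x. P x * y x) absolutely_integrable_on {0..L}"
    using absolutely_integrable_continuous_mult[OF P c] by (simp add: mult.commute)
  ultimately have "ac_on L y y1" "ac_on L y1 (\<lambda>x. P x * y x)"
    using I 0 by (simp_all add: ac_on_def)
  with 0 show ?thesis by blast
qed

lemmas linear_system_solution = picard_solution

end

lemma sol_coeff_integrable:
  fixes p :: "real \<Rightarrow> real"
  assumes "p absolutely_integrable_on {0..L}"
  shows "(\<lambda>x. complex_of_real (p x) - z) absolutely_integrable_on {0..L}"
proof (rule set_integral_diff(1))
  show "(\<lambda>x. complex_of_real (p x)) absolutely_integrable_on {0..L}"
    using absolutely_integrable_linear[OF assms bounded_linear_of_real] by (simp add: o_def)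
next
  show "(\<lambda>x. z) absolutely_integrable_on {0..L}"
    by (rule absolutely_integrable_continuous_real) (rule continuous_on_const)
qed

lemma sol_exists:
  assumes "p absolutely_integrable_on {0..L}" "0 \<le> L"
  shows "\<exists>y y1. sol L p z y y1 \<and> y 0 = \<alpha> \<and> y1 0 = \<beta>"
  using linear_system_solution[OF sol_coeff_integrable[OF assms(1)] assms(2)]
  unfolding sol_def by blast

text \<open>The Wronskians with a fundamental system \<open>c\<close>, \<open>s\<close> are
  constant, hence fixed by the initial data. Since the Wronskian of \<open>c\<close> and
  \<open>s\<close> is \<open>1\<close>, they determine \<open>y x\<close> and \<open>y1 x\<close> by
  linear algebra.\<close>

lemma sol_unique:
  assumes p: "p absolutely_integrable_on {0..L}"
    and "sol L p z y y1" "sol L p z u u1" "y 0 = u 0" "y1 0 = u1 0" "x \<in> {0..L}"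
  shows "y x = u x" "y1 x = u1 x"
proof -
  have "0 \<le> L" using assms(6) by auto
  obtain c c1 where c: "sol L p z c c1" "c 0 = 1" "c1 0 = 0"
    using sol_exists[OF p \<open>0 \<le> L\<close>] by blast
  obtain s s1 where s: "sol L p z s s1" "s 0 = 0" "s1 0 = 1"
    using sol_exists[OF p \<open>0 \<le> L\<close>] by blast
  note W = sol_wronskian_eq[OF _ _ assms(6)]
  have 1: "c x * s1 x - c1 x * s x = 1" using W[OF c(1) s(1)] c s by simp
  have 2: "y x * c1 x - y1 x * c x = u x * c1 x - u1 x * c x"
    using W[OF assms(2) c(1)] W[OF assms(3) c(1)] assms(4,5) by simp
  have 3: "y x * s1 x - y1 x * s x = u x * s1 x - u1 x * s x"
    using W[OF assms(2) s(1)] W[OF assms(3) s(1)] assms(4,5) by simp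
  have "(y x - u x) * (c x * s1 x - c1 x * s x) = 0"
    using 2 3 by algebra
  then show "y x = u x" unfolding 1 by simp
  have "(y1 x - u1 x) * (c x * s1 x - c1 x * s x) = 0"
    using 2 3 by algebra
  then show "y1 x = u1 x" unfolding 1 by simp
qed

subsection \<open>Dependence on the spectral parameter\<close>

text \<open>
  Solving for \<open>y z\<close> in terms of solutions at a fixed \<open>w\<close> displays the difference quotient at \<open>z = w\<close>, so
  continuity of the integrals in \<open>z\<close> already yields holomorphy.
\<close>

lemma sol_variation:
  assumes c: "sol L p w c c1" "c 0 = 1" "c1 0 = 0"
    and s: "sol L p w s s1" "s 0 = 0" "s1 0 = 1"
    and y: "sol L p z y y1" and x: "x \<in> {0..L}"
  shows "y x = c x * (y 0 + (z - w) * integral {0..x} (\<lambda>t. y t * s t)) +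
               s x * (y1 0 - (z - w) * integral {0..x} (\<lambda>t. y t * c t))"
    and "y1 x = c1 x * (y 0 + (z - w) * integral {0..x} (\<lambda>t. y t * s t)) +
               s1 x * (y1 0 - (z - w) * integral {0..x} (\<lambda>t. y t * c t))"
proof -
  define Is where "Is = (z - w) * integral {0..x} (\<lambda>t. y t * s t)"
  define Ic where "Ic = (z - w) * integral {0..x} (\<lambda>t. y t * c t)"
  have 1: "c x * s1 x - c1 x * s x = 1"
    using sol_wronskian_eq[OF c(1) s(1) x] c s by simp
  have 2: "y x * s1 x - y1 x * s x = y 0 + Is"
    using integral_unique[OF sol_wronskian[OF y s(1) x]] s(2,3)
    unfolding Is_def integral_mult_right by simp
  have 3: "y x * c1 x - y1 x * c x = Ic - y1 0"
    using integral_unique[OF sol_wronskian[OF y c(1) x]] c(2,3)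
    unfolding Ic_def integral_mult_right by simp
  have "y x * (c x * s1 x - c1 x * s x) = c x * (y 0 + Is) + s x * (y1 0 - Ic)"
    using 2 3 by algebra
  moreover have "y1 x * (c x * s1 x - c1 x * s x) = c1 x * (y 0 + Is) + s1 x * (y1 0 - Ic)"
    using 2 3 by algebra
  ultimately show "y x = c x * (y 0 + (z - w) * integral {0..x} (\<lambda>t. y t * s t)) +
               s x * (y1 0 - (z - w) * integral {0..x} (\<lambda>t. y t * c t))"
    and "y1 x = c1 x * (y 0 + (z - w) * integral {0..x} (\<lambda>t. y t * s t)) +
               s1 x * (y1 0 - (z - w) * integral {0..x} (\<lambda>t. y t * c t))"
    unfolding 1 by (simp_all add: Is_def Ic_def)
qed

lemma continuous_on_interval_bound:
  fixes f :: "real \<Rightarrow> 'a::real_normed_vector"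
  assumes "continuous_on {a..b} f"
  obtains K where "K > 0" "\<And>x. x \<in> {a..b} \<Longrightarrow> norm (f x) \<le> K"
proof -
  have "bounded (f ` {a..b})"
    using assms by (intro compact_imp_bounded compact_continuous_image) auto
  then show ?thesis using that unfolding bounded_pos by blast
qed

context
  fixes L :: real and p :: "real \<Rightarrow> real" and y y1 :: "complex \<Rightarrow> real \<Rightarrow> complex"
  assumes p: "p absolutely_integrable_on {0..L}" and L: "0 \<le> L"
    and y: "\<And>z. sol L p z (y z) (y1 z)"
begin

text \<open>\<open>sol_variation\<close> bounds the deviation of \<open>y z\<close> from
  \<open>c * y z 0 + s * y1 z 0\<close> by \<open>norm (z - w)\<close> times the supremum of
  \<open>y z\<close> itself. Once that factor is at most \<open>1/2\<close>, the estimate at a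
  maximum point absorbs the supremum and bounds it by the initial data; inserted again, this makes
  the deviation tend to \<open>0\<close>.\<close>

lemma sol_param_uniform:
  assumes "isCont (\<lambda>z. y z 0) w" "isCont (\<lambda>z. y1 z 0) w"
  obtains g where "(g \<longlongrightarrow> 0) (at w)"
    "\<forall>\<^sub>F z in at w. \<forall>x\<in>{0..L}. norm (y z x - y w x) \<le> g z"
proof -
  obtain c c1 where c: "sol L p w c c1" "c 0 = 1" "c1 0 = 0"
    using sol_exists[OF p L] by blast
  obtain s s1 where s: "sol L p w s s1" "s 0 = 0" "s1 0 = 1"
    using sol_exists[OF p L] by blast
  obtain K1 where K1: "K1 > 0" "\<And>x. x \<in> {0..L} \<Longrightarrow> norm (c x) \<le> K1"
    by (rule continuous_on_interval_bound[OF sol_continuous[OF c(1)]]) blast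
  obtain K2 where K2: "K2 > 0" "\<And>x. x \<in> {0..L} \<Longrightarrow> norm (s x) \<le> K2"
    by (rule continuous_on_interval_bound[OF sol_continuous[OF s(1)]]) blast
  define K where "K = max K1 K2"
  have K: "K > 0" "\<And>x. x \<in> {0..L} \<Longrightarrow> norm (c x) \<le> K" "\<And>x. x \<in> {0..L} \<Longrightarrow> norm (s x) \<le> K"
    using K1 K2 by (auto simp: K_def le_max_iff_disj)
  have int: "norm (integral {0..x} (\<lambda>t. y z t * u t)) \<le> P * K * L"
    if x: "x \<in> {0..L}" and P: "\<And>t. t \<in> {0..L} \<Longrightarrow> norm (y z t) \<le> P"
      and u: "continuous_on {0..L} u" "\<And>t. t \<in> {0..L} \<Longrightarrow> norm (u t) \<le> K" for x z P u
  proof -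
    have "norm (integral {0..x} (\<lambda>t. y z t * u t)) \<le> P * K * (x - 0)"
    proof (rule integral_bound)
      show "continuous_on {0..x} (\<lambda>t. y z t * u t)"
        using x by (intro continuous_intros continuous_on_subset[OF sol_continuous[OF y]]
            continuous_on_subset[OF u(1)]) auto
      have "0 \<le> P" using P[of 0] L norm_ge_zero[of "y z 0"] by (auto simp del: norm_ge_zero)
      then show "norm (y z t * u t) \<le> P * K" if "t \<in> {0..x}" for t
        unfolding norm_mult using that x by (intro mult_mono P u) auto
    qed (use x in auto)
    also have "\<dots> \<le> P * K * L"
    proof (rule mult_left_mono)
      have "0 \<le> P" using P[of 0] L norm_ge_zero[of "y z 0"] by (auto simp del: norm_ge_zero)
      then show "0 \<le> P * K" using K by simp
    qed (use x in auto)
    finally show ?thesis .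
  qed
  have main: "norm (y z x - (c x * y z 0 + s x * y1 z 0)) \<le> norm (z - w) * (2 * K^2 * L) * P"
    if x: "x \<in> {0..L}" and P: "\<And>t. t \<in> {0..L} \<Longrightarrow> norm (y z t) \<le> P" for x z P
  proof -
    have "0 \<le> P" using P[of 0] L norm_ge_zero[of "y z 0"] by (auto simp del: norm_ge_zero)
    let ?Is = "integral {0..x} (\<lambda>t. y z t * s t)" and ?Ic = "integral {0..x} (\<lambda>t. y z t * c t)"
    have eq: "y z x - (c x * y z 0 + s x * y1 z 0) = (z - w) * (c x * ?Is - s x * ?Ic)"
      by (subst sol_variation(1)[OF c s y x]) (simp add: algebra_simps)
    have "norm ?Is \<le> P * K * L" "norm ?Ic \<le> P * K * L"
      by (rule int[OF x P sol_continuous[OF s(1)] K(3)] int[OF x P sol_continuous[OF c(1)] K(2)]; simp)+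
    then have "norm (c x * ?Is) \<le> K * (P * K * L)" "norm (s x * ?Ic) \<le> K * (P * K * L)"
      unfolding norm_mult using K(1) by (intro mult_mono K x; simp)+
    then have n: "norm (c x * ?Is - s x * ?Ic) \<le> 2 * K^2 * L * P"
      using norm_triangle_ineq4[of "c x * ?Is" "s x * ?Ic"] by (simp add: power2_eq_square algebra_simps)
    show ?thesis
      unfolding eq norm_mult using mult_left_mono[OF n, of "norm (z - w)"] by (simp add: mult_ac)
  qed
  have bound: "norm (y z x) \<le> 2 * K * (norm (y z 0) + norm (y1 z 0))"
    if x: "x \<in> {0..L}" and z: "norm (z - w) * (2 * K^2 * L) \<le> 1/2" for x z
  proof -
    have "continuous_on {0..L} (\<lambda>t. norm (y z t))"
      by (intro continuous_on_norm sol_continuous[OF y])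
    then obtain x0 where x0: "x0 \<in> {0..L}" "\<And>t. t \<in> {0..L} \<Longrightarrow> norm (y z t) \<le> norm (y z x0)"
      using continuous_attains_sup[of "{0..L}" "\<lambda>t. norm (y z t)"] L by auto
    let ?P = "norm (y z x0)"
    have "norm (y z x0 - (c x0 * y z 0 + s x0 * y1 z 0)) \<le> norm (z - w) * (2 * K^2 * L) * ?P"
      by (rule main[OF x0])
    also have "\<dots> \<le> 1/2 * ?P" by (intro mult_right_mono z) simp
    finally have "?P \<le> norm (c x0 * y z 0 + s x0 * y1 z 0) + 1/2 * ?P"
      using norm_triangle_ineq2[of "y z x0" "c x0 * y z 0 + s x0 * y1 z 0"] by linarith
    moreover have "norm (c x0 * y z 0 + s x0 * y1 z 0) \<le> K * norm (y z 0) + K * norm (y1 z 0)"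
      by (rule norm_triangle_le) (auto simp: norm_mult intro!: add_mono mult_right_mono K x0)
    ultimately have "?P \<le> 2 * K * (norm (y z 0) + norm (y1 z 0))" by (simp add: algebra_simps)
    with x0(2)[OF x] show ?thesis by linarith
  qed
  define g where "g = (\<lambda>z. norm (z - w) * (2 * K^2 * L) * (2 * K * (norm (y z 0) + norm (y1 z 0)))
     + K * norm (y z 0 - y w 0) + K * norm (y1 z 0 - y1 w 0))"
  have lim: "((\<lambda>z. y z 0) \<longlongrightarrow> y w 0) (at w)" "((\<lambda>z. y1 z 0) \<longlongrightarrow> y1 w 0) (at w)"
    using assms by (auto simp: isCont_def)
  show ?thesis
  proof
    have "(g \<longlongrightarrow> norm (w - w) * (2 * K^2 * L) * (2 * K * (norm (y w 0) + norm (y1 w 0)))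
     + K * norm (y w 0 - y w 0) + K * norm (y1 w 0 - y1 w 0)) (at w)"
      unfolding g_def by (intro tendsto_intros lim)
    then show "(g \<longlongrightarrow> 0) (at w)" by simp
    have "((\<lambda>z. norm (z - w) * (2 * K^2 * L)) \<longlongrightarrow> norm (w - w) * (2 * K^2 * L)) (at w)"
      by (intro tendsto_intros)
    then have "\<forall>\<^sub>F z in at w. norm (z - w) * (2 * K^2 * L) < 1/2"
      by (intro order_tendstoD(2)) auto
    then show "\<forall>\<^sub>F z in at w. \<forall>x\<in>{0..L}. norm (y z x - y w x) \<le> g z"
    proof eventually_elim
      case (elim z)
      show ?case
      proof
        fix x assume x: "x \<in> {0..L}"
        have 1: "norm (y z x - (c x * y z 0 + s x * y1 z 0)) \<le>
            norm (z - w) * (2 * K^2 * L) * (2 * K * (norm (y z 0) + norm (y1 z 0)))"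
          by (rule main[OF x bound]) (use elim in auto)
        have 2: "y w x = c x * y w 0 + s x * y1 w 0"
          by (subst sol_variation(1)[OF c s y x]) simp
        have e: "y z x - y w x = (y z x - (c x * y z 0 + s x * y1 z 0)) +
            (c x * (y z 0 - y w 0) + s x * (y1 z 0 - y1 w 0))"
          unfolding 2 by (simp add: algebra_simps)
        have "norm (c x * (y z 0 - y w 0) + s x * (y1 z 0 - y1 w 0)) \<le>
            K * norm (y z 0 - y w 0) + K * norm (y1 z 0 - y1 w 0)"
          by (rule norm_triangle_le) (auto simp: norm_mult intro!: add_mono mult_right_mono K x)
        then show "norm (y z x - y w x) \<le> g z"
          unfolding e g_def using 1 norm_triangle_ineq[of "y z x - (c x * y z 0 + s x * y1 z 0)"
            "c x * (y z 0 - y w 0) + s x * (y1 z 0 - y1 w 0)"]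
          by linarith
      qed
    qed
  qed
qed

lemma sol_param_integral:
  assumes "isCont (\<lambda>z. y z 0) w" "isCont (\<lambda>z. y1 z 0) w" "continuous_on {0..L} u" "x \<in> {0..L}"
  shows "isCont (\<lambda>z. integral {0..x} (\<lambda>t. y z t * u t)) w"
proof -
  obtain g where g: "(g \<longlongrightarrow> 0) (at w)"
    "\<forall>\<^sub>F z in at w. \<forall>x\<in>{0..L}. norm (y z x - y w x) \<le> g z"
    using sol_param_uniform[OF assms(1,2)] .
  obtain U where U: "U > 0" "\<And>t. t \<in> {0..L} \<Longrightarrow> norm (u t) \<le> U"
    by (rule continuous_on_interval_bound[OF assms(3)]) blast
  have sub: "{0..x} \<subseteq> {0..L}" using assms(4) by auto
  note c = continuous_on_subset[OF sol_continuous[OF y] sub] continuous_on_subset[OF assms(3) sub]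
  note ci = integrable_continuous_real[OF continuous_on_mult[OF c]]
  have "\<forall>\<^sub>F z in at w. norm (integral {0..x} (\<lambda>t. y z t * u t) - integral {0..x} (\<lambda>t. y w t * u t))
      \<le> g z * U * (x - 0)"
    using g(2)
  proof eventually_elim
    case (elim z)
    have "integral {0..x} (\<lambda>t. y z t * u t) - integral {0..x} (\<lambda>t. y w t * u t) =
        integral {0..x} (\<lambda>t. (y z t - y w t) * u t)"
      unfolding left_diff_distrib by (rule Henstock_Kurzweil_Integration.integral_diff[OF ci ci, symmetric])
    also have "norm \<dots> \<le> g z * U * (x - 0)"
    proof (rule integral_bound)
      show "continuous_on {0..x} (\<lambda>t. (y z t - y w t) * u t)"
        by (rule continuous_on_mult[OF continuous_on_diff[OF c(1) c(1)] c(2)])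
      have "norm (y z 0 - y w 0) \<le> g z" using elim L by auto
      then have "0 \<le> g z" by (rule order_trans[OF norm_ge_zero])
      then show "norm ((y z t - y w t) * u t) \<le> g z * U" if "t \<in> {0..x}" for t
        unfolding norm_mult using that assms(4) elim U by (intro mult_mono) auto
    qed (use assms(4) in auto)
    finally show ?case .
  qed
  moreover have "((\<lambda>z. g z * U * (x - 0)) \<longlongrightarrow> 0) (at w)"
    by (rule tendsto_mult_left_zero[OF tendsto_mult_left_zero[OF g(1)]])
  ultimately have "((\<lambda>z. integral {0..x} (\<lambda>t. y z t * u t) - integral {0..x} (\<lambda>t. y w t * u t)) \<longlongrightarrow> 0) (at w)"
    by (rule Lim_null_comparison)
  then show ?thesis unfolding isCont_def by (rule LIM_zero_cancel)
qed

lemma sol_param_holomorphic: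
  assumes h: "(\<lambda>z. y z 0) holomorphic_on UNIV" "(\<lambda>z. y1 z 0) holomorphic_on UNIV"
    and x: "x \<in> {0..L}"
  shows "(\<lambda>z. y z x) holomorphic_on UNIV" "(\<lambda>z. y1 z x) holomorphic_on UNIV"
proof -
  have *: "(\<lambda>z. y z x) field_differentiable (at w) \<and> (\<lambda>z. y1 z x) field_differentiable (at w)" for w
  proof -
    have fd: "(\<lambda>z. y z 0) field_differentiable (at w)" "(\<lambda>z. y1 z 0) field_differentiable (at w)"
      using h by (auto simp: holomorphic_on_def)
    have ct: "isCont (\<lambda>z. y z 0) w" "isCont (\<lambda>z. y1 z 0) w"
      using fd by (auto intro: field_differentiable_imp_continuous_at)
    obtain c c1 where c: "sol L p w c c1" "c 0 = 1" "c1 0 = 0"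
      using sol_exists[OF p L] by blast
    obtain s s1 where s: "sol L p w s s1" "s 0 = 0" "s1 0 = 1"
      using sol_exists[OF p L] by blast
    have I: "(\<lambda>z. (z - w) * integral {0..x} (\<lambda>t. y z t * u t)) field_differentiable (at w)"
      if "continuous_on {0..L} u" for u
    proof -
      let ?g = "\<lambda>z. integral {0..x} (\<lambda>t. y z t * u t)"
      \<comment> \<open>Caratheodory's form of differentiability: the function vanishes at
        \<open>w\<close> and \<open>?g\<close> is its difference quotient, so continuity of
        \<open>?g\<close> at \<open>w\<close> is enough.\<close>
      have "(\<forall>z. (z - w) * ?g z - (w - w) * ?g w = ?g z * (z - w)) \<and> isCont ?g w \<and> ?g w = ?g w"
        using sol_param_integral[OF ct that x] by simp
      then show ?thesis
        unfolding field_differentiable_def CARAT_DERIV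
        by (intro exI[where x = "?g w"] exI[where x = ?g])
    qed
    have A: "(\<lambda>z. y z 0 + (z - w) * integral {0..x} (\<lambda>t. y z t * s t)) field_differentiable (at w)"
      by (rule field_differentiable_add[OF fd(1) I[OF sol_continuous[OF s(1)]]])
    have B: "(\<lambda>z. y1 z 0 - (z - w) * integral {0..x} (\<lambda>t. y z t * c t)) field_differentiable (at w)"
      by (rule field_differentiable_diff[OF fd(2) I[OF sol_continuous[OF c(1)]]])
    have lin: "(\<lambda>z. a * f z + b * g z) field_differentiable (at w)"
      if "f field_differentiable (at w)" "g field_differentiable (at w)" for a b and f g :: "complex \<Rightarrow> complex"
      using that by (intro field_differentiable_add field_differentiable_mult field_differentiable_const)
    show ?thesis
      using lin[OF A B, of "c x" "s x"] lin[OF A B, of "c1 x" "s1 x"]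
      unfolding sol_variation(1)[OF c s y x, symmetric] sol_variation(2)[OF c s y x, symmetric] by (rule conjI)
  qed
  show "(\<lambda>z. y z x) holomorphic_on UNIV"
    unfolding holomorphic_on_def by (rule ballI) (rule *[THEN conjunct1])
  show "(\<lambda>z. y1 z x) holomorphic_on UNIV"
    unfolding holomorphic_on_def by (rule ballI) (rule *[THEN conjunct2])
qed

end

subsection \<open>Asymptotics\<close>

lemma norm_exp_le: "norm (exp (k * of_real x)) \<le> exp (\<bar>Re k\<bar> * x)" if "0 \<le> x"
  for k :: complex
  using that by (simp add: mult_right_mono)

context
  fixes L :: real and p :: "real \<Rightarrow> real" and k :: complex and y y1 :: "real \<Rightarrow> complex"
  assumes p: "p absolutely_integrable_on {0..L}" and L: "0 \<le> L"
    and y: "sol L p (- k\<^sup>2) y y1"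
begin

text \<open>\<open>y1 + k' y\<close> satisfies the first-order equation \<open>u' = k' u + p y\<close>.\<close>

private lemma sol_first_order:
  assumes "k' = k \<or> k' = - k" and x: "x \<in> {0..L}"
    and P: "\<And>t. t \<in> {0..L} \<Longrightarrow> norm (y t) \<le> P * exp (\<bar>Re k\<bar> * t)"
  shows "norm (y1 x + k' * y x - exp (k' * of_real x) * (y1 0 + k' * y 0)) \<le>
    integral {0..L} (\<lambda>t. \<bar>p t\<bar>) * P * exp (\<bar>Re k\<bar> * x)"
proof -
  have k': "k' * k' = k\<^sup>2" "\<bar>Re k'\<bar> = \<bar>Re k\<bar>" using assms(1) by (auto simp: power2_eq_square)
  have "ac_on L (\<lambda>x. exp (- k' * of_real x)) (\<lambda>x. - k' * exp (- k' * of_real x))"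
    by (intro ac_on_continuous continuous_intros)
       (auto intro!: derivative_eq_intros has_vector_derivative_real_field)
  from ac_on_mult[OF this ac_on_add[OF sol_ac1[OF y] ac_on_cmult[OF sol_ac[OF y], of k']]]
  have "ac_on L (\<lambda>x. exp (- k' * of_real x) * (y1 x + k' * y x))
     (\<lambda>x. exp (- k' * of_real x) * (of_real (p x) * y x) + (k\<^sup>2 - k' * k') * exp (- k' * of_real x) * y x)"
    by (simp add: algebra_simps)
  then have "ac_on L (\<lambda>x. exp (- k' * of_real x) * (y1 x + k' * y x))
     (\<lambda>x. exp (- k' * of_real x) * (of_real (p x) * y x))"
    by (simp add: k')
  then have "((\<lambda>t. exp (- k' * of_real t) * (of_real (p t) * y t)) has_integral
      exp (- k' * of_real x) * (y1 x + k' * y x) - (y1 0 + k' * y 0)) {0..x}"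
    using x by (simp add: ac_on_def)
  note has_integral_mult_right[OF this, of "exp (k' * of_real x)"]
  moreover have E: "exp (k' * of_real x) * (exp (- k' * of_real t) * W) = exp (k' * of_real (x - t)) * W"
    for t and W :: complex
  proof -
    have "exp (k' * of_real x) * exp (- k' * of_real t) = exp (k' * of_real (x - t))"
      unfolding exp_add[symmetric] by (simp add: algebra_simps)
    then show ?thesis by (simp only: mult.assoc[symmetric])
  qed
  moreover have "exp (k' * of_real x) * (exp (- k' * of_real x) * W - V) = W - exp (k' * of_real x) * V"
    for W V :: complex
    using E[of x W] by (simp only: right_diff_distrib) simp
  ultimately
  have I: "((\<lambda>t. exp (k' * of_real (x - t)) * (of_real (p t) * y t)) has_integral
      y1 x + k' * y x - exp (k' * of_real x) * (y1 0 + k' * y 0)) {0..x}"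
    by (simp only:)
  have ap: "(\<lambda>t. \<bar>p t\<bar>) integrable_on {0..L}"
    using p by (simp add: absolutely_integrable_on_def)
  then have apx: "(\<lambda>t. \<bar>p t\<bar>) integrable_on {0..x}"
    by (rule integrable_on_subinterval) (use x in auto)
  have P0: "0 \<le> P" using order_trans[OF norm_ge_zero P[of 0]] L by simp
  have "norm (y1 x + k' * y x - exp (k' * of_real x) * (y1 0 + k' * y 0)) \<le>
      integral {0..x} (\<lambda>t. \<bar>p t\<bar> * (P * exp (\<bar>Re k\<bar> * x)))"
    unfolding integral_unique[OF I, symmetric]
  proof (rule integral_norm_bound_integral)
    show "(\<lambda>t. exp (k' * of_real (x - t)) * (of_real (p t) * y t)) integrable_on {0..x}"
      using I by blast
    show "(\<lambda>t. \<bar>p t\<bar> * (P * exp (\<bar>Re k\<bar> * x))) integrable_on {0..x}"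
      using apx by (rule integrable_on_mult_left)
    fix t assume t: "t \<in> {0..x}"
    have "norm (exp (k' * of_real (x - t)) * (of_real (p t) * y t)) \<le>
        exp (\<bar>Re k'\<bar> * (x - t)) * (\<bar>p t\<bar> * (P * exp (\<bar>Re k\<bar> * t)))"
      unfolding norm_mult norm_of_real using t x
      by (intro mult_mono norm_exp_le P mult_left_mono order_refl) auto
    also have "\<dots> = \<bar>p t\<bar> * (P * (exp (\<bar>Re k\<bar> * (x - t)) * exp (\<bar>Re k\<bar> * t)))"
      unfolding k' by (simp only: mult.left_commute)
    also have "exp (\<bar>Re k\<bar> * (x - t)) * exp (\<bar>Re k\<bar> * t) = exp (\<bar>Re k\<bar> * x)"
      by (simp add: exp_add[symmetric] algebra_simps)
    finally show "norm (exp (k' * of_real (x - t)) * (of_real (p t) * y t)) \<le>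
        \<bar>p t\<bar> * (P * exp (\<bar>Re k\<bar> * x))" .
  qed
  also have "\<dots> = integral {0..x} (\<lambda>t. \<bar>p t\<bar>) * P * exp (\<bar>Re k\<bar> * x)" by simp
  also have "\<dots> \<le> integral {0..L} (\<lambda>t. \<bar>p t\<bar>) * P * exp (\<bar>Re k\<bar> * x)"
    using x ap apx P0 by (intro mult_right_mono integral_subset_le) auto
  finally show ?thesis .
qed

text \<open>Half the difference and half the sum of the estimates \<open>sol_first_order\<close> for
  \<open>k\<close> and \<open>- k\<close> isolate \<open>k * y\<close> and \<open>y1\<close>. Their
  right-hand sides contain the supremum \<open>P\<close> of \<open>y\<close> weighted by
  \<open>exp (- \<bar>Re k\<bar> * t)\<close>. At the point where it is attained, the lower bound on
  \<open>norm k\<close> makes the error at most half of the weighted supremum, whence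
  \<open>P \<le> 2 * A\<close>.\<close>

lemma sol_asymptotics:
  assumes k: "norm k \<ge> 2 * integral {0..L} (\<lambda>t. \<bar>p t\<bar>)" "k \<noteq> 0" and x: "x \<in> {0..L}"
  defines "A \<equiv> norm (y 0) + norm (y1 0) / norm k"
  shows "norm (y x - (y 0 * cosh (k * of_real x) + y1 0 / k * sinh (k * of_real x))) \<le>
      2 * integral {0..L} (\<lambda>t. \<bar>p t\<bar>) * A * exp (\<bar>Re k\<bar> * x) / norm k" (is ?A)
    and "norm (y1 x - (y 0 * k * sinh (k * of_real x) + y1 0 * cosh (k * of_real x))) \<le>
      2 * integral {0..L} (\<lambda>t. \<bar>p t\<bar>) * A * exp (\<bar>Re k\<bar> * x)" (is ?B)
proof -
  let ?M = "integral {0..L} (\<lambda>t. \<bar>p t\<bar>)" and ?s = "\<bar>Re k\<bar>"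
  have both: "norm (y x - (y 0 * cosh (k * of_real x) + y1 0 / k * sinh (k * of_real x))) \<le>
      ?M * P * exp (?s * x) / norm k"
    "norm (y1 x - (y 0 * k * sinh (k * of_real x) + y1 0 * cosh (k * of_real x))) \<le>
      ?M * P * exp (?s * x)"
    if x: "x \<in> {0..L}" and P: "\<And>t. t \<in> {0..L} \<Longrightarrow> norm (y t) \<le> P * exp (?s * t)" for x P
  proof -
    define U where "U = y1 x + k * y x - exp (k * of_real x) * (y1 0 + k * y 0)"
    define V where "V = y1 x + (-k) * y x - exp ((-k) * of_real x) * (y1 0 + (-k) * y 0)"
    have U: "norm U \<le> ?M * P * exp (?s * x)" and V: "norm V \<le> ?M * P * exp (?s * x)"
      unfolding U_def V_def by (rule sol_first_order[OF _ x P]; simp)+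
    have UV: "norm (U - V) \<le> 2 * (?M * P * exp (?s * x))" "norm (U + V) \<le> 2 * (?M * P * exp (?s * x))"
      using U V norm_triangle_ineq4[of U V] norm_triangle_ineq[of U V] by linarith+
    have 1: "y x - (y 0 * cosh (k * of_real x) + y1 0 / k * sinh (k * of_real x)) = (U - V) / (2 * k)"
      using k(2) by (simp add: U_def V_def cosh_field_def sinh_field_def field_simps)
    have 2: "y1 x - (y 0 * k * sinh (k * of_real x) + y1 0 * cosh (k * of_real x)) = (U + V) / 2"
      by (simp add: U_def V_def cosh_field_def sinh_field_def field_simps)
    show "norm (y x - (y 0 * cosh (k * of_real x) + y1 0 / k * sinh (k * of_real x))) \<le>
      ?M * P * exp (?s * x) / norm k"
      unfolding 1 using UV(1) k(2) by (simp add: norm_divide norm_mult field_simps)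
    show "norm (y1 x - (y 0 * k * sinh (k * of_real x) + y1 0 * cosh (k * of_real x))) \<le>
      ?M * P * exp (?s * x)"
      unfolding 2 using UV(2) by (simp add: norm_divide)
  qed
  have "continuous_on {0..L} (\<lambda>t. norm (y t) * exp (- ?s * t))"
    by (intro continuous_intros sol_continuous[OF y])
  then obtain x0 where x0: "x0 \<in> {0..L}"
      "\<And>t. t \<in> {0..L} \<Longrightarrow> norm (y t) * exp (- ?s * t) \<le> norm (y x0) * exp (- ?s * x0)"
    using continuous_attains_sup[of "{0..L}" "\<lambda>t. norm (y t) * exp (- ?s * t)"] L by auto
  define P where "P = norm (y x0) * exp (- ?s * x0)"
  have P: "norm (y t) \<le> P * exp (?s * t)" if "t \<in> {0..L}" for t
    using x0(2)[OF that] by (simp add: P_def exp_minus field_simps)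
  have P0: "P \<ge> 0" by (simp add: P_def)
  have ch: "norm (cosh (k * of_real t)) \<le> exp (?s * t)" "norm (sinh (k * of_real t)) \<le> exp (?s * t)"
    if "t \<in> {0..L}" for t
  proof -
    have "norm (exp (k * of_real t)) \<le> exp (?s * t)" "norm (exp (- (k * of_real t))) \<le> exp (?s * t)"
      using norm_exp_le[of t k] norm_exp_le[of t "-k"] that by (simp_all del: norm_exp_eq_Re)
    then have "norm (exp (k * of_real t) + exp (- (k * of_real t))) \<le> 2 * exp (?s * t)"
      "norm (exp (k * of_real t) - exp (- (k * of_real t))) \<le> 2 * exp (?s * t)"
      using norm_triangle_ineq[of "exp (k * of_real t)" "exp (- (k * of_real t))"]
        norm_triangle_ineq4[of "exp (k * of_real t)" "exp (- (k * of_real t))"] by linarith+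
    then show "norm (cosh (k * of_real t)) \<le> exp (?s * t)" "norm (sinh (k * of_real t)) \<le> exp (?s * t)"
      by (simp_all add: cosh_field_def sinh_field_def norm_divide)
  qed
  have "norm (y 0 * cosh (k * of_real x0) + y1 0 / k * sinh (k * of_real x0)) \<le>
      norm (y 0) * exp (?s * x0) + norm (y1 0) / norm k * exp (?s * x0)"
    by (rule norm_triangle_le)
       (auto simp: norm_mult norm_divide intro!: add_mono mult_left_mono divide_right_mono ch x0)
  also have "\<dots> = A * exp (?s * x0)" by (simp add: A_def algebra_simps)
  finally have 0: "norm (y 0 * cosh (k * of_real x0) + y1 0 / k * sinh (k * of_real x0)) \<le> A * exp (?s * x0)" .
  have "?M * P * exp (?s * x0) / norm k \<le> P / 2 * exp (?s * x0)"
  proof -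
    have "?M * (P * exp (?s * x0)) \<le> norm k / 2 * (P * exp (?s * x0))"
      using k P0 by (intro mult_right_mono) auto
    then show ?thesis using k(2) by (simp add: field_simps)
  qed
  with both(1)[OF x0(1) P] 0
  have "norm (y x0) \<le> A * exp (?s * x0) + P / 2 * exp (?s * x0)"
    using norm_triangle_ineq2[of "y x0" "y 0 * cosh (k * of_real x0) + y1 0 / k * sinh (k * of_real x0)"]
    by linarith
  then have "P \<le> A + P / 2"
    by (simp add: P_def exp_minus field_simps)
  then have "P \<le> 2 * A" by simp
  then have PA: "norm (y t) \<le> 2 * A * exp (?s * t)" if "t \<in> {0..L}" for t
    by (rule order_trans[OF P[OF that] mult_right_mono]) (use \<open>P \<le> 2 * A\<close> in auto)
  show ?A using both(1)[OF x PA] by (simp add: mult_ac)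
  show ?B using both(2)[OF x PA] by (simp add: mult_ac)
qed

end

section \<open>Asymptotics of solutions satisfying a boundary condition\<close>

text \<open>The leading profile of a solution whose boundary coefficient has index \<open>n\<close>.
  For even \<open>n\<close> the initial value dominates; for odd \<open>n\<close>, including
  \<open>- 1\<close> for \<open>Infty\<close>, the initial slope does. Passing from \<open>n\<close>
  to \<open>n + 1\<close> is differentiation.\<close>

definition hyp :: "int \<Rightarrow> complex \<Rightarrow> complex" where
  "hyp n w = (if even n then cosh w else sinh w)"

lemma norm_hyp_le:
  assumes "0 \<le> t"
  shows "norm (hyp n (k * of_real t)) \<le> exp (\<bar>Re k\<bar> * t)"
proof -
  have "norm (exp (k * of_real t)) \<le> exp (\<bar>Re k\<bar> * t)" "norm (exp (- (k * of_real t))) \<le> exp (\<bar>Re k\<bar> * t)"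
    using norm_exp_le[of t k] norm_exp_le[of t "-k"] assms by (simp_all del: norm_exp_eq_Re)
  then have "norm (exp (k * of_real t) + exp (- (k * of_real t))) \<le> 2 * exp (\<bar>Re k\<bar> * t)"
    "norm (exp (k * of_real t) - exp (- (k * of_real t))) \<le> 2 * exp (\<bar>Re k\<bar> * t)"
    using norm_triangle_ineq[of "exp (k * of_real t)" "exp (- (k * of_real t))"]
      norm_triangle_ineq4[of "exp (k * of_real t)" "exp (- (k * of_real t))"] by linarith+
  then show ?thesis by (simp add: hyp_def cosh_field_def sinh_field_def norm_divide)
qed

text \<open>For \<open>Re w \<ge> 0\<close> write \<open>hyp n w\<close> as
  \<open>exp w * (1 + e) / 2\<close> or \<open>exp w * (1 - e) / 2\<close> with
  \<open>e = exp (- 2 * w)\<close>. Either \<open>e\<close> is small, or it is purely imaginary; in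
  both cases \<open>1 + e\<close> and \<open>1 - e\<close> have modulus at least \<open>1/2\<close>.
  Parity in \<open>w\<close> handles the other half-plane.\<close>

lemma norm_hyp_ge:
  assumes "cos (2 * Im w) = 0 \<or> 1 \<le> \<bar>Re w\<bar>"
  shows "exp \<bar>Re w\<bar> / 4 \<le> norm (hyp n w)"
proof -
  have *: "exp (Re w) / 4 \<le> norm (hyp n w)" if w: "cos (2 * Im w) = 0 \<or> 1 \<le> Re w" for w
  proof -
    define e where "e = exp (- (2 * w))"
    have "1/2 \<le> norm (1 + e) \<and> 1/2 \<le> norm (1 - e)"
    proof (cases "1 \<le> Re w")
      case True
      have "3 \<le> exp (2 * Re w)" using exp_ge_add_one_self[of "2 * Re w"] True by linarith
      then have "inverse (exp (2 * Re w)) \<le> inverse 3" by (rule le_imp_inverse_le) simp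
      moreover have "norm e = inverse (exp (2 * Re w))" by (simp add: e_def exp_minus[symmetric])
      ultimately have "norm e \<le> 1/2" by simp
      then show ?thesis
        using norm_triangle_ineq2[of 1 "-e"] norm_triangle_ineq2[of 1 e] by simp
    next
      case False
      then have "Re e = 0" using w by (simp add: e_def Re_exp)
      then show ?thesis using complex_Re_le_cmod[of "1 + e"] complex_Re_le_cmod[of "1 - e"] by simp
    qed
    moreover have "exp w * e = exp (- w)" by (simp add: e_def exp_add[symmetric])
    then have "exp w * (1 + e) = exp w + exp (- w)" "exp w * (1 - e) = exp w - exp (- w)"
      by (simp_all add: distrib_left right_diff_distrib)
    then have "hyp n w = exp w * (1 + e) / 2 \<or> hyp n w = exp w * (1 - e) / 2"
      by (simp add: hyp_def cosh_field_def sinh_field_def)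
    then have "norm (hyp n w) = exp (Re w) * norm (1 + e) / 2 \<or> norm (hyp n w) = exp (Re w) * norm (1 - e) / 2"
    proof (elim disj_forward)
      show "norm (hyp n w) = exp (Re w) * norm (1 + e) / 2" if "hyp n w = exp w * (1 + e) / 2"
        unfolding that norm_divide norm_mult by simp
      show "norm (hyp n w) = exp (Re w) * norm (1 - e) / 2" if "hyp n w = exp w * (1 - e) / 2"
        unfolding that norm_divide norm_mult by simp
    qed
    moreover have half: "exp (Re w) / 2 \<le> exp (Re w) * x" if "1/2 \<le> x" for x
      using mult_left_mono[OF that, of "exp (Re w)"] by simp
    ultimately show ?thesis
      using half[of "norm (1 + e)"] half[of "norm (1 - e)"] by linarith
  qed
  show ?thesis
  proof (cases "0 \<le> Re w")
    case True
    then show ?thesis using *[of w] assms by auto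
  next
    case False
    moreover have "norm (hyp n (- w)) = norm (hyp n w)" by (simp add: hyp_def)
    ultimately show ?thesis using *[of "- w"] assms by auto
  qed
qed

text \<open>Here \<open>d\<close> is only an upper bound for the degree, because the coefficient of
  \<open>up g\<close> at \<open>d\<close> may vanish. Integer powers admit the exponent
  \<open>- 1\<close> for \<open>d = 0\<close>.\<close>

lemma cpoly_asymptotics:
  assumes "degree P \<le> d"
  shows "\<exists>K\<ge>0. \<forall>k. 1 \<le> norm k \<longrightarrow>
    norm (cpoly P (- k\<^sup>2) - of_real (coeff P d) * (- k\<^sup>2) ^ d) \<le> K * norm k powi (2 * int d - 1)"
proof -
  define K where "K = (\<Sum>i<d. \<bar>coeff P i\<bar>)"
  have "norm (cpoly P (- k\<^sup>2) - of_real (coeff P d) * (- k\<^sup>2) ^ d) \<le> K * norm k powi (2 * int d - 1)"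
    if k: "1 \<le> norm k" for k
  proof -
    have deg: "degree (map_poly complex_of_real P) \<le> d"
      using map_poly_degree_leq[of complex_of_real P] assms by simp
    have "cpoly P (- k\<^sup>2) = (\<Sum>i\<le>d. of_real (coeff P i) * (- k\<^sup>2) ^ i)"
      unfolding poly_altdef using deg
      by (intro sum.mono_neutral_cong_left) (auto simp: coeff_map_poly intro!: le_degree)
    also have "\<dots> = of_real (coeff P d) * (- k\<^sup>2) ^ d + (\<Sum>i<d. of_real (coeff P i) * (- k\<^sup>2) ^ i)"
      by (simp add: lessThan_Suc_atMost[symmetric] lessThan_Suc)
    finally have "cpoly P (- k\<^sup>2) - of_real (coeff P d) * (- k\<^sup>2) ^ d =
        (\<Sum>i<d. of_real (coeff P i) * (- k\<^sup>2) ^ i)" by simp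
    also have "norm \<dots> \<le> (\<Sum>i<d. \<bar>coeff P i\<bar> * norm k powi (2 * int d - 1))"
    proof (rule sum_norm_le)
      fix i assume "i \<in> {..<d}"
      then have "2 * int i \<le> 2 * int d - 1" by auto
      then have "norm k powi (2 * int i) \<le> norm k powi (2 * int d - 1)"
        by (rule power_int_increasing) (use k in auto)
      moreover have "norm ((- k\<^sup>2) ^ i) = norm k powi (2 * int i)"
        by (simp add: norm_power power_mult[symmetric] power_int_def nat_mult_distrib)
      ultimately show "norm (of_real (coeff P i) * (- k\<^sup>2) ^ i) \<le> \<bar>coeff P i\<bar> * norm k powi (2 * int d - 1)"
        by (simp add: norm_mult mult_left_mono)
    qed
    also have "\<dots> = K * norm k powi (2 * int d - 1)"
      by (simp add: K_def sum_distrib_right)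
    finally show ?thesis .
  qed
  moreover have "K \<ge> 0" by (auto simp: K_def intro: sum_nonneg)
  ultimately show ?thesis by blast
qed

lemma prod_linear_degree_coeff:
  fixes a :: "nat \<Rightarrow> real"
  shows "degree (\<Prod>k<d. [:a k, - 1:]) \<le> d \<and> coeff (\<Prod>k<d. [:a k, - 1:]) d = (- 1) ^ d"
proof (induction d)
  case (Suc d)
  let ?P = "\<Prod>k<d. [:a k, - 1:]"
  have eq: "(\<Prod>k<Suc d. [:a k, - 1:]) = [:a d, - 1:] * ?P" by (simp add: mult.commute)
  have "degree ([:a d, - 1:] * ?P) \<le> Suc d"
    using degree_mult_le[of "[:a d, - 1:]" ?P] Suc by simp
  moreover have "coeff ([:a d, - 1:] * ?P) (Suc d) = (- 1) ^ Suc d"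
    using Suc coeff_eq_0[of ?P "Suc d"] by (simp add: mult_pCons_left)
  ultimately show ?case unfolding eq by blast
qed simp

text \<open>The factor \<open>lead_norm\<close> makes the leading coefficient of the dominant
  polynomial (\<open>up\<close> for \<open>h0 > 0\<close>, \<open>down\<close> for
  \<open>h0 = 0\<close>) equal to \<open>(- 1) ^ d\<close>. This sign cancels against that of
  \<open>(- k\<^sup>2) ^ d\<close>, so the leading term is exactly \<open>k powi n\<close> or
  \<open>k powi (n + 1)\<close>.\<close>

lemma down_up_asymptotics:
  assumes "g \<in> class_R"
  defines "n \<equiv> ind g"
  shows "\<exists>K\<ge>0. \<forall>k. 1 \<le> norm k \<longrightarrow>
    norm (cpoly (down g) (- k\<^sup>2) - (if even n then k powi n else 0)) \<le> K * norm k powi (n - 1) \<and>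
    norm (- cpoly (up g) (- k\<^sup>2) - (if even n then 0 else k powi (n + 1))) \<le> K * norm k powi n"
proof (cases g)
  case Infty
  have "map_poly complex_of_real (- 1) = - 1"
    by (rule poly_eqI) (simp add: coeff_map_poly)
  then show ?thesis using Infty by (intro exI[of _ 0]) (simp add: n_def)
next
  case (Ratl h0 h ps)
  have h0: "h0 \<ge> 0" using assms(1) by (auto simp: class_R_def Ratl)
  define d where "d = length ps"
  define c where "c = lead_norm h0"
  have D: "degree (down g) \<le> d" "coeff (down g) d = c * (- 1) ^ d"
    using prod_linear_degree_coeff[of "\<lambda>k. fst (ps ! k)" d]
      degree_smult_le[of c "\<Prod>k<d. [:fst (ps ! k), - 1:]"]
    by (auto simp: Ratl d_def c_def simp del: degree_smult_eq)
  define S where "S = smult c (\<Sum>k<d. smult (snd (ps ! k)) (\<Prod>j\<in>{..<d} - {k}. [:fst (ps ! j), - 1:]))"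
  have S: "degree S \<le> d"
  proof -
    have "degree (smult (snd (ps ! k)) (\<Prod>j\<in>{..<d} - {k}. [:fst (ps ! j), - 1:])) \<le> d" for k
    proof -
      have "degree (\<Prod>j\<in>{..<d} - {k}. [:fst (ps ! j), - 1:]) \<le>
          (\<Sum>j\<in>{..<d} - {k}. degree [:fst (ps ! j), - 1:])"
        using degree_prod_sum_le[of "{..<d} - {k}" "\<lambda>j. [:fst (ps ! j), - 1:]"] by (simp add: o_def)
      also have "\<dots> = card ({..<d} - {k})" by simp
      also have "\<dots> \<le> card {..<d}" by (rule card_mono) auto
      finally have "degree (\<Prod>j\<in>{..<d} - {k}. [:fst (ps ! j), - 1:]) \<le> d" by simp
      then show ?thesis using degree_smult_le order_trans by blast
    qed
    then have "degree (\<Sum>k<d. smult (snd (ps ! k)) (\<Prod>j\<in>{..<d} - {k}. [:fst (ps ! j), - 1:])) \<le> d"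
      by (intro degree_sum_le) auto
    then show ?thesis unfolding S_def using degree_smult_le order_trans by blast
  qed
  have up: "up g = smult h (down g) + pCons 0 (smult h0 (down g)) + S"
  proof -
    have "up g = [:h, h0:] * down g + S" by (simp only: Ratl up.simps S_def c_def d_def)
    then show ?thesis by (simp only: mult_pCons_left) simp
  qed
  have pw: "(- k\<^sup>2) ^ i = (- 1) ^ i * k powi (2 * int i)" for k :: complex and i
    by (simp add: power_minus[of "k\<^sup>2"] power_mult[symmetric] power_int_def nat_mult_distrib)
  have sq: "(- 1) ^ i * ((- 1) ^ i * x) = x" for i and x :: complex
    by (simp add: mult.assoc[symmetric] power_add[symmetric])
  have big: "norm w \<le> (\<bar>b\<bar> + K) * norm k powi (2 * int e)"
    if "norm (w - of_real b * (- k\<^sup>2) ^ e) \<le> K * norm k powi (2 * int e - 1)" "1 \<le> norm k" "0 \<le> K"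
    for w k :: complex and b K and e :: nat
  proof -
    have "norm k powi (2 * int e - 1) \<le> norm k powi (2 * int e)"
      by (rule power_int_increasing) (use that in auto)
    then have "K * norm k powi (2 * int e - 1) \<le> K * norm k powi (2 * int e)"
      using that by (intro mult_left_mono)
    moreover have "norm (of_real b * (- k\<^sup>2) ^ e) = \<bar>b\<bar> * norm k powi (2 * int e)"
      unfolding pw by (simp add: norm_mult norm_power norm_power_int)
    ultimately show ?thesis
      using that(1) norm_triangle_ineq2[of w "of_real b * (- k\<^sup>2) ^ e"] by (simp add: algebra_simps)
  qed
  show ?thesis
  proof (cases "h0 > 0")
    case True
    have n: "n = 2 * int d + 1" using True by (simp add: n_def Ratl d_def)
    have "degree (up g) \<le> Suc d"
      unfolding up using D(1) S degree_smult_le[of h "down g"] degree_smult_le[of h0 "down g"]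
      by (intro degree_add_le) (auto simp: degree_pCons_eq_if)
    moreover have "coeff (up g) (Suc d) = (- 1) ^ d"
      unfolding up using D S True coeff_eq_0[of "down g" "Suc d"] coeff_eq_0[of S "Suc d"]
      by (simp add: c_def lead_norm_def)
    ultimately obtain K1 where K1: "K1 \<ge> 0" "\<And>k. 1 \<le> norm k \<Longrightarrow>
        norm (cpoly (up g) (- k\<^sup>2) - of_real ((- 1) ^ d) * (- k\<^sup>2) ^ Suc d) \<le> K1 * norm k powi (2 * int (Suc d) - 1)"
      using cpoly_asymptotics[of "up g" "Suc d"] by metis
    obtain K2 where K2: "K2 \<ge> 0" "\<And>k. 1 \<le> norm k \<Longrightarrow>
        norm (cpoly (down g) (- k\<^sup>2) - of_real (c * (- 1) ^ d) * (- k\<^sup>2) ^ d) \<le> K2 * norm k powi (2 * int d - 1)"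
      using cpoly_asymptotics[OF D(1)] unfolding D(2) by blast
    define K where "K = max K1 (\<bar>c\<bar> + K2)"
    have "norm (cpoly (down g) (- k\<^sup>2)) \<le> K * norm k powi (n - 1) \<and>
      norm (- cpoly (up g) (- k\<^sup>2) - k powi (n + 1)) \<le> K * norm k powi n" if k: "1 \<le> norm k" for k
    proof
      have "norm (cpoly (down g) (- k\<^sup>2)) \<le> (\<bar>c\<bar> + K2) * norm k powi (n - 1)"
        using big[OF K2(2)[OF k] k K2(1)] by (simp add: n abs_mult)
      also have "\<dots> \<le> K * norm k powi (n - 1)"
        by (intro mult_right_mono) (auto simp: K_def)
      finally show "norm (cpoly (down g) (- k\<^sup>2)) \<le> K * norm k powi (n - 1)" .
      have "of_real ((- 1) ^ d) * (- k\<^sup>2) ^ Suc d = - (k powi (n + 1))"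
        unfolding pw n by (simp add: sq)
      then have "norm (- cpoly (up g) (- k\<^sup>2) - k powi (n + 1)) \<le> K1 * norm k powi n"
        using K1(2)[OF k] norm_minus_cancel[of "cpoly (up g) (- k\<^sup>2) + k powi (n + 1)"]
        by (simp add: n add.commute)
      also have "\<dots> \<le> K * norm k powi n"
        by (intro mult_right_mono) (auto simp: K_def)
      finally show "norm (- cpoly (up g) (- k\<^sup>2) - k powi (n + 1)) \<le> K * norm k powi n" .
    qed
    moreover have "K \<ge> 0" using K1(1) by (simp add: K_def)
    ultimately show ?thesis by (intro exI[of _ K]) (simp add: n)
  next
    case False
    then have "h0 = 0" using h0 by simp
    have n: "n = 2 * int d" using False by (simp add: n_def Ratl d_def)
    have c: "c = 1" using \<open>h0 = 0\<close> by (simp add: c_def lead_norm_def)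
    have "degree (up g) \<le> d"
      unfolding up \<open>h0 = 0\<close> using D(1) S degree_smult_le[of h "down g"]
      by (intro degree_add_le) auto
    then obtain K1 where K1: "K1 \<ge> 0" "\<And>k. 1 \<le> norm k \<Longrightarrow>
        norm (cpoly (up g) (- k\<^sup>2) - of_real (coeff (up g) d) * (- k\<^sup>2) ^ d) \<le> K1 * norm k powi (2 * int d - 1)"
      using cpoly_asymptotics[of "up g" "d"] by metis
    obtain K2 where K2: "K2 \<ge> 0" "\<And>k. 1 \<le> norm k \<Longrightarrow>
        norm (cpoly (down g) (- k\<^sup>2) - of_real (c * (- 1) ^ d) * (- k\<^sup>2) ^ d) \<le> K2 * norm k powi (2 * int d - 1)"
      using cpoly_asymptotics[OF D(1)] unfolding D(2) by blast
    define K where "K = max K2 (\<bar>coeff (up g) d\<bar> + K1)"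
    have "norm (cpoly (down g) (- k\<^sup>2) - k powi n) \<le> K * norm k powi (n - 1) \<and>
      norm (- cpoly (up g) (- k\<^sup>2)) \<le> K * norm k powi n" if k: "1 \<le> norm k" for k
    proof
      have "norm (- cpoly (up g) (- k\<^sup>2)) \<le> (\<bar>coeff (up g) d\<bar> + K1) * norm k powi n"
        using big[OF K1(2)[OF k] k K1(1)] by (simp add: n)
      also have "\<dots> \<le> K * norm k powi n"
        by (intro mult_right_mono) (auto simp: K_def)
      finally show "norm (- cpoly (up g) (- k\<^sup>2)) \<le> K * norm k powi n" .
      have "of_real (c * (- 1) ^ d) * (- k\<^sup>2) ^ d = k powi n"
        unfolding pw n c by (simp add: sq)
      then have "norm (cpoly (down g) (- k\<^sup>2) - k powi n) \<le> K2 * norm k powi (n - 1)"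
        using K2(2)[OF k] by (simp add: n)
      also have "\<dots> \<le> K * norm k powi (n - 1)"
        by (intro mult_right_mono) (auto simp: K_def)
      finally show "norm (cpoly (down g) (- k\<^sup>2) - k powi n) \<le> K * norm k powi (n - 1)" .
    qed
    moreover have "K \<ge> 0" using K2(1) by (simp add: K_def)
    ultimately show ?thesis by (intro exI[of _ K]) (simp add: n)
  qed
qed

text \<open>
  These are the data of the condition with coefficient \<open>g\<close> at the left end point; a condition at the
  right end point takes the same form after the reflection \<open>x \<mapsto> L - x\<close>, which changes the sign of \<open>y1\<close>.
\<close>

definition bc_sol :: "real \<Rightarrow> (real \<Rightarrow> real) \<Rightarrow> bcoeff \<Rightarrow> (complex \<Rightarrow> real \<Rightarrow> complex) \<Rightarrow>
    (complex \<Rightarrow> real \<Rightarrow> complex) \<Rightarrow> bool" where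
  "bc_sol L p g y y1 \<longleftrightarrow> (\<forall>z. sol L p z (y z) (y1 z) \<and>
     y z 0 = cpoly (down g) z \<and> y1 z 0 = - cpoly (up g) z)"

lemma bc_sol_exists:
  assumes "p absolutely_integrable_on {0..L}" "0 \<le> L"
  obtains y y1 where "bc_sol L p g y y1"
proof -
  have "\<exists>Y. sol L p z (fst Y) (snd Y) \<and> fst Y 0 = cpoly (down g) z \<and> snd Y 0 = - cpoly (up g) z" for z
    using sol_exists[OF assms, of z "cpoly (down g) z" "- cpoly (up g) z"] by auto
  then obtain Y where "\<And>z. sol L p z (fst (Y z)) (snd (Y z)) \<and>
      fst (Y z) 0 = cpoly (down g) z \<and> snd (Y z) 0 = - cpoly (up g) z"
    by metis
  then have "bc_sol L p g (\<lambda>z. fst (Y z)) (\<lambda>z. snd (Y z))" by (simp add: bc_sol_def)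
  then show ?thesis by (rule that)
qed

lemma bc_sol_holomorphic:
  assumes "p absolutely_integrable_on {0..L}" "bc_sol L p g y y1" "x \<in> {0..L}"
  shows "(\<lambda>z. y z x) holomorphic_on UNIV" "(\<lambda>z. y1 z x) holomorphic_on UNIV"
proof -
  have "(\<lambda>z. y z 0) holomorphic_on UNIV" "(\<lambda>z. y1 z 0) holomorphic_on UNIV"
    using assms(2) by (auto simp: bc_sol_def intro!: holomorphic_intros)
  moreover have "0 \<le> L" "\<And>z. sol L p z (y z) (y1 z)" using assms by (auto simp: bc_sol_def)
  ultimately show "(\<lambda>z. y z x) holomorphic_on UNIV" "(\<lambda>z. y1 z x) holomorphic_on UNIV"
    using sol_param_holomorphic[OF assms(1) _ _ _ _ assms(3), of y y1] by blast+
qed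

text \<open>The dominant parts \<open>\<alpha>0\<close> and \<open>\<beta>0\<close> of the Cauchy
  data yield the \<open>hyp\<close> terms exactly. The remainders of the data and the influence of
  the potential are both smaller by one power of \<open>norm k\<close>.\<close>

lemma bc_sol_asymptotics:
  assumes p: "p absolutely_integrable_on {0..L}" and L: "0 \<le> L" and g: "g \<in> class_R"
    and y: "bc_sol L p g y y1"
  defines "n \<equiv> ind g"
  obtains K R where "K > 0" "R \<ge> 1"
    "\<And>k x. norm k \<ge> R \<Longrightarrow> x \<in> {0..L} \<Longrightarrow>
      norm (y (- k\<^sup>2) x - k powi n * hyp n (k * of_real x)) \<le>
        K * norm k powi (n - 1) * exp (\<bar>Re k\<bar> * x)"
    "\<And>k x. norm k \<ge> R \<Longrightarrow> x \<in> {0..L} \<Longrightarrow>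
      norm (y1 (- k\<^sup>2) x - k powi (n + 1) * hyp (n + 1) (k * of_real x)) \<le>
        K * norm k powi n * exp (\<bar>Re k\<bar> * x)"
proof -
  let ?M = "integral {0..L} (\<lambda>t. \<bar>p t\<bar>)"
  obtain K0 where K0: "K0 \<ge> 0"
    "\<And>k. 1 \<le> norm k \<Longrightarrow> norm (cpoly (down g) (- k\<^sup>2) - (if even n then k powi n else 0)) \<le> K0 * norm k powi (n - 1)"
    "\<And>k. 1 \<le> norm k \<Longrightarrow> norm (- cpoly (up g) (- k\<^sup>2) - (if even n then 0 else k powi (n + 1))) \<le> K0 * norm k powi n"
    using down_up_asymptotics[OF g] unfolding n_def by blast
  \<comment> \<open>The first summand comes from \<open>sol_asymptotics\<close> with
    \<open>A \<le> 2 * (1 + K0) * T\<close>, the second from the errors of the two Cauchy data; the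
    last one makes \<open>K\<close> positive.\<close>
  define K where "K = 4 * ?M * (1 + K0) + 2 * K0 + 1"
  have M0: "?M \<ge> 0"
    using p by (intro Henstock_Kurzweil_Integration.integral_nonneg) (auto simp: absolutely_integrable_on_def)
  have main: "norm (y (- k\<^sup>2) x - k powi n * hyp n (k * of_real x)) \<le>
        K * norm k powi (n - 1) * exp (\<bar>Re k\<bar> * x) \<and>
      norm (y1 (- k\<^sup>2) x - k powi (n + 1) * hyp (n + 1) (k * of_real x)) \<le>
        K * norm k powi n * exp (\<bar>Re k\<bar> * x)"
    if k: "norm k \<ge> max 1 (2 * ?M)" and x: "x \<in> {0..L}" for k x
  proof -
    define r where "r = norm k"
    define T where "T = r powi n"
    define e where "e = exp (\<bar>Re k\<bar> * x)"
    have r: "r \<ge> 1" "k \<noteq> 0" "r > 0" using k by (auto simp: r_def)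
    have T: "T > 0" "r powi (n - 1) = T / r" "r powi (n + 1) = T * r"
      using r by (auto simp: T_def power_int_diff power_int_add)
    have Tk: "norm (k powi n) = T" "norm (k powi (n + 1)) = T * r"
      unfolding norm_power_int r_def[symmetric] T by (simp_all add: T_def)
    have kk: "k powi (n + 1) = k powi n * k" using r by (simp add: power_int_add)
    have e: "e > 0" "norm (hyp m (k * of_real x)) \<le> e" for m
      using norm_hyp_le[of x m k] x by (auto simp: e_def)
    define \<alpha> where "\<alpha> = cpoly (down g) (- k\<^sup>2)"
    define \<beta> where "\<beta> = - cpoly (up g) (- k\<^sup>2)"
    define \<alpha>0 where "\<alpha>0 = (if even n then k powi n else 0)"
    define \<beta>0 where "\<beta>0 = (if even n then 0 else k powi (n + 1))"
    have ab: "norm (\<alpha> - \<alpha>0) \<le> K0 * (T / r)" "norm (\<beta> - \<beta>0) \<le> K0 * T"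
      using K0(2,3)[of k] r T unfolding \<alpha>_def \<beta>_def \<alpha>0_def \<beta>0_def r_def[symmetric] T_def[symmetric] by auto
    have Tr: "T / r \<le> T" "T \<le> T * r" using r T(1) by (auto simp: field_simps)
    have "norm \<alpha>0 \<le> T" "norm \<beta>0 \<le> T * r" using Tk T(1) r by (auto simp: \<alpha>0_def \<beta>0_def)
    moreover have "norm \<alpha> \<le> norm \<alpha>0 + norm (\<alpha> - \<alpha>0)" "norm \<beta> \<le> norm \<beta>0 + norm (\<beta> - \<beta>0)"
      using norm_triangle_ineq[of \<alpha>0 "\<alpha> - \<alpha>0"] norm_triangle_ineq[of \<beta>0 "\<beta> - \<beta>0"] by simp_all
    moreover have "K0 * (T / r) \<le> K0 * T" "K0 * T \<le> K0 * (T * r)"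
      by (rule mult_left_mono[OF Tr(1) K0(1)], rule mult_left_mono[OF Tr(2) K0(1)])
    ultimately have a: "norm \<alpha> \<le> (1 + K0) * T" and b: "norm \<beta> \<le> (1 + K0) * T * r"
      using ab by (auto simp: algebra_simps)
    define A where "A = norm \<alpha> + norm \<beta> / r"
    have "norm \<beta> / r \<le> (1 + K0) * T" using b r by (simp add: field_simps)
    with a have "A \<le> (1 + K0) * T + (1 + K0) * T" unfolding A_def by (rule add_mono)
    then have A: "A \<le> 2 * (1 + K0) * T" by (simp add: algebra_simps)
    have MA: "2 * ?M * A * e \<le> 4 * ?M * (1 + K0) * T * e"
      using mult_left_mono[OF A, of "2 * ?M * e"] M0 e(1) by (simp add: algebra_simps)
    have ys: "sol L p (- k\<^sup>2) (y (- k\<^sup>2)) (y1 (- k\<^sup>2))" "y (- k\<^sup>2) 0 = \<alpha>" "y1 (- k\<^sup>2) 0 = \<beta>"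
      using y by (auto simp: bc_sol_def \<alpha>_def \<beta>_def)
    let ?c = "cosh (k * of_real x)" and ?s = "sinh (k * of_real x)"
    have cs: "norm ?c \<le> e" "norm ?s \<le> e" using e(2)[of 0] e(2)[of 1] by (simp_all add: hyp_def)
    have k2: "norm k \<ge> 2 * ?M" using k by simp
    note as = sol_asymptotics[OF p L ys(1) k2 r(2) x, unfolded ys(2,3), folded r_def e_def, folded A_def]
    have "norm (y (- k\<^sup>2) x - (\<alpha> * ?c + \<beta> / k * ?s)) \<le> 4 * ?M * (1 + K0) * T * e / r"
      using as(1) MA r by (smt (verit) divide_right_mono)
    moreover have "norm ((\<alpha> - \<alpha>0) * ?c + (\<beta> - \<beta>0) / k * ?s) \<le> K0 * (T / r) * e + K0 * T / r * e"
      unfolding norm_divide norm_mult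
      by (rule norm_triangle_le, unfold norm_mult norm_divide r_def[symmetric], intro add_mono mult_mono)
         (use ab cs r T K0(1) in \<open>auto intro: divide_right_mono\<close>)
    moreover have "\<alpha>0 * ?c + \<beta>0 / k * ?s = k powi n * hyp n (k * of_real x)"
      using r(2) by (simp add: \<alpha>0_def \<beta>0_def hyp_def kk)
    ultimately have "norm (y (- k\<^sup>2) x - k powi n * hyp n (k * of_real x)) \<le>
        4 * ?M * (1 + K0) * T * e / r + (K0 * (T / r) * e + K0 * T / r * e)"
      using norm_triangle_ineq[of "y (- k\<^sup>2) x - (\<alpha> * ?c + \<beta> / k * ?s)" "(\<alpha> - \<alpha>0) * ?c + (\<beta> - \<beta>0) / k * ?s"]
      by (simp add: algebra_simps diff_divide_distrib)
    also have "\<dots> \<le> K * (T / r) * e"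
      using T(1) e(1) r(3) by (simp add: K_def field_simps)
    finally have 1: "norm (y (- k\<^sup>2) x - k powi n * hyp n (k * of_real x)) \<le> K * (T / r) * e" .
    have "norm (y1 (- k\<^sup>2) x - (\<alpha> * k * ?s + \<beta> * ?c)) \<le> 4 * ?M * (1 + K0) * T * e"
      using as(2) MA by linarith
    moreover have "norm ((\<alpha> - \<alpha>0) * k * ?s + (\<beta> - \<beta>0) * ?c) \<le> K0 * (T / r) * r * e + K0 * T * e"
      by (rule norm_triangle_le, unfold norm_mult r_def[symmetric], intro add_mono mult_mono)
         (use ab cs r T K0(1) in auto)
    moreover have "\<alpha>0 * k * ?s + \<beta>0 * ?c = k powi (n + 1) * hyp (n + 1) (k * of_real x)"
      using r(2) by (simp add: \<alpha>0_def \<beta>0_def hyp_def kk)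
    ultimately have "norm (y1 (- k\<^sup>2) x - k powi (n + 1) * hyp (n + 1) (k * of_real x)) \<le>
        4 * ?M * (1 + K0) * T * e + (K0 * (T / r) * r * e + K0 * T * e)"
      using norm_triangle_ineq[of "y1 (- k\<^sup>2) x - (\<alpha> * k * ?s + \<beta> * ?c)" "(\<alpha> - \<alpha>0) * k * ?s + (\<beta> - \<beta>0) * ?c"]
      by (simp add: algebra_simps)
    also have "\<dots> \<le> K * T * e"
      using T(1) e(1) r(3) by (simp add: K_def field_simps)
    finally have 2: "norm (y1 (- k\<^sup>2) x - k powi (n + 1) * hyp (n + 1) (k * of_real x)) \<le> K * T * e" .
    show ?thesis using 1 2 T(2) by (simp add: r_def T_def e_def)
  qed
  show ?thesis
  proof (rule that)
    show "K > 0" using M0 K0(1) by (simp add: K_def add_nonneg_pos)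
    show "max 1 (2 * ?M) \<ge> 1" by simp
  qed (use main in blast)+
qed

section \<open>Entire functions bounded on large squares\<close>

text \<open>Quantifying over \<open>n\<close> asks for the lower bound on \<open>cosh\<close> and
  \<open>sinh\<close> at once, so that one family of contours serves all boundary
  coefficients.\<close>

definition hyp_large :: "real \<Rightarrow> complex \<Rightarrow> bool" where
  "hyp_large L k \<longleftrightarrow> (\<forall>n. exp (\<bar>Re k\<bar> * L) / 4 \<le> norm (hyp n (k * of_real L)))"

lemma hyp_large_of_real:
  assumes "1 \<le> L * t" "0 < L" "0 < t"
  shows "hyp_large L (of_real t)"
  unfolding hyp_large_def
proof
  fix n
  have "1 \<le> \<bar>Re (of_real t * of_real L)\<bar>" using assms by (simp add: mult.commute)
  then show "exp (\<bar>Re (of_real t)\<bar> * L) / 4 \<le> norm (hyp n (of_real t * of_real L))"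
    using norm_hyp_ge[of "of_real t * of_real L" n] assms by (simp add: abs_mult)
qed

lemma square_hyp_large:
  assumes L: "L > 0"
  obtains R where "R \<ge> R0" "R > 0"
    "\<And>k. max \<bar>Re k\<bar> \<bar>Im k\<bar> = R \<Longrightarrow> hyp_large L k"
proof -
  obtain N :: nat where N: "max R0 0 * (4 * L) / pi < real N" using reals_Archimedean2 by blast
  \<comment> \<open>On the horizontal sides \<open>2 * R * L\<close> is an odd multiple of
    \<open>pi / 2\<close>, so the cosine in \<open>norm_hyp_ge\<close> vanishes. The summand
    \<open>3\<close> instead of \<open>1\<close> ensures
    \<open>R * L \<ge> 3 * pi / 4 \<ge> 1\<close> on the vertical sides, even for
    \<open>N = 0\<close>.\<close>
  define R where "R = (2 * real N + 3) * pi / (4 * L)"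
  show ?thesis
  proof (rule that)
    have "max R0 0 * (4 * L) < real N * pi" using N by (simp add: field_simps)
    also have "\<dots> \<le> (2 * real N + 3) * pi" by (simp add: mult_right_mono)
    finally have "max R0 0 < R" using L by (simp add: R_def field_simps del: max_less_iff_conj)
    then show "R0 \<le> R" "R > 0" by auto
    fix k assume k: "max \<bar>Re k\<bar> \<bar>Im k\<bar> = R"
    have RL: "R * L = (2 * real N + 3) * pi / 4" using L by (simp add: R_def)
    have "cos (2 * Im (k * of_real L)) = 0 \<or> 1 \<le> \<bar>Re (k * of_real L)\<bar>"
    proof (cases "\<bar>Re k\<bar> = R")
      case True
      then have "\<bar>Re (k * of_real L)\<bar> = (2 * real N + 3) * pi / 4" using RL L by (simp add: abs_mult)
      moreover have "(2 * real N + 3) * pi \<ge> 3 * pi" by (intro mult_right_mono) auto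
      then have "(2 * real N + 3) * pi / 4 \<ge> 1" using pi_gt3 by linarith
      ultimately show ?thesis by simp
    next
      case False
      then have "\<bar>Im k\<bar> = R" using k by (auto simp: max_def split: if_splits)
      then have "\<bar>2 * Im (k * of_real L)\<bar> = of_int (2 * int N + 3) * (pi / 2)"
        using RL L by (simp add: abs_mult)
      then have "cos \<bar>2 * Im (k * of_real L)\<bar> = 0"
        unfolding cos_zero_iff_int by (intro exI[of _ "2 * int N + 3"]) auto
      then show ?thesis unfolding cos_abs_real by (rule disjI1)
    qed
    then show "hyp_large L k"
      unfolding hyp_large_def using norm_hyp_ge[of "k * of_real L"] L by (simp add: abs_mult)
  qed
qed

lemma max_Re_Im_le_norm: "max \<bar>Re k\<bar> \<bar>Im k\<bar> \<le> norm k"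
  using abs_Re_le_cmod[of k] abs_Im_le_cmod[of k] by simp

text \<open>The maximum principle is applied in the \<open>k\<close>-plane, where the contours are
  squares: every \<open>z\<close> is \<open>- k\<^sup>2\<close> for some \<open>k\<close>, and
  arbitrarily large squares surround that \<open>k\<close>.\<close>

lemma entire_bounded_of_squares:
  assumes Q: "Q holomorphic_on UNIV" and L: "L > 0"
    and B: "\<And>k. norm k \<ge> R0 \<Longrightarrow> hyp_large L k \<Longrightarrow> norm (Q (- k\<^sup>2)) \<le> B"
  shows "norm (Q z) \<le> B"
proof -
  define k where "k = csqrt (- z)"
  obtain R where R: "R \<ge> max R0 (norm k)" "R > 0"
    "\<And>k. max \<bar>Re k\<bar> \<bar>Im k\<bar> = R \<Longrightarrow> hyp_large L k"
    using square_hyp_large[OF L] by blast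
  let ?S = "cbox (Complex (- R) (- R)) (Complex R R)"
  have hol: "(\<lambda>k. Q (- k\<^sup>2)) holomorphic_on UNIV"
  proof -
    have "(Q \<circ> (\<lambda>k. - k\<^sup>2)) holomorphic_on UNIV"
      by (rule holomorphic_on_compose_gen[OF _ Q]) (auto intro!: holomorphic_intros)
    then show ?thesis by (simp add: o_def)
  qed
  have "norm (Q (- k\<^sup>2)) \<le> B"
  proof (rule maximum_modulus_frontier[of "\<lambda>k. Q (- k\<^sup>2)" ?S])
    show "(\<lambda>k. Q (- k\<^sup>2)) holomorphic_on interior ?S"
      by (rule holomorphic_on_subset[OF hol]) simp
    show "continuous_on (closure ?S) (\<lambda>k. Q (- k\<^sup>2))"
      by (rule holomorphic_on_imp_continuous_on[OF holomorphic_on_subset[OF hol]]) simp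
    show "bounded ?S" by (rule bounded_cbox)
    show "k \<in> ?S"
      using max_Re_Im_le_norm[of k] R(1) by (auto simp: in_cbox_complex_iff)
    fix w assume "w \<in> frontier ?S"
    then have "w \<in> ?S - box (Complex (- R) (- R)) (Complex R R)"
      by (simp add: frontier_cbox)
    then have w: "max \<bar>Re w\<bar> \<bar>Im w\<bar> = R"
      by (auto simp: in_cbox_complex_iff in_box_complex_iff)
    show "norm (Q (- w\<^sup>2)) \<le> B"
      by (rule B[OF _ R(3)[OF w]]) (use max_Re_Im_le_norm[of w] w R(1) in auto)
  qed
  then show ?thesis by (simp add: k_def)
qed

text \<open>At a zero of \<open>X\<close>, which is simple by hypothesis, the value of the quotient
  is prescribed by l'Hopital's rule.\<close>

lemma entire_quotient:
  assumes H: "H holomorphic_on UNIV" and X: "X holomorphic_on UNIV"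
    and zero: "\<And>w. X w = 0 \<Longrightarrow> H w = 0 \<and> deriv X w \<noteq> 0"
  obtains Q where "Q holomorphic_on UNIV" "\<And>z. H z = Q z * X z"
proof -
  define Q where "Q = (\<lambda>z. if X z = 0 then deriv H z / deriv X z else H z / X z)"
  have "Q field_differentiable (at w)" for w
  proof (cases "X w = 0")
    case False
    have "open (X -` (- {0}))"
      using X by (intro open_vimage holomorphic_on_imp_continuous_on) auto
    moreover have "Q holomorphic_on X -` (- {0})"
    proof (rule holomorphic_transform)
      show "(\<lambda>z. H z / X z) holomorphic_on X -` (- {0})"
        by (intro holomorphic_on_divide holomorphic_on_subset[OF H] holomorphic_on_subset[OF X]) auto
    qed (auto simp: Q_def)
    ultimately show ?thesis
      using False by (auto intro: holomorphic_on_imp_differentiable_at)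
  next
    case True
    \<comment> \<open>Near a zero \<open>w\<close> both functions are divided by
      \<open>z - w\<close>. The completed quotients are entire and \<open>x w = deriv X w\<close> is
      not \<open>0\<close>; moreover \<open>h / x\<close> agrees with \<open>Q\<close> wherever
      \<open>x\<close> does not vanish.\<close>
    define h where "h = (\<lambda>z. if z = w then deriv H w else (H z - H w) / (z - w))"
    define x where "x = (\<lambda>z. if z = w then deriv X w else (X z - X w) / (z - w))"
    have h: "h holomorphic_on UNIV" unfolding h_def
      by (rule pole_lemma_open[OF H open_UNIV])
    have x: "x holomorphic_on UNIV" unfolding x_def
      by (rule pole_lemma_open[OF X open_UNIV])
    have "open (x -` (- {0}))"
      using x by (intro open_vimage holomorphic_on_imp_continuous_on) auto
    moreover have "Q holomorphic_on x -` (- {0})"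
    proof (rule holomorphic_transform)
      show "(\<lambda>z. h z / x z) holomorphic_on x -` (- {0})"
        by (intro holomorphic_on_divide holomorphic_on_subset[OF h] holomorphic_on_subset[OF x]) auto
      show "h z / x z = Q z" if "z \<in> x -` (- {0})" for z
        using that True zero[OF True] by (auto simp: h_def x_def Q_def)
    qed
    moreover have "x w \<noteq> 0" using zero[OF True] by (simp add: x_def)
    ultimately show ?thesis
      by (auto intro: holomorphic_on_imp_differentiable_at)
  qed
  then have "Q holomorphic_on UNIV" by (simp add: holomorphic_on_def)
  moreover have "H z = Q z * X z" for z using zero[of z] by (auto simp: Q_def)
  ultimately show ?thesis by (rule that)
qed

lemma entire_zero_of_squares:
  assumes Q: "Q holomorphic_on UNIV" and L: "L > 0"
    and B: "\<And>k. norm k \<ge> R0 \<Longrightarrow> hyp_large L k \<Longrightarrow> norm (Q (- k\<^sup>2)) \<le> B / norm k"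
  shows "Q z = 0"
proof (rule ccontr)
  assume "Q z \<noteq> 0"
  \<comment> \<open>Beyond radius \<open>B / e\<close> the decaying bound is below \<open>e\<close>,
    which forces \<open>norm (Q z) \<le> norm (Q z) / 2\<close>.\<close>
  define e where "e = norm (Q z) / 2"
  have e: "e > 0" using \<open>Q z \<noteq> 0\<close> by (simp add: e_def)
  have "norm (Q z) \<le> e"
  proof (rule entire_bounded_of_squares[OF Q L])
    fix k assume k: "norm k \<ge> max (max 1 R0) (B / e)" "hyp_large L k"
    have "norm (Q (- k\<^sup>2)) \<le> B / norm k" using B k by simp
    also have "\<dots> \<le> e"
    proof -
      have "norm k > 0" "B \<le> e * norm k" using k(1) e by (auto simp: field_simps)
      then show ?thesis by (simp add: pos_divide_le_eq)
    qed
    finally show "norm (Q (- k\<^sup>2)) \<le> e" .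
  qed
  then show False using e by (simp add: e_def)
qed

lemma entire_zero_of_bounded:
  assumes Q: "Q holomorphic_on UNIV" and L: "L > 0"
    and B: "\<And>k. norm k \<ge> R0 \<Longrightarrow> hyp_large L k \<Longrightarrow> norm (Q (- k\<^sup>2)) \<le> B"
    and lim: "((\<lambda>t. Q (- of_real (t\<^sup>2))) \<longlongrightarrow> 0) at_top"
  shows "Q z = 0"
proof -
  have "bounded (range Q)"
    using entire_bounded_of_squares[OF Q L B] by (auto simp: bounded_iff)
  then obtain c where c: "\<And>z. Q z = c"
    using Liouville_theorem[OF Q] by (auto simp: constant_on_def)
  have "c = 0" using lim unfolding c by (simp add: tendsto_const_iff)
  then show ?thesis by (simp add: c)
qed

section \<open>The characteristic function and its zeros\<close>

lemma cpoly_add: "cpoly (p + q) z = cpoly p z + cpoly q z"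
proof -
  have "map_poly complex_of_real (p + q) = map_poly complex_of_real p + map_poly complex_of_real q"
    by (rule poly_eqI) (simp add: coeff_map_poly)
  then show ?thesis by simp
qed

lemma cpoly_smult: "cpoly (smult c q) z = of_real c * cpoly q z"
proof -
  have "map_poly complex_of_real (smult c q) = smult (of_real c) (map_poly complex_of_real q)"
    by (rule poly_eqI) (simp add: coeff_map_poly)
  then show ?thesis by simp
qed

lemma cpoly_pCons: "cpoly (pCons c q) z = of_real c + z * cpoly q z"
proof -
  have "map_poly complex_of_real (pCons c q) = pCons (of_real c) (map_poly complex_of_real q)"
    by (rule poly_eqI) (simp add: coeff_map_poly coeff_pCons split: nat.splits)
  then show ?thesis by simp
qed

lemma cpoly_mult: "cpoly (p * q) z = cpoly p z * cpoly q z"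
proof (induction p)
  case 0
  then show ?case by simp
next
  case (pCons c p)
  then show ?case
    by (simp add: mult_pCons_left cpoly_add cpoly_smult cpoly_pCons algebra_simps)
qed

lemma cpoly_prod: "cpoly (\<Prod>i\<in>A. p i) z = (\<Prod>i\<in>A. cpoly (p i) z)"
proof (induction A rule: infinite_finite_induct)
  case (insert i A)
  then show ?case by (simp add: cpoly_mult)
qed simp_all

lemma cpoly_sum: "cpoly (\<Sum>i\<in>A. p i) z = (\<Sum>i\<in>A. cpoly (p i) z)"
proof (induction A rule: infinite_finite_induct)
  case (insert i A)
  then show ?case by (simp add: cpoly_add)
qed simp_all

lemma cpoly_of_real: "cpoly p (of_real x) = of_real (poly p x)"
  by (induction p) (simp_all add: cpoly_pCons)

lemma DERIV_cpoly: "(cpoly p has_field_derivative cpoly (pderiv p) z) (at z)"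
proof -
  have "pderiv (map_poly complex_of_real p) = map_poly complex_of_real (pderiv p)"
    by (rule poly_eqI) (simp add: coeff_map_poly coeff_pderiv)
  then show ?thesis using poly_DERIV[of "map_poly complex_of_real p" z] by simp
qed

text \<open>The Herglotz property: the derivative
  \<open>h0 + (\<Sum>k. \<delta>\<^sub>k / (h\<^sub>k - x)\<^sup>2)\<close> of the rational function
  is nonnegative. Multiplied by \<open>(down g)\<^sup>2\<close>, it becomes an inequality between
  polynomials that also holds at the poles; \<open>P k\<close> is \<open>down g\<close> with its
  factor \<open>k\<close> removed.\<close>

lemma pderiv_up_down:
  assumes "g \<in> class_R"
  shows "poly (pderiv (down g)) x * poly (up g) x \<le> poly (pderiv (up g)) x * poly (down g) x"
proof (cases g)
  case Infty
  then show ?thesis by simp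
next
  case (Ratl h0 h ps)
  have g: "h0 \<ge> 0" "\<And>k. k < length ps \<Longrightarrow> snd (ps ! k) > 0"
    using assms by (auto simp: class_R_def Ratl)
  define D where "D = down g"
  define P where "P = (\<lambda>k. smult (lead_norm h0) (\<Prod>j\<in>{..<length ps} - {k}. [:fst (ps ! j), - 1:]))"
  have D: "D = [:fst (ps ! k), - 1:] * P k" if "k < length ps" for k
    using prod.remove[of "{..<length ps}" k "\<lambda>j. [:fst (ps ! j), - 1:]"] that
    by (simp add: D_def Ratl P_def)
  have up: "up g = [:h, h0:] * D + (\<Sum>k<length ps. smult (snd (ps ! k)) (P k))"
  proof -
    have sm: "smult c (\<Sum>i<n. u i) = (\<Sum>i<n. smult c (u i))" for c :: real and u and n :: nat
      by (induction n) (simp_all add: smult_add_right)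
    show ?thesis
      unfolding Ratl up.simps D_def P_def sm by (simp only: smult_smult mult.commute)
  qed
  have W: "poly (pderiv (P k)) x * poly D x - poly (pderiv D) x * poly (P k) x = (poly (P k) x)\<^sup>2"
    if "k < length ps" for k
    unfolding D[OF that] pderiv_mult poly_add poly_mult
    by (simp add: pderiv_pCons power2_eq_square algebra_simps)
  have pd: "pderiv (\<Sum>i<n. u i) = (\<Sum>i<n. pderiv (u i))" for u :: "nat \<Rightarrow> real poly" and n
    by (induction n) (simp_all add: pderiv_add)
  have "poly (pderiv (up g)) x * poly D x - poly (pderiv D) x * poly (up g) x =
      h0 * (poly D x)\<^sup>2 + (\<Sum>k<length ps. snd (ps ! k) *
        (poly (pderiv (P k)) x * poly D x - poly (pderiv D) x * poly (P k) x))"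
    unfolding up by (simp add: pderiv_add pderiv_mult pderiv_pCons pd pderiv_smult poly_sum
        sum_subtractf sum_distrib_left sum_distrib_right power2_eq_square algebra_simps)
  also have "\<dots> = h0 * (poly D x)\<^sup>2 + (\<Sum>k<length ps. snd (ps ! k) * (poly (P k) x)\<^sup>2)"
    using W by simp
  also have "\<dots> \<ge> 0"
    using g by (intro add_nonneg_nonneg sum_nonneg mult_nonneg_nonneg) (auto intro: less_imp_le)
  finally show ?thesis by (simp add: D_def)
qed

text \<open>A zero of \<open>down g\<close> is one of the poles. There every summand of
  \<open>up g\<close> vanishes except the one carrying the residue at this pole, and that one is
  nonzero because the poles are distinct.\<close>

lemma down_up_no_common_zero:
  assumes "g \<in> class_R" "cpoly (down g) z = 0"
  shows "cpoly (up g) z \<noteq> 0"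
proof (cases g)
  case Infty
  have "map_poly complex_of_real (- 1) = - 1"
    by (rule poly_eqI) (simp add: coeff_map_poly)
  then show ?thesis by (simp add: Infty)
next
  case (Ratl h0 h ps)
  have g: "\<And>k. k < length ps \<Longrightarrow> snd (ps ! k) > 0" "sorted_wrt (<) (map fst ps)"
    using assms by (auto simp: class_R_def Ratl)
  have c: "lead_norm h0 \<noteq> 0" by (simp add: lead_norm_def)
  have down: "cpoly (down g) z = of_real (lead_norm h0) * (\<Prod>k<length ps. of_real (fst (ps ! k)) - z)"
    by (simp add: Ratl cpoly_smult cpoly_prod cpoly_pCons)
  with assms(2) c have "(\<Prod>k<length ps. of_real (fst (ps ! k)) - z) = 0"
    by simp
  then obtain k where k: "k < length ps" "z = of_real (fst (ps ! k))"
    unfolding prod_zero_iff[OF finite_lessThan] by auto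
  have P0: "(\<Prod>j\<in>{..<length ps} - {i}. of_real (fst (ps ! j)) - z) = 0" if "i < length ps" "i \<noteq> k" for i
    by (rule prod_zero, simp, rule bexI[of _ k]) (use k that in auto)
  have dist: "fst (ps ! j) \<noteq> fst (ps ! k)" if "j < length ps" "j \<noteq> k" for j
  proof -
    have "distinct (map fst ps)" using g(2) strict_sorted_iff by blast
    then show ?thesis using that k(1) nth_eq_iff_index_eq[of "map fst ps" j k] by simp
  qed
  have "cpoly (up g) z = of_real (lead_norm h0) *
      (\<Sum>i<length ps. of_real (snd (ps ! i)) * (\<Prod>j\<in>{..<length ps} - {i}. of_real (fst (ps ! j)) - z))"
  proof -
    have "up g = [:h, h0:] * down g + smult (lead_norm h0)
        (\<Sum>k<length ps. smult (snd (ps ! k)) (\<Prod>j\<in>{..<length ps} - {k}. [:fst (ps ! j), - 1:]))"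
      by (simp only: Ratl up.simps)
    then have "cpoly (up g) z = cpoly (smult (lead_norm h0)
        (\<Sum>k<length ps. smult (snd (ps ! k)) (\<Prod>j\<in>{..<length ps} - {k}. [:fst (ps ! j), - 1:]))) z"
      by (simp only: cpoly_add cpoly_mult assms(2) mult_zero_right add_0)
    then show ?thesis by (simp add: cpoly_smult cpoly_sum cpoly_prod cpoly_pCons)
  qed
  also have "(\<Sum>i<length ps. of_real (snd (ps ! i)) * (\<Prod>j\<in>{..<length ps} - {i}. of_real (fst (ps ! j)) - z)) =
      of_real (snd (ps ! k)) * (\<Prod>j\<in>{..<length ps} - {k}. of_real (fst (ps ! j)) - z)"
  proof -
    have "(\<Sum>i\<in>{..<length ps} - {k}. of_real (snd (ps ! i)) *
        (\<Prod>j\<in>{..<length ps} - {i}. of_real (fst (ps ! j)) - z)) = 0"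
    proof (rule sum.neutral, rule ballI)
      fix i assume "i \<in> {..<length ps} - {k}"
      then have "(\<Prod>j\<in>{..<length ps} - {i}. of_real (fst (ps ! j)) - z) = 0" by (intro P0) auto
      then show "of_real (snd (ps ! i)) * (\<Prod>j\<in>{..<length ps} - {i}. of_real (fst (ps ! j)) - z) = 0"
        by (simp only: mult_zero_right)
    qed
    then show ?thesis by (subst sum.remove[of _ k]) (use k(1) in auto)
  qed
  finally show ?thesis
  proof -
    have "(\<Prod>j\<in>{..<length ps} - {k}. of_real (fst (ps ! j)) - z) \<noteq> 0"
      using dist k by (subst prod_zero_iff) auto
    moreover have "snd (ps ! k) \<noteq> 0" using g(1)[OF k(1)] by simp
    ultimately show "cpoly (up g) z \<noteq> 0" if "cpoly (up g) z = of_real (lead_norm h0) *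
        (of_real (snd (ps ! k)) * (\<Prod>j\<in>{..<length ps} - {k}. of_real (fst (ps ! j)) - z))"
      using c unfolding that by simp
  qed
qed

lemma proportional:
  fixes a b c d :: complex
  assumes "a * d = b * c" "a \<noteq> 0 \<or> b \<noteq> 0"
  obtains r where "c = r * a" "d = r * b"
proof (cases "a = 0")
  case True
  then show ?thesis using assms that[of "d / b"] by auto
next
  case False
  then show ?thesis using assms(1) that[of "c / a"] by (simp add: field_simps)
qed

text \<open>If \<open>y z\<close> vanished identically, \<open>y1 z\<close> would be constant with
  integral \<open>0\<close>, hence \<open>0\<close>, and \<open>down g\<close> and
  \<open>up g\<close> would have a common zero.\<close>

lemma bc_sol_nontrivial:
  assumes "g \<in> class_R" "bc_sol L p g y y1" "0 < L"
  shows "\<exists>x\<in>{0..L}. y z x \<noteq> 0"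
proof (rule ccontr)
  assume *: "\<not> ?thesis"
  have s: "sol L p z (y z) (y1 z)" using assms(2) by (simp add: bc_sol_def)
  have c: "y1 z x = y1 z 0" if x: "x \<in> {0..L}" for x
  proof -
    have 1: "((\<lambda>t. (of_real (p t) - z) * y z t) has_integral y1 z x - y1 z 0) {0..x}"
      using sol_ac1[OF s] x by (simp add: ac_on_def)
    have "((\<lambda>t. (of_real (p t) - z) * y z t) has_integral 0) {0..x}"
      by (rule has_integral_is_0) (use * x in auto)
    from has_integral_unique[OF 1 this] show ?thesis by simp
  qed
  have "(y1 z has_integral y z L - y z 0) {0..L}"
    using sol_ac[OF s] assms(3) by (simp add: ac_on_def)
  moreover have "y z L = 0" "y z 0 = 0" using * assms(3) by auto
  ultimately have "(y1 z has_integral 0) {0..L}" by simp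
  then have "((\<lambda>t. y1 z 0) has_integral 0) {0..L}"
    by (rule has_integral_eq[OF c, rotated])
  moreover have "((\<lambda>t. y1 z 0) has_integral of_real L * y1 z 0) {0..L}"
    using has_integral_const_real[of "y1 z 0" 0 L] assms(3) by (simp add: scaleR_conv_of_real)
  ultimately have "of_real L * y1 z 0 = 0" by (rule has_integral_unique[symmetric])
  then have "y1 z 0 = 0" using assms(3) by simp
  moreover have "y z 0 = 0" using * assms(3) by simp
  ultimately show False
    using assms(1,2) down_up_no_common_zero by (simp add: bc_sol_def)
qed

text \<open>At a double zero, Lagrange's identity for \<open>y z\<close> and the conjugate of
  \<open>y w\<close>, differentiated at \<open>z = w\<close>, writes \<open>0\<close> as the sum of
  the squared norm of the eigenfunction and two boundary terms. The Herglotz property makes the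
  boundary terms nonnegative, so the eigenfunction would vanish.\<close>

lemma characteristic_simple_zero:
  assumes q: "q absolutely_integrable_on {0..L}" and L: "0 < L"
    and f: "f \<in> class_R" and F: "F \<in> class_R"
    and y: "bc_sol L q f y y1"
  defines "X \<equiv> (\<lambda>z. cpoly (down F) z * y1 z L - cpoly (up F) z * y z L)"
  assumes zero: "X (of_real x) = 0"
  shows "deriv X (of_real x) \<noteq> 0"
proof
  define w where "w = complex_of_real x"
  assume deriv0: "deriv X (of_real x) = 0"
  have sol: "\<And>z. sol L q z (y z) (y1 z)" using y by (simp add: bc_sol_def)
  have init: "\<And>z. y z 0 = cpoly (down f) z" "\<And>z. y1 z 0 = - cpoly (up f) z"
    using y by (auto simp: bc_sol_def)
  have cw: "cpoly p w = of_real (poly p x)" for p by (simp add: w_def cpoly_of_real)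
  have "cpoly (down F) w * y1 w L = cpoly (up F) w * y w L"
    using zero by (simp add: X_def w_def)
  \<comment> \<open>At a zero of \<open>X\<close> the data of the solution at \<open>L\<close> are a
    multiple of the polynomials in the right-hand boundary condition.\<close>
  then obtain r where r: "y w L = r * cpoly (down F) w" "y1 w L = r * cpoly (up F) w"
    using proportional[of "cpoly (down F) w" "y1 w L" "cpoly (up F) w" "y w L"]
      down_up_no_common_zero[OF F] by blast
  have Lin: "L \<in> {0..L}" using L by simp
  have u: "sol L q w (\<lambda>t. cnj (y w t)) (\<lambda>t. cnj (y1 w t))"
    using sol_cnj[OF sol[of w]] by (simp add: w_def)
  define I where "I = (\<lambda>z. integral {0..L} (\<lambda>t. y z t * cnj (y w t)))"
  have G: "y z L * cnj (y1 w L) - y1 z L * cnj (y w L)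
      - (cpoly (up f) z * cpoly (down f) w - cpoly (down f) z * cpoly (up f) w) = (z - w) * I z" for z
    using integral_unique[OF sol_wronskian[OF sol u Lin]]
    unfolding I_def integral_mult_right init by (simp add: cw algebra_simps)
  have contI: "isCont I w"
    unfolding I_def
  proof (rule sol_param_integral[OF q _ sol _ _ _ Lin])
    show "isCont (\<lambda>z. y z 0) w" "isCont (\<lambda>z. y1 z 0) w"
      unfolding init by (auto intro!: continuous_intros)
    show "continuous_on {0..L} (\<lambda>t. cnj (y w t))"
      by (rule continuous_on_cnj[OF sol_continuous[OF sol]])
  qed (use L in simp)
  have "((\<lambda>z. (z - w) * I z) has_field_derivative I w) (at w)"
    unfolding CARAT_DERIV using contI by (intro exI[of _ I]) simp
  then have DG: "((\<lambda>z. y z L * cnj (y1 w L) - y1 z L * cnj (y w L)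
      - (cpoly (up f) z * cpoly (down f) w - cpoly (down f) z * cpoly (up f) w)) has_field_derivative I w) (at w)"
    unfolding G .
  have Dy: "((\<lambda>z. y z L) has_field_derivative deriv (\<lambda>z. y z L) w) (at w)"
    "((\<lambda>z. y1 z L) has_field_derivative deriv (\<lambda>z. y1 z L) w) (at w)"
    using bc_sol_holomorphic[OF q y Lin] by (auto intro: holomorphic_derivI)
  define A where "A = deriv (\<lambda>z. y z L) w"
  define B where "B = deriv (\<lambda>z. y1 z L) w"
  have "((\<lambda>z. y z L * cnj (y1 w L) - y1 z L * cnj (y w L)
      - (cpoly (up f) z * cpoly (down f) w - cpoly (down f) z * cpoly (up f) w)) has_field_derivative
      (A * cnj (y1 w L) - B * cnj (y w L) - (cpoly (pderiv (up f)) w * cpoly (down f) w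
         - cpoly (pderiv (down f)) w * cpoly (up f) w))) (at w)"
    unfolding A_def B_def by (intro DERIV_diff DERIV_cmult_right Dy DERIV_cpoly)
  from DERIV_unique[OF DG this] have Iw: "I w = A * cnj (y1 w L) - B * cnj (y w L)
      - (cpoly (pderiv (up f)) w * cpoly (down f) w - cpoly (pderiv (down f)) w * cpoly (up f) w)" .
  have "(X has_field_derivative ((cpoly (down F) w * B + cpoly (pderiv (down F)) w * y1 w L)
      - (cpoly (up F) w * A + cpoly (pderiv (up F)) w * y w L))) (at w)"
    unfolding X_def A_def B_def by (intro DERIV_diff DERIV_mult' Dy DERIV_cpoly)
  from DERIV_imp_deriv[OF this] deriv0
  have chi: "(cpoly (down F) w * B + cpoly (pderiv (down F)) w * y1 w L)
      - (cpoly (up F) w * A + cpoly (pderiv (up F)) w * y w L) = 0" by (simp add: w_def)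
  define WF where "WF = poly (pderiv (up F)) x * poly (down F) x - poly (pderiv (down F)) x * poly (up F) x"
  define Wf where "Wf = poly (pderiv (up f)) x * poly (down f) x - poly (pderiv (down f)) x * poly (up f) x"
  \<comment> \<open>The vanishing derivative of \<open>X\<close> makes
    \<open>A * up F - B * down F\<close> at \<open>w\<close> equal to \<open>- r * WF\<close>;
    multiplication by \<open>cnj r\<close> turns the boundary term at \<open>L\<close> into
    \<open>(norm r)\<^sup>2 * WF\<close>.\<close>
  have "I w + of_real Wf + r * cnj r * of_real WF = 0"
    using chi unfolding Iw r cw complex_cnj_mult complex_cnj_complex_of_real WF_def Wf_def of_real_diff of_real_mult
    by algebra
  moreover have "I w = of_real (integral {0..L} (\<lambda>t. (norm (y w t))\<^sup>2))"
  proof -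
    have "(\<lambda>t. (norm (y w t))\<^sup>2) integrable_on {0..L}"
      by (intro integrable_continuous_real continuous_intros sol_continuous[OF sol])
    from integral_linear[OF this bounded_linear_of_real]
    show ?thesis by (simp add: I_def o_def complex_norm_square[symmetric])
  qed
  moreover have "r * cnj r = of_real ((norm r)\<^sup>2)" by (simp add: complex_norm_square[symmetric])
  ultimately have "of_real (integral {0..L} (\<lambda>t. (norm (y w t))\<^sup>2) + Wf + (norm r)\<^sup>2 * WF) = (0::complex)"
    by simp
  then have sum0: "integral {0..L} (\<lambda>t. (norm (y w t))\<^sup>2) + Wf + (norm r)\<^sup>2 * WF = 0"
    unfolding of_real_eq_0_iff .
  have "Wf \<ge> 0" "WF \<ge> 0"
    using pderiv_up_down[OF f] pderiv_up_down[OF F] by (simp_all add: Wf_def WF_def)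
  moreover have ge: "integral {0..L} (\<lambda>t. (norm (y w t))\<^sup>2) \<ge> 0"
    by (intro Henstock_Kurzweil_Integration.integral_nonneg integrable_continuous_real continuous_intros sol_continuous[OF sol]) simp
  moreover have "(norm r)\<^sup>2 * WF \<ge> 0" using \<open>WF \<ge> 0\<close> by simp
  ultimately have "integral {0..L} (\<lambda>t. (norm (y w t))\<^sup>2) = 0" using sum0 by linarith
  moreover have "continuous_on {0..L} (\<lambda>t. (norm (y w t))\<^sup>2)"
    by (intro continuous_intros sol_continuous[OF sol])
  ultimately have "\<forall>t\<in>{0..L}. (norm (y w t))\<^sup>2 = 0"
    using integral_eq_0_iff[of 0 L "\<lambda>t. (norm (y w t))\<^sup>2"] L by simp
  then show False using bc_sol_nontrivial[OF f y L, of w] by auto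
qed

lemma is_solution_iff_sol: "is_solution q z y y1 \<longleftrightarrow> sol pi q z y y1"
proof -
  have ac: "has_ac_derivative u g \<longleftrightarrow> ac_on pi u g" for u g
    by (simp add: has_ac_derivative_def ac_on_def)
  have eq: "- a + b * c = z * c \<longleftrightarrow> (b - z) * c = a" for a b c :: complex
    by (auto simp: algebra_simps)
  show ?thesis
    unfolding is_solution_def sol_def ac eq
  proof (intro conj_cong refl iffI)
    assume "\<exists>y2. ac_on pi y1 y2 \<and> (AE x in lebesgue_on {0..pi}. (of_real (q x) - z) * y x = y2 x)"
    then obtain y2 where y2: "ac_on pi y1 y2"
      "AE x in lebesgue_on {0..pi}. (of_real (q x) - z) * y x = y2 x" by blast
    from y2(2) have "AE x in lebesgue_on {0..pi}. y2 x = (of_real (q x) - z) * y x"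
      by eventually_elim (rule sym)
    with y2(1) show "ac_on pi y1 (\<lambda>x. (of_real (q x) - z) * y x)" by (rule ac_on_AE)
  next
    assume "ac_on pi y1 (\<lambda>x. (of_real (q x) - z) * y x)"
    then show "\<exists>y2. ac_on pi y1 y2 \<and> (AE x in lebesgue_on {0..pi}. (of_real (q x) - z) * y x = y2 x)"
      by (intro exI[of _ "\<lambda>x. (of_real (q x) - z) * y x"] conjI) simp_all
  qed
qed

lemma characteristic_zero_imp_eigenvalue:
  assumes "f \<in> class_R" "bc_sol pi q f y y1"
    and "cpoly (down F) z * y1 z pi - cpoly (up F) z * y z pi = 0"
  shows "is_eigenvalue q f F z"
  unfolding is_eigenvalue_def is_solution_iff_sol
proof (rule exI[of _ "y z"], rule exI[of _ "y1 z"], intro conjI)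
  show "sol pi q z (y z) (y1 z)" using assms(2) by (simp add: bc_sol_def)
  show "\<exists>x\<in>{0..pi}. y z x \<noteq> 0" by (rule bc_sol_nontrivial[OF assms(1,2)]) simp
  show "cpoly (down f) z * y1 z 0 + cpoly (up f) z * y z 0 = 0"
    using assms(2) by (simp add: bc_sol_def)
qed (rule assms(3))

section \<open>Equality of the Weyl functions at the midpoint\<close>

text \<open>A single \<open>K\<close> serves as threshold and as error constant, and the errors are
  stated relative to the natural size of the function. Several solutions can then share the maximum
  of their constants, and the relative error is at most \<open>1\<close> beyond the
  threshold.\<close>

definition hyp_asymp :: "real \<Rightarrow> int \<Rightarrow> (complex \<Rightarrow> real \<Rightarrow> complex) \<Rightarrow> (complex \<Rightarrow> real \<Rightarrow> complex) \<Rightarrow> real \<Rightarrow> bool" where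
  "hyp_asymp L n y y1 K \<longleftrightarrow> (\<forall>k x. K \<le> norm k \<longrightarrow> x \<in> {0..L} \<longrightarrow>
     norm (y (- k\<^sup>2) x - k powi n * hyp n (k * of_real x)) \<le>
       K / norm k * (norm k powi n * exp (\<bar>Re k\<bar> * x)) \<and>
     norm (y1 (- k\<^sup>2) x - k powi (n + 1) * hyp (n + 1) (k * of_real x)) \<le>
       K / norm k * (norm k powi (n + 1) * exp (\<bar>Re k\<bar> * x)))"

lemma hyp_asympD:
  assumes "hyp_asymp L n y y1 K" "K \<le> norm k" "x \<in> {0..L}"
  shows "norm (y (- k\<^sup>2) x - k powi n * hyp n (k * of_real x)) \<le>
       K / norm k * (norm k powi n * exp (\<bar>Re k\<bar> * x))"
    and "norm (y1 (- k\<^sup>2) x - k powi (n + 1) * hyp (n + 1) (k * of_real x)) \<le>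
       K / norm k * (norm k powi (n + 1) * exp (\<bar>Re k\<bar> * x))"
  using assms by (auto simp: hyp_asymp_def)

lemma hyp_asymp_mono:
  assumes a: "hyp_asymp L n y y1 K" and "1 \<le> K" and K: "K \<le> K'"
  shows "hyp_asymp L n y y1 K'"
  unfolding hyp_asymp_def
proof (intro allI impI)
  fix k :: complex and x :: real assume k: "K' \<le> norm k" and x: "x \<in> {0..L}"
  have "K / norm k * (norm k powi m * exp (\<bar>Re k\<bar> * x)) \<le> K' / norm k * (norm k powi m * exp (\<bar>Re k\<bar> * x))" for m
    by (intro mult_right_mono divide_right_mono K) auto
  then show "norm (y (- k\<^sup>2) x - k powi n * hyp n (k * of_real x)) \<le>
       K' / norm k * (norm k powi n * exp (\<bar>Re k\<bar> * x)) \<and>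
     norm (y1 (- k\<^sup>2) x - k powi (n + 1) * hyp (n + 1) (k * of_real x)) \<le>
       K' / norm k * (norm k powi (n + 1) * exp (\<bar>Re k\<bar> * x))"
    using hyp_asympD[OF a order_trans[OF K k] x] order_trans by blast
qed

lemma bc_sol_asymp:
  assumes "p absolutely_integrable_on {0..L}" "0 \<le> L" "g \<in> class_R" "bc_sol L p g y y1"
  obtains K where "1 \<le> K" "hyp_asymp L (ind g) y y1 K"
proof -
  let ?n = "ind g"
  obtain K R where K: "K > 0" "R \<ge> 1"
    "\<And>k x. norm k \<ge> R \<Longrightarrow> x \<in> {0..L} \<Longrightarrow>
      norm (y (- k\<^sup>2) x - k powi ?n * hyp ?n (k * of_real x)) \<le>
        K * norm k powi (?n - 1) * exp (\<bar>Re k\<bar> * x)"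
    "\<And>k x. norm k \<ge> R \<Longrightarrow> x \<in> {0..L} \<Longrightarrow>
      norm (y1 (- k\<^sup>2) x - k powi (?n + 1) * hyp (?n + 1) (k * of_real x)) \<le>
        K * norm k powi ?n * exp (\<bar>Re k\<bar> * x)"
    using bc_sol_asymptotics[OF assms] by blast
  define M where "M = max K R"
  have "hyp_asymp L ?n y y1 M"
    unfolding hyp_asymp_def
  proof (intro allI impI)
    fix k :: complex and x :: real assume k: "M \<le> norm k" and x: "x \<in> {0..L}"
    have kR: "norm k \<ge> R" using k by (simp add: M_def)
    have k0: "norm k > 0" using kR K(2) by linarith
    have le: "K * norm k powi (m - 1) * exp (\<bar>Re k\<bar> * x) \<le>
        M / norm k * (norm k powi m * exp (\<bar>Re k\<bar> * x))" for m
    proof -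
      have "norm k powi (m - 1) = norm k powi m / norm k" using k0 by (simp add: power_int_diff)
      then have "K * norm k powi (m - 1) * exp (\<bar>Re k\<bar> * x) = K / norm k * (norm k powi m * exp (\<bar>Re k\<bar> * x))"
        by simp
      also have "\<dots> \<le> M / norm k * (norm k powi m * exp (\<bar>Re k\<bar> * x))"
        by (intro mult_right_mono divide_right_mono) (auto simp: M_def)
      finally show ?thesis .
    qed
    have "K * norm k powi ?n * exp (\<bar>Re k\<bar> * x) \<le>
        M / norm k * (norm k powi (?n + 1) * exp (\<bar>Re k\<bar> * x))"
      using le[of "?n + 1"] by simp
    then show "norm (y (- k\<^sup>2) x - k powi ?n * hyp ?n (k * of_real x)) \<le>
         M / norm k * (norm k powi ?n * exp (\<bar>Re k\<bar> * x)) \<and>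
       norm (y1 (- k\<^sup>2) x - k powi (?n + 1) * hyp (?n + 1) (k * of_real x)) \<le>
         M / norm k * (norm k powi (?n + 1) * exp (\<bar>Re k\<bar> * x))"
      using K(3,4)[OF kR x] le[of ?n] order_trans by blast
  qed
  moreover have "1 \<le> M" using K(2) by (simp add: M_def)
  ultimately show ?thesis using that by blast
qed

lemma norm_powi_hyp_le:
  fixes k :: complex
  assumes "0 \<le> x"
  shows "norm (k powi n * hyp m (k * of_real x)) \<le> norm k powi n * exp (\<bar>Re k\<bar> * x)"
  unfolding norm_mult norm_power_int by (intro mult_left_mono norm_hyp_le assms) simp

lemma hyp_asymp_upper:
  assumes a: "hyp_asymp L n y y1 K" "0 < K" "K \<le> norm k" "x \<in> {0..L}"
  shows "norm (y (- k\<^sup>2) x) \<le> 2 * (norm k powi n * exp (\<bar>Re k\<bar> * x))"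
proof -
  have "norm k > 0" using assms(2,3) by linarith
  then have "K / norm k \<le> 1" using assms(3) by simp
  then have "K / norm k * (norm k powi n * exp (\<bar>Re k\<bar> * x)) \<le> 1 * (norm k powi n * exp (\<bar>Re k\<bar> * x))"
    by (rule mult_right_mono) simp
  then show ?thesis
    using hyp_asympD(1)[OF a(1,3,4)] norm_powi_hyp_le[of x k n n] assms(4)
      norm_triangle_ineq2[of "y (- k\<^sup>2) x" "k powi n * hyp n (k * of_real x)"] by simp
qed

lemma hyp_asymp_lower:
  assumes a: "hyp_asymp L n y y1 K" "0 < K" "8 * K \<le> norm k" "x \<in> {0..L}" and "hyp_large x k"
  shows "norm k powi n * exp (\<bar>Re k\<bar> * x) / 8 \<le> norm (y (- k\<^sup>2) x)"
proof -
  let ?T = "norm k powi n * exp (\<bar>Re k\<bar> * x)"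
  have "norm k > 0" using assms(2,3) by linarith
  \<comment> \<open>An error of \<open>1/8\<close> against a leading term of at least
    \<open>1/4\<close> leaves \<open>1/8\<close>.\<close>
  then have "K / norm k \<le> 1/8" using assms(3) by (simp add: field_simps)
  then have "K / norm k * ?T \<le> 1/8 * ?T" by (rule mult_right_mono) simp
  moreover have "norm (y (- k\<^sup>2) x - k powi n * hyp n (k * of_real x)) \<le> K / norm k * ?T"
    by (rule hyp_asympD(1)[OF a(1) _ a(4)]) (use assms(2,3) in linarith)
  moreover have "?T / 4 \<le> norm (k powi n * hyp n (k * of_real x))"
  proof -
    have "norm k powi n * (exp (\<bar>Re k\<bar> * x) / 4) \<le> norm k powi n * norm (hyp n (k * of_real x))"
      using assms(5) by (intro mult_left_mono) (auto simp: hyp_large_def)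
    then show ?thesis by (simp add: norm_mult norm_power_int)
  qed
  ultimately show ?thesis
    using norm_triangle_ineq2[of "k powi n * hyp n (k * of_real x)" "y (- k\<^sup>2) x"]
      norm_minus_commute[of "y (- k\<^sup>2) x" "k powi n * hyp n (k * of_real x)"] by linarith
qed

lemma product_error:
  fixes a b a0 b0 :: complex
  assumes "norm (a - a0) \<le> e * A" "norm a0 \<le> A" "norm (b - b0) \<le> e * B" "norm b0 \<le> B" "0 \<le> e" "e \<le> 1"
  shows "norm (a * b - a0 * b0) \<le> 3 * e * (A * B)"
proof -
  have A: "0 \<le> A" "0 \<le> B" using assms(2,4) norm_ge_zero order_trans by blast+
  have "norm b \<le> norm (b - b0) + norm b0" using norm_triangle_ineq[of "b - b0" b0] by simp
  also have "e * B \<le> B" using mult_right_mono[OF assms(6) A(2)] by simp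
  then have "norm (b - b0) + norm b0 \<le> 2 * B" using assms(3,4) by linarith
  finally have b: "norm b \<le> 2 * B" .
  have "a * b - a0 * b0 = (a - a0) * b + a0 * (b - b0)" by (simp add: algebra_simps)
  also have "norm \<dots> \<le> (e * A) * (2 * B) + A * (e * B)"
    by (rule norm_triangle_le, unfold norm_mult, intro add_mono mult_mono)
       (use assms A b in auto)
  finally show ?thesis by (simp add: algebra_simps)
qed

lemma norm_diff_diff_le:
  fixes a b c d :: complex
  assumes "norm (a - c) \<le> e" "norm (b - d) \<le> e'"
  shows "norm ((a - b) - (c - d)) \<le> e + e'"
proof -
  have "(a - b) - (c - d) = (a - c) - (b - d)" by simp
  then show ?thesis using norm_triangle_ineq4[of "a - c" "b - d"] assms by (simp only:)
qed

text \<open>For \<open>u\<close> issuing from the right end point, \<open>u\<close> and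
  \<open>u1\<close> at \<open>0\<close> are \<open>down F\<close> and \<open>- up F\<close>, so the
  sum on the right is the characteristic function.\<close>

lemma characteristic_lower:
  assumes f: "hyp_asymp L n y y1 K" and F: "hyp_asymp L m u u1 K" and K: "0 < K" "48 * K \<le> norm k"
    and L: "0 \<le> L" "hyp_large L k"
  shows "norm k powi (n + m + 1) * exp (\<bar>Re k\<bar> * L) / 8 \<le>
    norm (u (- k\<^sup>2) 0 * y1 (- k\<^sup>2) L + u1 (- k\<^sup>2) 0 * y (- k\<^sup>2) L)"
proof -
  let ?e = "exp (\<bar>Re k\<bar> * L)" and ?T = "norm k powi (n + m + 1) * exp (\<bar>Re k\<bar> * L)"
  have k: "norm k > 0" "K \<le> norm k" "k \<noteq> 0" using K by auto
  have e: "0 \<le> K / norm k" "K / norm k \<le> 1" "48 * (K / norm k) \<le> 1" using K k by (auto simp: field_simps)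
  have T: "norm k powi m * (norm k powi (n + 1) * ?e) = ?T" "norm k powi (m + 1) * (norm k powi n * ?e) = ?T"
    using k(1) by (simp_all add: power_int_add field_simps)
  have 1: "norm (u (- k\<^sup>2) 0 * y1 (- k\<^sup>2) L - (k powi m * hyp m (k * of_real 0)) * (k powi (n + 1) * hyp (n + 1) (k * of_real L)))
      \<le> 3 * (K / norm k) * ?T"
    unfolding T(1)[symmetric]
    by (rule product_error)
       (use hyp_asympD[OF F k(2), of 0] hyp_asympD[OF f k(2), of L] L norm_powi_hyp_le[of 0 k m m]
         norm_powi_hyp_le[of L k "n+1" "n+1"] e in simp_all)
  have 2: "norm (u1 (- k\<^sup>2) 0 * y (- k\<^sup>2) L - (k powi (m + 1) * hyp (m + 1) (k * of_real 0)) * (k powi n * hyp n (k * of_real L)))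
      \<le> 3 * (K / norm k) * ?T"
    unfolding T(2)[symmetric]
    by (rule product_error)
       (use hyp_asympD[OF F k(2), of 0] hyp_asympD[OF f k(2), of L] L norm_powi_hyp_le[of 0 k "m+1" "m+1"]
         norm_powi_hyp_le[of L k n n] e in simp_all)
  \<comment> \<open>Exactly one of \<open>hyp m 0\<close> and \<open>hyp (m + 1) 0\<close> is
    \<open>1\<close>, the other is \<open>0\<close>. The surviving product has the parity of
    \<open>n + m + 1\<close> in either case.\<close>
  have "(k powi m * hyp m (k * of_real 0)) * (k powi (n + 1) * hyp (n + 1) (k * of_real L)) +
      (k powi (m + 1) * hyp (m + 1) (k * of_real 0)) * (k powi n * hyp n (k * of_real L)) =
      k powi (n + m + 1) * hyp (n + m + 1) (k * of_real L)"
    using k(3) by (cases "even n"; cases "even m") (simp_all add: hyp_def power_int_add)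
  with order_trans[OF norm_diff_triangle_ineq add_mono[OF 1 2]]
  have "norm (u (- k\<^sup>2) 0 * y1 (- k\<^sup>2) L + u1 (- k\<^sup>2) 0 * y (- k\<^sup>2) L -
      k powi (n + m + 1) * hyp (n + m + 1) (k * of_real L)) \<le> 3 * (K / norm k) * ?T + 3 * (K / norm k) * ?T"
    by (simp only:)
  then have "norm (u (- k\<^sup>2) 0 * y1 (- k\<^sup>2) L + u1 (- k\<^sup>2) 0 * y (- k\<^sup>2) L -
      k powi (n + m + 1) * hyp (n + m + 1) (k * of_real L)) \<le> 6 * (K / norm k) * ?T"
    by linarith
  \<comment> \<open>The two products contribute \<open>3 * K / norm k\<close> each; the threshold
    \<open>48 * K\<close> keeps the total below \<open>1/8\<close>, half of the lower bound for the
    leading term.\<close>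
  moreover have "6 * (K / norm k) * ?T \<le> 1/8 * ?T"
    by (rule mult_right_mono) (use e in auto)
  moreover have "?T / 4 \<le> norm (k powi (n + m + 1) * hyp (n + m + 1) (k * of_real L))"
  proof -
    have "norm k powi (n + m + 1) * (?e / 4) \<le> norm k powi (n + m + 1) * norm (hyp (n + m + 1) (k * of_real L))"
      using L(2) by (intro mult_left_mono) (auto simp: hyp_large_def)
    then show ?thesis by (simp add: norm_mult norm_power_int)
  qed
  ultimately show ?thesis
    using norm_triangle_ineq3[of "k powi (n + m + 1) * hyp (n + m + 1) (k * of_real L)"
        "u (- k\<^sup>2) 0 * y1 (- k\<^sup>2) L + u1 (- k\<^sup>2) 0 * y (- k\<^sup>2) L"]
      norm_minus_commute[of "k powi (n + m + 1) * hyp (n + m + 1) (k * of_real L)"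
        "u (- k\<^sup>2) 0 * y1 (- k\<^sup>2) L + u1 (- k\<^sup>2) 0 * y (- k\<^sup>2) L"] by linarith
qed

text \<open>Equal parities give \<open>0\<close>, different ones \<open>1\<close> or
  \<open>- 1\<close> by \<open>cosh\<^sup>2 - sinh\<^sup>2 = 1\<close>. This cancellation removes
  the exponential from the leading term of the Wronskian.\<close>

lemma hyp_wronskian_le: "norm (hyp m w * hyp (n + 1) w - hyp (m + 1) w * hyp n w) \<le> 1"
  using cosh_square_eq[of w] by (auto simp: hyp_def power2_eq_square)

lemma wronskian_upper:
  assumes f: "hyp_asymp L m y y1 K" and F: "hyp_asymp L n u u1 K" and K: "0 < K" "K \<le> norm k"
    and x: "x \<in> {0..L}"
  shows "norm (y (- k\<^sup>2) x * u1 (- k\<^sup>2) x - y1 (- k\<^sup>2) x * u (- k\<^sup>2) x) \<le>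
    norm k powi (m + n + 1) * (1 + 6 * K * exp (\<bar>Re k\<bar> * (2 * x)) / norm k)"
proof -
  let ?e = "exp (\<bar>Re k\<bar> * x)" and ?E = "exp (\<bar>Re k\<bar> * (2 * x))"
  let ?T = "norm k powi (m + n + 1)"
  have k: "norm k > 0" "k \<noteq> 0" using K by auto
  have e: "0 \<le> K / norm k" "K / norm k \<le> 1" using K k by (auto simp: field_simps)
  have E: "?E = ?e * ?e" by (simp add: exp_add[symmetric])
  have T: "(norm k powi m * ?e) * (norm k powi (n + 1) * ?e) = ?T * ?E"
     "(norm k powi (m + 1) * ?e) * (norm k powi n * ?e) = ?T * ?E"
    unfolding E using k(1) by (simp_all add: power_int_add field_simps)
  have x0: "0 \<le> x" using x by simp
  have 1: "norm (y (- k\<^sup>2) x * u1 (- k\<^sup>2) x - (k powi m * hyp m (k * of_real x)) * (k powi (n + 1) * hyp (n + 1) (k * of_real x)))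
      \<le> 3 * (K / norm k) * (?T * ?E)"
    unfolding T(1)[symmetric]
    by (rule product_error[OF hyp_asympD(1)[OF f K(2) x] norm_powi_hyp_le[OF x0] hyp_asympD(2)[OF F K(2) x] norm_powi_hyp_le[OF x0] e])
  have 2: "norm (y1 (- k\<^sup>2) x * u (- k\<^sup>2) x - (k powi (m + 1) * hyp (m + 1) (k * of_real x)) * (k powi n * hyp n (k * of_real x)))
      \<le> 3 * (K / norm k) * (?T * ?E)"
    unfolding T(2)[symmetric]
    by (rule product_error[OF hyp_asympD(2)[OF f K(2) x] norm_powi_hyp_le[OF x0] hyp_asympD(1)[OF F K(2) x] norm_powi_hyp_le[OF x0] e])
  let ?W = "(k powi m * hyp m (k * of_real x)) * (k powi (n + 1) * hyp (n + 1) (k * of_real x)) -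
      (k powi (m + 1) * hyp (m + 1) (k * of_real x)) * (k powi n * hyp n (k * of_real x))"
  have "?W = k powi (m + n + 1) *
      (hyp m (k * of_real x) * hyp (n + 1) (k * of_real x) - hyp (m + 1) (k * of_real x) * hyp n (k * of_real x))"
    using k(2) by (simp add: power_int_add algebra_simps)
  then have W: "norm ?W \<le> ?T"
    using mult_left_mono[OF hyp_wronskian_le[of m "k * of_real x" n], of ?T]
    by (simp add: norm_mult norm_power_int)
  have "norm (y (- k\<^sup>2) x * u1 (- k\<^sup>2) x - y1 (- k\<^sup>2) x * u (- k\<^sup>2) x - ?W) \<le> 6 * (K / norm k) * (?T * ?E)"
    using norm_diff_diff_le[OF 1 2] by simp
  then have "norm (y (- k\<^sup>2) x * u1 (- k\<^sup>2) x - y1 (- k\<^sup>2) x * u (- k\<^sup>2) x) \<le> ?T + 6 * (K / norm k) * (?T * ?E)"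
    using W norm_triangle_ineq2[of "y (- k\<^sup>2) x * u1 (- k\<^sup>2) x - y1 (- k\<^sup>2) x * u (- k\<^sup>2) x" ?W] by linarith
  also have "\<dots> = ?T * (1 + 6 * K * ?E / norm k)" by (simp add: algebra_simps)
  finally show ?thesis .
qed

lemma absolutely_integrable_reflect_at:
  fixes p :: "real \<Rightarrow> real"
  assumes "p absolutely_integrable_on {0..L}" "0 \<le> L"
  shows "(\<lambda>t. p (L - t)) absolutely_integrable_on {0..L}"
proof -
  have "ac_on L (\<lambda>x. 0 + integral {0..x} p) p" by (rule ac_on_integral[OF assms(1)])
  from ac_on_absolutely_integrable[OF ac_on_reflect[OF this assms(2)]]
  have "(\<lambda>t. - p (L - t)) absolutely_integrable_on {0..L}" .
  from absolutely_integrable_linear[OF this bounded_linear_minus[OF bounded_linear_ident]]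
  show ?thesis by (simp add: o_def)
qed

text \<open>The boundary condition makes the Cauchy data at the right end point proportional, and
  uniqueness spreads the factor over the interval; it is nonzero because the eigenfunction
  is.\<close>

lemma eigenfunction_reflect:
  assumes q: "q absolutely_integrable_on {0..L}" and L: "0 \<le> L" and F: "F \<in> class_R"
    and u: "bc_sol L (\<lambda>t. q (L - t)) F u u1"
    and y: "sol L q z y y1" "\<exists>x\<in>{0..L}. y x \<noteq> 0"
    and bc: "cpoly (down F) z * y1 L - cpoly (up F) z * y L = 0"
  obtains r where "r \<noteq> 0" "\<And>x. x \<in> {0..L} \<Longrightarrow> y (L - x) = r * u z x"
    "\<And>x. x \<in> {0..L} \<Longrightarrow> - y1 (L - x) = r * u1 z x"
proof -
  have "cpoly (down F) z * y1 L = cpoly (up F) z * y L" using bc by simp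
  then obtain r where r: "y L = r * cpoly (down F) z" "y1 L = r * cpoly (up F) z"
    using proportional[of "cpoly (down F) z" "y1 L" "cpoly (up F) z" "y L"]
      down_up_no_common_zero[OF F] by blast
  have u': "sol L (\<lambda>t. q (L - t)) z (u z) (u1 z)" "u z 0 = cpoly (down F) z" "u1 z 0 = - cpoly (up F) z"
    using u by (auto simp: bc_sol_def)
  have eq: "y (L - x) = r * u z x" "- y1 (L - x) = r * u1 z x" if x: "x \<in> {0..L}" for x
    by (rule sol_unique[OF absolutely_integrable_reflect_at[OF q L] sol_reflect[OF y(1) L] sol_scale[OF u'(1)] _ _ x];
        simp add: r u')+
  obtain x where x: "x \<in> {0..L}" "y x \<noteq> 0" using y(2) by blast
  have "y x = r * u z (L - x)" using eq(1)[of "L - x"] x(1) by simp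
  then have "r \<noteq> 0" using x(2) by auto
  then show ?thesis using that eq by blast
qed

lemma weyl_functions_agree:
  fixes q q' :: "real \<Rightarrow> real"
  assumes q: "q absolutely_integrable_on {0..pi}" and q': "q' absolutely_integrable_on {0..pi}"
    and f: "f \<in> class_R" and F: "F \<in> class_R" and F': "F' \<in> class_R" and ind: "ind F \<le> ind f"
    and ae: "AE x in lebesgue_on {0..pi / 2}. q x = q' x"
    and ev: "\<And>z. is_eigenvalue q' f F' z \<Longrightarrow> is_eigenvalue q f F z \<and> z \<in> \<real>"
    and Y: "bc_sol pi (\<lambda>t. q (pi - t)) F Y Y1" and Y': "bc_sol pi (\<lambda>t. q' (pi - t)) F' Y' Y1'"
  shows "Y z (pi / 2) * Y1' z (pi / 2) - Y1 z (pi / 2) * Y' z (pi / 2) = 0"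
proof -
  obtain \<phi> \<phi>1 where \<phi>: "bc_sol pi q' f \<phi> \<phi>1" using bc_sol_exists[OF q'] by (metis pi_ge_zero)
  define X where "X = (\<lambda>z. cpoly (down F') z * \<phi>1 z pi - cpoly (up F') z * \<phi> z pi)"
  define H where "H = (\<lambda>z. Y z (pi / 2) * Y1' z (pi / 2) - Y1 z (pi / 2) * Y' z (pi / 2))"
  note p = absolutely_integrable_reflect_at[OF q pi_ge_zero] absolutely_integrable_reflect_at[OF q' pi_ge_zero]
  have mid: "pi / 2 \<in> {0..pi}" "pi \<in> {0..pi}" by auto
  have holH: "H holomorphic_on UNIV" unfolding H_def
    by (intro holomorphic_on_diff holomorphic_on_mult bc_sol_holomorphic[OF p(1) Y mid(1)]
        bc_sol_holomorphic[OF p(2) Y' mid(1)])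
  have pol: "cpoly P holomorphic_on UNIV" for P by (intro holomorphic_intros)
  have holX: "X holomorphic_on UNIV" unfolding X_def
    by (intro holomorphic_on_diff holomorphic_on_mult bc_sol_holomorphic[OF q' \<phi> mid(2)] pol)
  have zero: "H w = 0 \<and> deriv X w \<noteq> 0" if w: "X w = 0" for w
  proof
    have "is_eigenvalue q' f F' w"
      by (rule characteristic_zero_imp_eigenvalue[OF f \<phi>]) (use w in \<open>simp add: X_def\<close>)
    then have w': "is_eigenvalue q f F w" "w \<in> \<real>" using ev by blast+
    then obtain x where x: "w = of_real x" by (auto elim: Reals_cases)
    show "deriv X w \<noteq> 0"
      using characteristic_simple_zero[OF q' pi_gt_zero f F' \<phi>, of x] w
      unfolding X_def x by blast
    obtain y y1 where y: "sol pi q w y y1" "\<exists>x\<in>{0..pi}. y x \<noteq> 0"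
        "cpoly (down f) w * y1 0 + cpoly (up f) w * y 0 = 0"
        "cpoly (down F) w * y1 pi - cpoly (up F) w * y pi = 0"
      using w'(1) unfolding is_eigenvalue_def is_solution_iff_sol by blast
    obtain r where r: "r \<noteq> 0" "\<And>x. x \<in> {0..pi} \<Longrightarrow> y (pi - x) = r * Y w x"
        "\<And>x. x \<in> {0..pi} \<Longrightarrow> - y1 (pi - x) = r * Y1 w x"
      using eigenfunction_reflect[OF q pi_ge_zero F Y y(1,2,4)] by blast
    have phi: "sol pi q' w (\<phi> w) (\<phi>1 w)" "\<phi> w 0 = cpoly (down f) w" "\<phi>1 w 0 = - cpoly (up f) w"
      using \<phi> by (auto simp: bc_sol_def)
    obtain r' where r': "r' \<noteq> 0" "\<And>x. x \<in> {0..pi} \<Longrightarrow> \<phi> w (pi - x) = r' * Y' w x"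
        "\<And>x. x \<in> {0..pi} \<Longrightarrow> - \<phi>1 w (pi - x) = r' * Y1' w x"
      using eigenfunction_reflect[OF q' pi_ge_zero F' Y' phi(1) bc_sol_nontrivial[OF f \<phi> pi_gt_zero]] w
      unfolding X_def by blast
    have half: "pi / 2 \<in> {0..pi / 2}" "pi / 2 \<le> pi" by auto
    \<comment> \<open>On the left half \<open>y\<close> also solves the equation with
      \<open>q'\<close>. Its Wronskian with \<open>\<phi> w\<close> is constant up to the midpoint
      and vanishes at \<open>0\<close> by the common boundary condition.\<close>
    have "sol (pi / 2) q' w y y1"
      by (rule sol_AE[OF sol_subset[OF y(1) half(2)] ae])
    from sol_wronskian_eq[OF this sol_subset[OF phi(1) half(2)] half(1)]
    have "y (pi / 2) * \<phi>1 w (pi / 2) - y1 (pi / 2) * \<phi> w (pi / 2) = 0"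
      using y(3) unfolding phi by algebra
    moreover have "y (pi / 2) = r * Y w (pi / 2)" "y1 (pi / 2) = - (r * Y1 w (pi / 2))"
      "\<phi> w (pi / 2) = r' * Y' w (pi / 2)" "\<phi>1 w (pi / 2) = - (r' * Y1' w (pi / 2))"
      using r(2,3)[OF mid(1)] r'(2,3)[OF mid(1)] by (simp_all add: minus_equation_iff[of "_ (pi / 2)"])
    ultimately have "r * r' * H w = 0" unfolding H_def by algebra
    then show "H w = 0" using r(1) r'(1) by simp
  qed
  obtain Q where Q: "Q holomorphic_on UNIV" "\<And>z. H z = Q z * X z"
    using entire_quotient[OF holH holX zero] by blast
  obtain K1 where K1: "1 \<le> K1" "hyp_asymp pi (ind F) Y Y1 K1"
    by (rule bc_sol_asymp[OF p(1) pi_ge_zero F Y])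
  obtain K2 where K2: "1 \<le> K2" "hyp_asymp pi (ind F') Y' Y1' K2"
    by (rule bc_sol_asymp[OF p(2) pi_ge_zero F' Y'])
  obtain K3 where K3: "1 \<le> K3" "hyp_asymp pi (ind f) \<phi> \<phi>1 K3"
    by (rule bc_sol_asymp[OF q' pi_ge_zero f \<phi>])
  define K where "K = max K1 (max K2 K3)"
  have K: "1 \<le> K" using K1(1) by (simp add: K_def)
  have as: "hyp_asymp pi (ind F) Y Y1 K" "hyp_asymp pi (ind F') Y' Y1' K" "hyp_asymp pi (ind f) \<phi> \<phi>1 K"
    by (rule hyp_asymp_mono[OF K1(2,1)] hyp_asymp_mono[OF K2(2,1)] hyp_asymp_mono[OF K3(2,1)]; simp add: K_def)+
  have Qle: "norm (Q (- k\<^sup>2)) \<le> 8 * (exp (- \<bar>Re k\<bar> * pi) + 6 * K / norm k)"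
    if k: "48 * K \<le> norm k" "hyp_large pi k" for k
  proof -
    let ?e = "exp (\<bar>Re k\<bar> * pi)" and ?n = "ind f" and ?m = "ind F" and ?m' = "ind F'"
    have k1: "1 \<le> norm k" using k(1) K by linarith
    have "X (- k\<^sup>2) = Y' (- k\<^sup>2) 0 * \<phi>1 (- k\<^sup>2) pi + Y1' (- k\<^sup>2) 0 * \<phi> (- k\<^sup>2) pi"
      using Y' by (simp add: X_def bc_sol_def)
    then have lower: "norm k powi (?n + ?m' + 1) * ?e / 8 \<le> norm (X (- k\<^sup>2))"
      using characteristic_lower[OF as(3,2) _ k(1) pi_ge_zero k(2)] K by simp
    have pos: "norm k powi (?n + ?m' + 1) > 0"
      by (rule zero_less_power_int) (use k1 in linarith)
    then have Xpos: "0 < norm k powi (?n + ?m' + 1) * ?e / 8" by simp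
    have "norm (H (- k\<^sup>2)) \<le> norm k powi (?m + ?m' + 1) * (1 + 6 * K * exp (\<bar>Re k\<bar> * (2 * (pi / 2))) / norm k)"
      unfolding H_def by (rule wronskian_upper[OF as(1,2) _ _ mid(1)]) (use K k in auto)
    also have "\<dots> \<le> norm k powi (?n + ?m' + 1) * (1 + 6 * K * ?e / norm k)"
      using k1 K ind by (intro mult_mono power_int_increasing) auto
    finally have upper: "norm (H (- k\<^sup>2)) \<le> norm k powi (?n + ?m' + 1) * (1 + 6 * K * ?e / norm k)" .
    have "norm (Q (- k\<^sup>2)) = norm (H (- k\<^sup>2)) / norm (X (- k\<^sup>2))"
    proof -
      have "0 < norm (X (- k\<^sup>2))" using Xpos lower by (rule less_le_trans)
      then show ?thesis unfolding Q(2) norm_mult by simp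
    qed
    also have "\<dots> \<le> norm k powi (?n + ?m' + 1) * (1 + 6 * K * ?e / norm k) / (norm k powi (?n + ?m' + 1) * ?e / 8)"
      by (rule frac_le[OF _ upper Xpos lower]) (use K k1 pos in auto)
    also have "\<dots> = 8 * (1 / ?e + 6 * K / norm k)"
    proof -
      have "T * (1 + 6 * K * e / s) / (T * e / 8) = 8 * (1 / e + 6 * K / s)"
        if "T > 0" "e > 0" "s > 0" for T e s :: real
        using that by (simp add: field_simps)
      from this[OF pos, of ?e "norm k"] show ?thesis using less_le_trans[OF zero_less_one k1]
        by (simp only: exp_gt_zero simp_thms)
    qed
    also have "1 / ?e = exp (- \<bar>Re k\<bar> * pi)" by (simp add: exp_minus field_simps)
    finally show ?thesis .
  qed
  have "Q z = 0" for z
  proof (rule entire_zero_of_bounded[OF Q(1) pi_gt_zero])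
    fix k assume k: "48 * K \<le> norm k" "hyp_large pi k"
    have "0 < norm k" "6 * K \<le> norm k" using k(1) K by linarith+
    then have "6 * K / norm k \<le> 1" by simp
    then have "8 * (exp (- \<bar>Re k\<bar> * pi) + 6 * K / norm k) \<le> 8 * (1 + 1)"
      by (intro mult_left_mono add_mono) simp_all
    with Qle[OF k] show "norm (Q (- k\<^sup>2)) \<le> 16" by simp
  next
    show "((\<lambda>t. Q (- of_real (t\<^sup>2))) \<longlongrightarrow> 0) at_top"
    proof (rule Lim_null_comparison)
      show "\<forall>\<^sub>F t in at_top. norm (Q (- of_real (t\<^sup>2))) \<le> 8 * (exp (- t * pi) + 6 * K / t)"
        using eventually_ge_at_top[of "48 * K"]
      proof eventually_elim
        case (elim t)
        have "1 \<le> pi * t" using elim K pi_gt3 mult_mono[of 1 pi 1 t] by simp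
        then have "hyp_large pi (of_real t)" using hyp_large_of_real[of pi t] elim K by simp
        from Qle[OF _ this] elim K show ?case by simp
      qed
      show "((\<lambda>t. 8 * (exp (- t * pi) + 6 * K / t)) \<longlongrightarrow> 0) at_top"
        by real_asymp
    qed
  qed
  then show ?thesis using Q(2)[of z] by (simp add: H_def)
qed

section \<open>Uniqueness from the Weyl function\<close>

lemma sigma_finite_lebesgue: "sigma_finite_measure (lebesgue :: real measure)"
proof
  let ?A = "range (\<lambda>n::nat. {- real n..real n})"
  have "(\<Union>n::nat. {- real n..real n}) = UNIV"
  proof (rule UNIV_eq_I[symmetric])
    fix x :: real
    obtain n :: nat where "\<bar>x\<bar> \<le> real n" using real_arch_simple by blast
    then show "x \<in> (\<Union>n::nat. {- real n..real n})" by (auto intro!: exI[of _ n])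
  qed
  then have "countable ?A \<and> ?A \<subseteq> sets lebesgue \<and> \<Union>?A = space lebesgue \<and> (\<forall>a\<in>?A. emeasure lebesgue a \<noteq> \<infinity>)"
    by (auto simp: emeasure_lborel_Icc_eq)
  then show "\<exists>A::real set set. countable A \<and> A \<subseteq> sets lebesgue \<and> \<Union>A = space lebesgue \<and>
      (\<forall>a\<in>A. emeasure lebesgue a \<noteq> \<infinity>)" by blast
qed

text \<open>The integrals over the half-lines \<open>{..a}\<close> vanish. These sets form an
  intersection-stable generator, so the integral vanishes on all Borel sets, then on all Lebesgue
  sets, and such a density is \<open>0\<close> almost everywhere.\<close>

lemma AE_zero_of_indefinite_integral:
  fixes g :: "real \<Rightarrow> complex"
  assumes g: "g absolutely_integrable_on {0..L}"
    and zero: "\<And>x. x \<in> {0..L} \<Longrightarrow> (g has_integral 0) {0..x}"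
  shows "AE x in lebesgue_on {0..L}. g x = 0"
proof (cases "0 \<le> L")
  case False
  then show ?thesis by (simp add: AE_restrict_space_iff)
next
  case L: True
  define f where "f = (\<lambda>x. indicat_real {0..L} x *\<^sub>R g x)"
  have f: "integrable lebesgue f" using g by (simp add: f_def set_integrable_def)
  have si: "set_integrable lebesgue A f" if "A \<in> sets lebesgue" for A
    unfolding set_integrable_def by (rule integrable_mult_indicator[OF that f])
  have ind: "f = (\<lambda>x. if x \<in> {0..L} then g x else 0)" by (auto simp: f_def)
  have I: "(LINT x:A|lebesgue. f x) = integral ({0..L} \<inter> A) g" if "A \<in> sets lebesgue" for A
  proof -
    have "(LINT x:A|lebesgue. f x) = integral A f"
      by (rule set_lebesgue_integral_eq_integral(2)[OF si[OF that]])
    also have "\<dots> = integral ({0..L} \<inter> A) g"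
      unfolding ind by (rule Henstock_Kurzweil_Integration.integral_restrict_Int)
    finally show ?thesis .
  qed
  have all: "(LINT x:UNIV|lebesgue. f x) = 0"
    using I[of UNIV] integral_unique[OF zero[of L]] L by simp
  have leb: "A \<in> sets lebesgue" if "A \<in> sets borel" for A :: "real set"
    using that by simp
  have Z: "(LINT x:A|lebesgue. f x) = 0" if "A \<in> sets borel" for A
  proof -
    have A: "A \<in> sigma_sets UNIV (range (\<lambda>a. {..a::real}))"
      using that by (simp add: borel_eq_atMost)
    have sub: "B \<in> sets borel" if "B \<in> sigma_sets UNIV (range (\<lambda>a. {..a::real}))" for B
      using that by (simp add: borel_eq_atMost)
    have "Int_stable (range (\<lambda>a. {..a::real}))" by (auto simp: Int_stable_def)
    moreover have "range (\<lambda>a. {..a::real}) \<subseteq> Pow UNIV" by simp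
    ultimately show ?thesis using A
    proof (induction rule: sigma_sets_induct_disjoint)
      case (basic B)
      then obtain a where a: "B = {..a}" by auto
      have "B \<in> sets lebesgue" unfolding a by simp
      moreover have "integral ({0..L} \<inter> {..a}) g = 0"
      proof (cases "0 \<le> a")
        case True
        then have "{0..L} \<inter> {..a} = {0..min a L}" by auto
        then show ?thesis using integral_unique[OF zero[of "min a L"]] True L by simp
      next
        case False
        then have "{0..L} \<inter> {..a} = {}" by auto
        then show ?thesis by simp
      qed
      ultimately show ?case using I[of B] a by simp
    next
      case (compl B)
      have B: "B \<in> sets lebesgue" "UNIV - B \<in> sets lebesgue"
        using leb[OF sub[OF compl(1)]] by auto
      have "(LINT x:B \<union> (UNIV - B)|lebesgue. f x) = (LINT x:B|lebesgue. f x) + (LINT x:UNIV - B|lebesgue. f x)"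
        by (rule set_integral_Un[OF _ si[OF B(1)] si[OF B(2)]]) auto
      then show ?case using all compl by (simp add: Un_absorb1)
    next
      case (union B)
      have B: "B i \<in> sets lebesgue" for i using union(2) sub leb by blast
      have "(LINT x:(\<Union>i. B i)|lebesgue. f x) = (\<Sum>i. (LINT x:(B i)|lebesgue. f x))"
      proof (rule lebesgue_integral_countable_add[OF B])
        show "i \<noteq> j \<Longrightarrow> B i \<inter> B j = {}" for i j
          using union(1) by (auto simp: disjoint_family_on_def)
        show "set_integrable lebesgue (\<Union>i. B i) f" using B by (intro si) auto
      qed
      then show ?case using union(3) by simp
    qed (simp add: set_lebesgue_integral_def)
  qed
  have "(LINT x:A|lebesgue. f x) = 0" if A: "A \<in> sets lebesgue" for A
  proof -
    \<comment> \<open>A Lebesgue set differs from a Borel set by a null set, which does not affect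
      the integral.\<close>
    obtain S N N' where S: "A = S \<union> N" "N \<subseteq> N'" "N' \<in> null_sets lborel" "S \<in> sets lborel"
      using sets_completionE[OF A] .
    have S': "S \<in> sets lebesgue" using S(4) by simp
    have N': "N' \<in> null_sets lebesgue" using S(3) by (rule null_sets_completionI)
    have N: "(A - S) \<union> (S - A) \<in> null_sets lebesgue"
      by (rule null_sets_completion_subset[OF _ N']) (use S(1,2) in auto)
    show ?thesis
      using set_integral_null_delta[OF f A S' N] Z S(4) by simp
  qed
  then have "AE x in lebesgue. f x = 0" by (rule sigma_finite_measure.density_zero[OF sigma_finite_lebesgue f])
  then have "AE x in lebesgue. x \<in> {0..L} \<longrightarrow> g x = 0"
    by eventually_elim (auto simp: ind)
  then show ?thesis by (simp add: AE_restrict_space_iff)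
qed

lemma ac_on_derivative_unique:
  fixes u :: "real \<Rightarrow> complex"
  assumes "ac_on L u g" "ac_on L u h" "continuous_on {0..L} g" "continuous_on {0..L} h" "0 < L"
    and "x \<in> {0..L}"
  shows "g x = h x"
proof -
  have "(u has_vector_derivative k x) (at x within {0..L})"
    if k: "ac_on L u k" "continuous_on {0..L} k" for k
  proof -
    have "((\<lambda>x. integral {0..x} k) has_vector_derivative k x) (at x within {0..L})"
      by (rule integral_has_vector_derivative[OF k(2) assms(6)])
    then have "((\<lambda>x. u 0 + integral {0..x} k) has_vector_derivative 0 + k x) (at x within {0..L})"
      by (intro has_vector_derivative_add has_vector_derivative_const)
    then have D: "((\<lambda>x. u 0 + integral {0..x} k) has_vector_derivative k x) (at x within {0..L})"
      by simp
    have "u x = u 0 + integral {0..x} k" if "x \<in> {0..L}" for x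
      using k(1) that integral_unique[of k "u x - u 0"] by (auto simp: ac_on_def)
    then show ?thesis
      by (rule has_vector_derivative_transform[OF assms(6) _ D])
  qed
  from vector_derivative_unique_within_closed_interval[unfolded box_real, OF assms(5) _ this[OF assms(1,3)] this[OF assms(2,4)]]
  show ?thesis using assms(6) by simp
qed

text \<open>Equal solutions have equal derivatives, so \<open>(p - p') * y\<close> has indefinite
  integral \<open>0\<close>; as \<open>y\<close> has no zeros, it can be cancelled.\<close>

lemma potential_AE_unique:
  fixes p p' :: "real \<Rightarrow> real"
  assumes p: "p absolutely_integrable_on {0..L}" and p': "p' absolutely_integrable_on {0..L}" and L: "0 < L"
    and y: "sol L p z y y1" and u: "sol L p' z u u1"
    and eq: "\<And>x. x \<in> {0..L} \<Longrightarrow> y x = u x" and nz: "\<And>x. x \<in> {0..L} \<Longrightarrow> y x \<noteq> 0"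
  shows "AE x in lebesgue_on {0..L}. p x = p' x"
proof -
  have u': "ac_on L y u1" by (rule ac_on_cong[OF sol_ac[OF u]]) (auto simp: eq)
  have eq1: "y1 x = u1 x" if "x \<in> {0..L}" for x
    by (rule ac_on_derivative_unique[OF sol_ac[OF y] u' sol_continuous1[OF y] sol_continuous1[OF u] L that])
  have d: "ac_on L (\<lambda>x. y1 x - u1 x) (\<lambda>x. (of_real (p x) - z) * y x - (of_real (p' x) - z) * u x)"
    by (rule ac_on_diff[OF sol_ac1[OF y] sol_ac1[OF u]])
  have "ac_on L (\<lambda>x. 0) (\<lambda>x. of_real (p x - p' x) * y x)"
    by (rule ac_on_cong[OF d]) (auto simp: eq eq1 algebra_simps)
  then have "AE x in lebesgue_on {0..L}. of_real (p x - p' x) * y x = 0"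
    by (intro AE_zero_of_indefinite_integral) (auto simp: ac_on_def)
  moreover have "AE x in lebesgue_on {0..L}. x \<in> {0..L}" by (rule AE_I2) simp
  ultimately show ?thesis
    by eventually_elim (use nz in auto)
qed

text \<open>
  By these values, the solutions with Cauchy data \<open>(1, 0)\<close> and \<open>(0, 1)\<close> at \<open>0\<close> are \<open>bc_sol\<close> for
  \<open>Ratl 0 0 []\<close> and \<open>Infty\<close>, and the asymptotics proved for \<open>bc_sol\<close> apply to them.
\<close>

lemma cpoly_down_up_Neumann_Dirichlet:
  "cpoly (down (Ratl 0 0 [])) z = 1" "cpoly (up (Ratl 0 0 [])) z = 0"
  "cpoly (down Infty) z = 0" "cpoly (up Infty) z = - 1"
proof -
  have "map_poly complex_of_real (- 1) = - 1" "map_poly complex_of_real 1 = 1"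
    by (rule poly_eqI, simp add: coeff_map_poly)+
  then show "cpoly (down (Ratl 0 0 [])) z = 1" "cpoly (up (Ratl 0 0 [])) z = 0"
    "cpoly (down Infty) z = 0" "cpoly (up Infty) z = - 1"
    by (simp_all add: lead_norm_def cpoly_pCons)
qed

text \<open>The hypothesis says \<open>S / C = S' / C'\<close>. By the Wronskian these quotients
  have derivatives \<open>1 / C\<^sup>2\<close> and \<open>1 / C'\<^sup>2\<close>, so the squares
  agree. Since \<open>C\<close> may vanish for general \<open>z\<close>, this is carried out without
  division.\<close>

lemma potentials_agree_of_fundamental_system:
  fixes p p' :: "real \<Rightarrow> real"
  assumes p: "p absolutely_integrable_on {0..L}" and p': "p' absolutely_integrable_on {0..L}" and L: "0 < L"
    and C: "bc_sol L p (Ratl 0 0 []) C C1" and S: "bc_sol L p Infty S S1"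
    and C': "bc_sol L p' (Ratl 0 0 []) C' C1'" and S': "bc_sol L p' Infty S' S1'"
    and E: "\<And>z x. x \<in> {0..L} \<Longrightarrow> S z x * C' z x = S' z x * C z x"
  shows "AE x in lebesgue_on {0..L}. p x = p' x"
proof -
  have cls: "Ratl 0 0 [] \<in> class_R" by (simp add: class_R_def)
  have sq: "(C z x)\<^sup>2 = (C' z x)\<^sup>2" if x: "x \<in> {0..L}" for z x
  proof -
    have s: "sol L p z (C z) (C1 z)" "C z 0 = 1" "C1 z 0 = 0" "sol L p z (S z) (S1 z)" "S z 0 = 0" "S1 z 0 = 1"
      "sol L p' z (C' z) (C1' z)" "C' z 0 = 1" "C1' z 0 = 0" "sol L p' z (S' z) (S1' z)" "S' z 0 = 0" "S1' z 0 = 1"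
      using C S C' S' by (simp_all add: bc_sol_def cpoly_down_up_Neumann_Dirichlet del: down.simps up.simps)
    have W: "C z x * S1 z x - C1 z x * S z x = 1" "C' z x * S1' z x - C1' z x * S' z x = 1"
      using sol_wronskian_eq[OF s(1,4) x] sol_wronskian_eq[OF s(7,10) x] s by simp_all
    note c = sol_continuous[OF s(1)] sol_continuous[OF s(4)] sol_continuous[OF s(7)] sol_continuous[OF s(10)]
       sol_continuous1[OF s(1)] sol_continuous1[OF s(4)] sol_continuous1[OF s(7)] sol_continuous1[OF s(10)]
    have 1: "ac_on L (\<lambda>x. S z x * C' z x) (\<lambda>x. S1 z x * C' z x + S z x * C1' z x)"
      by (rule ac_on_mult[OF sol_ac[OF s(4)] sol_ac[OF s(7)]])
    have "ac_on L (\<lambda>x. S' z x * C z x) (\<lambda>x. S1' z x * C z x + S' z x * C1 z x)"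
      by (rule ac_on_mult[OF sol_ac[OF s(10)] sol_ac[OF s(1)]])
    then have 2: "ac_on L (\<lambda>x. S z x * C' z x) (\<lambda>x. S1' z x * C z x + S' z x * C1 z x)"
      by (rule ac_on_cong) (simp_all add: E)
    have "S1 z x * C' z x + S z x * C1' z x = S1' z x * C z x + S' z x * C1 z x"
      by (rule ac_on_derivative_unique[OF 1 2 _ _ L x]; intro continuous_on_add continuous_on_mult c)
    \<comment> \<open>multiply by \<open>C z x * C' z x\<close> and substitute the Wronskians\<close>
    with W E[OF x, of z] show ?thesis by algebra
  qed
  have hn: "ind (Ratl 0 0 []) = 0" by simp
  obtain K1 where K1: "1 \<le> K1" "hyp_asymp L 0 C C1 K1"
    using bc_sol_asymp[OF p _ cls C] L by (auto simp: hn)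
  obtain K2 where K2: "1 \<le> K2" "hyp_asymp L 0 C' C1' K2"
    using bc_sol_asymp[OF p' _ cls C'] L by (auto simp: hn)
  \<comment> \<open>At \<open>z = - t\<^sup>2\<close> the error is at most
    \<open>exp (t * x) / 4\<close>, while the hyperbolic cosine exceeds
    \<open>exp (t * x) / 2\<close>. Hence both \<open>C\<close> and \<open>C'\<close> have positive
    real part, which decides the sign in \<open>C\<^sup>2 = C'\<^sup>2\<close> and excludes
    zeros.\<close>
  define t where "t = 4 * max K1 K2"
  have t: "0 < t" "K1 \<le> t" "K2 \<le> t" "K1 / t \<le> 1/4" "K2 / t \<le> 1/4"
    using K1(1) K2(1) by (auto simp: t_def field_simps)
  have pos: "0 < Re (V (- (complex_of_real t)\<^sup>2) x)"
    if V: "hyp_asymp L 0 V V1 K" "K \<le> t" "K / t \<le> 1/4" and x: "x \<in> {0..L}" for V V1 K x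
  proof -
    have "norm (V (- (complex_of_real t)\<^sup>2) x - cosh (of_real t * of_real x)) \<le> K / t * exp (t * x)"
      using hyp_asympD(1)[OF V(1) _ x, of "of_real t"] V(2) t(1) by (simp add: hyp_def)
    also have "\<dots> \<le> 1/4 * exp (t * x)" by (intro mult_right_mono V) simp
    finally have "\<bar>Re (V (- (complex_of_real t)\<^sup>2) x - cosh (of_real t * of_real x))\<bar> \<le> 1/4 * exp (t * x)"
      using abs_Re_le_cmod order_trans by blast
    then have "\<bar>Re (V (- (complex_of_real t)\<^sup>2) x) - Re (cosh (complex_of_real t * of_real x))\<bar> \<le> 1/4 * exp (t * x)"
      by simp
    moreover have "Re (cosh (complex_of_real t * of_real x)) = (exp (t * x) + exp (- (t * x))) / 2"
      by (simp add: cosh_field_def Re_exp)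
    moreover have "0 < r" if "\<bar>r - c\<bar> \<le> 1/4 * e" "c = (e + e') / 2" "0 < e" "0 < e'" for r c e e' :: real
    proof -
      have "c - r \<le> 1/4 * e" using that(1) abs_ge_minus_self[of "r - c"] by linarith
      then show ?thesis using that(2-4) by argo
    qed
    ultimately show ?thesis
      using exp_gt_zero by blast
  qed
  let ?z = "- (complex_of_real t)\<^sup>2"
  show ?thesis
  proof (rule potential_AE_unique[OF p p' L])
    show "sol L p ?z (C ?z) (C1 ?z)" "sol L p' ?z (C' ?z) (C1' ?z)"
      using C C' by (simp_all only: bc_sol_def)
    fix x assume x: "x \<in> {0..L}"
    note P = pos[OF K1(2) t(2,4) x] pos[OF K2(2) t(3,5) x]
    show "C ?z x \<noteq> 0" using P(1) by auto
    have "C ?z x = C' ?z x \<or> C ?z x = - C' ?z x" using sq[OF x, of ?z] by (simp add: power2_eq_iff)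
    then show "C ?z x = C' ?z x" using P by auto
  qed
qed

text \<open>\<open>Y\<close> and \<open>Y'\<close> start at the far end point, while the fundamental
  systems start at \<open>L\<close>, where the Weyl functions agree; hence the reflected potentials.
  The quotient of a Weyl solution at \<open>L - x\<close> by its value at \<open>L\<close> decays
  like \<open>exp (- s * x)\<close>, with \<open>s = \<bar>Re k\<bar>\<close>, and so compensates
  the growth of \<open>S\<close> and \<open>S'\<close>.\<close>

lemma weyl_function_determines_potential:
  fixes p p' :: "real \<Rightarrow> real"
  assumes p: "p absolutely_integrable_on {0..L}" and p': "p' absolutely_integrable_on {0..L}" and L: "0 < L"
    and F: "F \<in> class_R" and F': "F' \<in> class_R"
    and Y: "bc_sol L p F Y Y1" and Y': "bc_sol L p' F' Y' Y1'"
    and W: "\<And>z. Y z L * Y1' z L - Y1 z L * Y' z L = 0"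
  shows "AE x in lebesgue_on {0..L}. p (L - x) = p' (L - x)"
proof -
  have L0: "0 \<le> L" using L by simp
  note r = absolutely_integrable_reflect_at[OF p L0] absolutely_integrable_reflect_at[OF p' L0]
  have cls: "Ratl 0 0 [] \<in> class_R" "Infty \<in> class_R" by (simp_all add: class_R_def)
  obtain C C1 where C: "bc_sol L (\<lambda>x. p (L - x)) (Ratl 0 0 []) C C1" by (rule bc_sol_exists[OF r(1) L0])
  obtain S S1 where S: "bc_sol L (\<lambda>x. p (L - x)) Infty S S1" by (rule bc_sol_exists[OF r(1) L0])
  obtain C' C1' where C': "bc_sol L (\<lambda>x. p' (L - x)) (Ratl 0 0 []) C' C1'" by (rule bc_sol_exists[OF r(2) L0])
  obtain S' S1' where S': "bc_sol L (\<lambda>x. p' (L - x)) Infty S' S1'" by (rule bc_sol_exists[OF r(2) L0])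
  \<comment> \<open>\<open>sol_variation\<close> with both parameters equal to \<open>z\<close> has
    no integral terms; the minus sign stems from the reflection.\<close>
  have expand: "y z (L - x) = y z L * c z x - y1 z L * s z x"
    if "(q :: real \<Rightarrow> real) absolutely_integrable_on {0..L}" "bc_sol L q g y y1"
      "bc_sol L (\<lambda>x. q (L - x)) (Ratl 0 0 []) c c1" "bc_sol L (\<lambda>x. q (L - x)) Infty s s1" "x \<in> {0..L}"
    for q g y y1 c c1 s s1 z x
  proof -
    have Z: "sol L q z (y z) (y1 z)" "sol L (\<lambda>x. q (L - x)) z (c z) (c1 z)" "c z 0 = 1" "c1 z 0 = 0"
      "sol L (\<lambda>x. q (L - x)) z (s z) (s1 z)" "s z 0 = 0" "s1 z 0 = 1"
      using that(2-4) by (simp_all add: bc_sol_def cpoly_down_up_Neumann_Dirichlet del: down.simps up.simps)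
    note ref = sol_reflect[OF Z(1) L0]
    from sol_variation(1)[OF Z(2-7) ref that(5)] show ?thesis by (simp add: algebra_simps)
  qed
  have mid: "L \<in> {0..L}" using L by simp
  define E where "E = (\<lambda>x z. S z x * C' z x - S' z x * C z x)"
  have "E x z = 0" if x: "x \<in> {0..L}" for x z
  proof -
    obtain K1 where K1: "1 \<le> K1" "hyp_asymp L (ind F) Y Y1 K1" by (rule bc_sol_asymp[OF p L0 F Y])
    obtain K2 where K2: "1 \<le> K2" "hyp_asymp L (ind F') Y' Y1' K2" by (rule bc_sol_asymp[OF p' L0 F' Y'])
    obtain K3 where K3: "1 \<le> K3" "hyp_asymp L (- 1) S S1 K3"
      using bc_sol_asymp[OF r(1) L0 cls(2) S] by auto
    obtain K4 where K4: "1 \<le> K4" "hyp_asymp L (- 1) S' S1' K4"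
      using bc_sol_asymp[OF r(2) L0 cls(2) S'] by auto
    define K where "K = max (max K1 K2) (max K3 K4)"
    have K: "1 \<le> K" using K1(1) by (simp add: K_def)
    have as: "hyp_asymp L (ind F) Y Y1 K" "hyp_asymp L (ind F') Y' Y1' K"
        "hyp_asymp L (- 1) S S1 K" "hyp_asymp L (- 1) S' S1' K"
      by (rule hyp_asymp_mono[OF K1(2,1)] hyp_asymp_mono[OF K2(2,1)] hyp_asymp_mono[OF K3(2,1)]
          hyp_asymp_mono[OF K4(2,1)]; simp add: K_def)+
    \<comment> \<open>After expansion the right-hand side contains the further term
      \<open>S * S'\<close> times the Wronskian of \<open>Y\<close> and \<open>Y'\<close> at
      \<open>L\<close>, which is \<open>0\<close> by \<open>W\<close>.\<close>
    have id: "E x z * (Y z L * Y' z L) = S z x * Y' z (L - x) * Y z L - S' z x * Y z (L - x) * Y' z L" for z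
      using W[of z] unfolding E_def expand[OF p Y C S x, of z] expand[OF p' Y' C' S' x, of z] by algebra
    \<comment> \<open>The constant \<open>32\<close> is made of two upper bounds with factor
      \<open>2\<close> and a lower bound with factor \<open>1/8\<close>.\<close>
    have quot: "norm (s (- k\<^sup>2) x * u (- k\<^sup>2) (L - x)) \<le> 32 / norm k * norm (u (- k\<^sup>2) L)"
      if "hyp_asymp L (- 1) s s1 K" "hyp_asymp L n u u1 K" "8 * K \<le> norm k" "hyp_large L k"
      for s s1 n u u1 k
    proof -
      have kK: "K \<le> norm k" "0 < K" "0 < norm k" using that(3) K by linarith+
      have Lx: "L - x \<in> {0..L}" using x by simp
      have "norm (s (- k\<^sup>2) x * u (- k\<^sup>2) (L - x)) \<le>
          (2 * (norm k powi (- 1) * exp (\<bar>Re k\<bar> * x))) * (2 * (norm k powi n * exp (\<bar>Re k\<bar> * (L - x))))"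
        unfolding norm_mult
        by (rule mult_mono[OF hyp_asymp_upper[OF that(1) kK(2,1) x] hyp_asymp_upper[OF that(2) kK(2,1) Lx]]) simp_all
      also have "\<dots> = 4 / norm k * (norm k powi n * (exp (\<bar>Re k\<bar> * x) * exp (\<bar>Re k\<bar> * (L - x))))"
        by (simp add: power_int_minus field_simps)
      also have "exp (\<bar>Re k\<bar> * x) * exp (\<bar>Re k\<bar> * (L - x)) = exp (\<bar>Re k\<bar> * L)"
        by (simp add: exp_add[symmetric] algebra_simps)
      also have "4 / norm k * (norm k powi n * exp (\<bar>Re k\<bar> * L)) =
          32 / norm k * (norm k powi n * exp (\<bar>Re k\<bar> * L) / 8)" by simp
      also have "\<dots> \<le> 32 / norm k * norm (u (- k\<^sup>2) L)"
        by (rule mult_left_mono[OF hyp_asymp_lower[OF that(2) kK(2) that(3) mid that(4)]]) simp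
      finally show ?thesis .
    qed
    have hol: "E x holomorphic_on UNIV"
      unfolding E_def
      by (intro holomorphic_on_diff holomorphic_on_mult bc_sol_holomorphic[OF r(1) C x]
          bc_sol_holomorphic[OF r(1) S x] bc_sol_holomorphic[OF r(2) C' x] bc_sol_holomorphic[OF r(2) S' x])
    show ?thesis
    proof (rule entire_zero_of_squares[OF hol L])
      fix k assume k: "8 * K \<le> norm k" "hyp_large L k"
      have kK: "0 < K" "0 < norm k" using k(1) K by linarith+
      let ?z = "- k\<^sup>2"
      have pos: "0 < norm k powi n * exp (\<bar>Re k\<bar> * L) / 8" for n
        using zero_less_power_int[OF kK(2)] by simp
      have nz: "0 < norm (Y ?z L)" "0 < norm (Y' ?z L)"
        by (rule less_le_trans[OF pos hyp_asymp_lower[OF as(1) kK(1) k(1) mid k(2)]],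
            rule less_le_trans[OF pos hyp_asymp_lower[OF as(2) kK(1) k(1) mid k(2)]])
      have "norm (E x ?z * (Y ?z L * Y' ?z L)) \<le>
          norm (S ?z x * Y' ?z (L - x)) * norm (Y ?z L) + norm (S' ?z x * Y ?z (L - x)) * norm (Y' ?z L)"
        unfolding id norm_mult[symmetric] by (rule norm_triangle_ineq4)
      also have "\<dots> \<le> 32 / norm k * norm (Y' ?z L) * norm (Y ?z L) + 32 / norm k * norm (Y ?z L) * norm (Y' ?z L)"
        by (intro add_mono mult_right_mono quot[OF as(3,2) k] quot[OF as(4,1) k]) simp_all
      also have "\<dots> = 64 / norm k * (norm (Y ?z L) * norm (Y' ?z L))" by (simp add: algebra_simps)
      finally have "norm (E x ?z) * (norm (Y ?z L) * norm (Y' ?z L)) \<le> 64 / norm k * (norm (Y ?z L) * norm (Y' ?z L))"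
        by (simp only: norm_mult)
      then show "norm (E x ?z) \<le> 64 / norm k"
        by (rule mult_right_le_imp_le) (use nz in simp)
    qed
  qed
  then have "S z x * C' z x = S' z x * C z x" if "x \<in> {0..L}" for z x
    using that by (simp add: E_def)
  then show ?thesis
    by (rule potentials_agree_of_fundamental_system[OF r L C S C' S'])
qed

lemma class_R_eqI_down_up:
  assumes F: "F \<in> class_R" and F': "F' \<in> class_R"
    and eq: "\<And>x. poly (down F) x * poly (up F') x = poly (up F) x * poly (down F') x"
  shows "F = F'"
proof -
  have nz: "poly (down (Ratl h0 h ps)) x \<noteq> 0" if "x \<notin> poles (Ratl h0 h ps)" for h0 h ps x
  proof -
    have "fst (ps ! k) - x \<noteq> 0" if "k < length ps" for k
      using \<open>x \<notin> poles (Ratl h0 h ps)\<close> nth_mem[OF that] by auto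
    moreover have "lead_norm h0 \<noteq> 0" by (simp add: lead_norm_def)
    ultimately show ?thesis by (simp add: poly_prod)
  qed
  have fin: "finite (poles G)" for G by (cases G) auto
  have ex: "\<exists>x. x \<notin> poles G" for G
    using fin[of G] ex_new_if_finite[OF infinite_UNIV_char_0, of "poles G"] by blast
  show ?thesis
  proof (cases F)
    case Infty
    have "poly (down F') x = 0" for x using eq[of x] by (simp add: Infty)
    then show ?thesis using ex[of F'] nz Infty by (cases F') (metis, metis)
  next
    case R: (Ratl h0 h ps)
    show ?thesis
    proof (cases F')
      case Infty
      have "poly (down F) x = 0" for x using eq[of x] by (simp add: Infty)
      then show ?thesis using ex[of F] nz R by metis
    next
      case R': (Ratl h0' h' ps')
      show ?thesis
      proof (rule class_R_eqI[OF F F'])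
        fix x assume x: "x \<notin> poles F \<union> poles F'"
        have "poly (up F) x = ratval F x * poly (down F) x" "poly (up F') x = ratval F' x * poly (down F') x"
          by (rule poly_up; use x R R' in simp)+
        moreover have "poly (down F) x \<noteq> 0" "poly (down F') x \<noteq> 0"
          using x nz unfolding R R' by blast+
        ultimately show "ratval F x = ratval F' x" using eq[of x] by simp
      qed (simp_all add: R R')
    qed
  qed
qed

lemma bc_sol_subset: "bc_sol L p g y y1 \<Longrightarrow> M \<le> L \<Longrightarrow> bc_sol M p g y y1"
  unfolding bc_sol_def using sol_subset by blast

text \<open>Once the potentials agree, the Wronskian is constant and carries its zero from
  \<open>L\<close> to the end point where the data are \<open>down\<close> and \<open>up\<close>.
  Cross-multiplied equality of these polynomials identifies the coefficients.\<close>

lemma boundary_coefficients_agree: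
  assumes Y: "bc_sol L p F Y Y1" and Y': "bc_sol L p' F' Y' Y1'" and L: "0 \<le> L"
    and F: "F \<in> class_R" and F': "F' \<in> class_R"
    and W: "\<And>z. Y z L * Y1' z L - Y1 z L * Y' z L = 0"
    and ae: "AE x in lebesgue_on {0..L}. p (L - x) = p' (L - x)"
  shows "F = F'"
proof (rule class_R_eqI_down_up[OF F F'])
  fix x
  let ?z = "complex_of_real x"
  have mid: "L \<in> {0..L}" using L by simp
  have s: "sol L p ?z (Y ?z) (Y1 ?z)" "sol L p' ?z (Y' ?z) (Y1' ?z)"
    using Y Y' by (simp_all add: bc_sol_def)
  from sol_wronskian_eq[OF sol_AE[OF sol_reflect[OF s(1) L] ae] sol_reflect[OF s(2) L] mid]
  have "Y ?z 0 * Y1' ?z 0 - Y1 ?z 0 * Y' ?z 0 = 0"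
    using W[of ?z] by (simp add: algebra_simps)
  then have "cpoly (down F) ?z * cpoly (up F') ?z = cpoly (up F) ?z * cpoly (down F') ?z"
    using Y Y' by (simp add: bc_sol_def algebra_simps)
  then show "poly (down F) x * poly (up F') x = poly (up F) x * poly (down F') x"
    unfolding cpoly_of_real of_real_mult[symmetric] of_real_eq_iff .
qed

section \<open>Joining the two half intervals\<close>

lemma AE_lebesgue_on_negligible:
  "(AE x in lebesgue_on {a..b::real}. P x) \<longleftrightarrow> negligible {x\<in>{a..b}. \<not> P x}"
proof -
  have "(AE x in lebesgue_on {a..b}. P x) \<longleftrightarrow> (AE x in lebesgue. x \<in> {a..b} \<longrightarrow> P x)"
    by (simp add: AE_restrict_space_iff)
  also have "\<dots> \<longleftrightarrow> negligible {x\<in>{a..b}. \<not> P x}"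
    unfolding eventually_ae_filter_negligible by (auto intro: negligible_subset)
  finally show ?thesis .
qed

lemma AE_lebesgue_on_append:
  assumes "AE x in lebesgue_on {0..a::real}. P x" "AE x in lebesgue_on {0..b}. P (a + x)"
  shows "AE x in lebesgue_on {0..a + b}. P x"
proof -
  have "negligible ({x\<in>{0..a}. \<not> P x} \<union> (+) a ` {x\<in>{0..b}. \<not> P (a + x)})"
    using assms unfolding AE_lebesgue_on_negligible
    by (intro negligible_Un negligible_translation)
  moreover have "{x\<in>{0..a + b}. \<not> P x} \<subseteq> {x\<in>{0..a}. \<not> P x} \<union> (+) a ` {x\<in>{0..b}. \<not> P (a + x)}"
  proof
    fix x assume x: "x \<in> {x\<in>{0..a + b}. \<not> P x}"
    show "x \<in> {x\<in>{0..a}. \<not> P x} \<union> (+) a ` {x\<in>{0..b}. \<not> P (a + x)}"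
    proof (cases "x \<le> a")
      case False
      then have "x - a \<in> {x\<in>{0..b}. \<not> P (a + x)}" "x = a + (x - a)" using x by auto
      then show ?thesis by blast
    qed (use x in simp)
  qed
  ultimately show ?thesis
    unfolding AE_lebesgue_on_negligible by (rule negligible_subset)
qed

theorem theorem4p10:
  fixes q q' :: "real \<Rightarrow> real" and f F F' :: bcoeff and lam lam' :: "nat \<Rightarrow> real"
  assumes "q absolutely_integrable_on {0..pi}"
    and "q' absolutely_integrable_on {0..pi}"
    and "f \<in> class_R" and "F \<in> class_R" and "F' \<in> class_R"
    and "ind f \<ge> ind F"
    and "eigenvalue_sequence q f F lam"
    and "eigenvalue_sequence q' f F' lam'"
    and "AE x in lebesgue_on {0..pi / 2}. q x = q' x"
    and "\<And>n. lam n = lam' n"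
  shows "(AE x in lebesgue_on {0..pi}. q x = q' x) \<and> F = F'"
proof -
  note q = assms(1) and q' = assms(2) and f = assms(3) and F = assms(4) and F' = assms(5)
  note p = absolutely_integrable_reflect_at[OF q pi_ge_zero] absolutely_integrable_reflect_at[OF q' pi_ge_zero]
  obtain Y Y1 where Y: "bc_sol pi (\<lambda>t. q (pi - t)) F Y Y1" by (rule bc_sol_exists[OF p(1) pi_ge_zero])
  obtain Y' Y1' where Y': "bc_sol pi (\<lambda>t. q' (pi - t)) F' Y' Y1'" by (rule bc_sol_exists[OF p(2) pi_ge_zero])
  have "is_eigenvalue q f F z \<and> z \<in> \<real>" if "is_eigenvalue q' f F' z" for z
  proof -
    have "z \<in> range (\<lambda>n. complex_of_real (lam' n))"
      using assms(8) that unfolding eigenvalue_sequence_def by blast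
    then have "z \<in> range (\<lambda>n. complex_of_real (lam n))" "z \<in> \<real>" using assms(10) by auto
    then show ?thesis using assms(7) unfolding eigenvalue_sequence_def by blast
  qed
  from weyl_functions_agree[OF q q' f F F' assms(6,9) this Y Y']
  have W: "Y z (pi / 2) * Y1' z (pi / 2) - Y1 z (pi / 2) * Y' z (pi / 2) = 0" for z .
  have half: "pi / 2 \<le> pi" "0 < pi / 2" "0 \<le> pi / 2" by simp_all
  have ph: "(\<lambda>t. q (pi - t)) absolutely_integrable_on {0..pi / 2}"
    "(\<lambda>t. q' (pi - t)) absolutely_integrable_on {0..pi / 2}"
    by (rule set_integrable_subset[OF p(1)] set_integrable_subset[OF p(2)]; use half in auto)+
  note Yh = bc_sol_subset[OF Y half(1)] bc_sol_subset[OF Y' half(1)]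
  \<comment> \<open>Two reflections are composed: \<open>t \<mapsto> pi - t\<close> puts the right
    end point at \<open>0\<close>, and \<open>x \<mapsto> pi / 2 - x\<close> starts at the midpoint.
    The argument is \<open>pi / 2 + x\<close>, which runs through the right half.\<close>
  have ae: "AE x in lebesgue_on {0..pi / 2}. q (pi - (pi / 2 - x)) = q' (pi - (pi / 2 - x))"
    by (rule weyl_function_determines_potential[OF ph half(2) F F' Yh W])
  have "F = F'"
    by (rule boundary_coefficients_agree[OF Yh half(3) F F' W ae])
  have "AE x in lebesgue_on {0..pi / 2 + pi / 2}. q x = q' x"
    by (rule AE_lebesgue_on_append[OF assms(9)]) (use ae in \<open>simp add: algebra_simps\<close>)
  then have "AE x in lebesgue_on {0..pi}. q x = q' x" unfolding field_sum_of_halves .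
  then show ?thesis using \<open>F = F'\<close> ..
qed

end
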